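(* Let $\mathcal{A}$ be a small additive category equipped with a duality functor $D:\mathcal{A}^{op}\to\mathcal{A}$, let $T$ be one of the functors $SD^2_\varepsilon$ or $\bar SD^2_\varepsilon$ ($\varepsilon\in\{-1,1\}$), let $\mathbf{H}(\mathcal{A})=\mathbf{H}^T(\mathcal{A})$ be the category of hermitian objects and $\pi^T:\mathbf{H}(\mathcal{A})\to\mathcal{A}$ the forgetful functor. Then $\pi^T$ induces (by precomposition with its canonical extension $\widetilde{\mathbf{H}(\mathcal{A})}\to\mathcal{A}$) an equivalence of categories $$\mathcal{P}ol_n(\mathcal{A},\mathcal{B})\xrightarrow{\simeq}\mathcal{P}ol_n(\widetilde{\mathbf{H}(\mathcal{A})},\mathcal{B})$$ for every $n\in\mathbb{N}$ and every abelian category $\mathcal{B}$.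
   Context: **Duality.** A duality functor on a small additive category $\mathcal{A}$ is a functor $D:\mathcal{A}^{op}\to\mathcal{A}$ with natural isomorphisms $\sigma_{X,Y}:\mathcal{A}(X,DY)\xrightarrow{\simeq}\mathcal{A}(Y,DX)$, such that $\sigma_{Y,X}=\sigma_{X,Y}^{-1}$ and the unit $\mathrm{Id}_{\mathcal{A}}\to D^2$ is an isomorphism. Write $\bar a=\sigma_{X,Y}(a)$. **Hermitian objects.** Let $\mathbb{Z}_\varepsilon$ be $\mathbb{Z}$ with the non-trivial element of $\mathbb{Z}/2$ acting by $\varepsilon$. Let $TD^2:\mathcal{A}^{op}\to\mathbf{Ab}$, $X\mapsto\mathcal{A}(X,DX)$, with the $\mathbb{Z}/2$-action given by $\sigma_{X,X}$. Put $\Gamma D^2_\varepsilon=\mathrm{Hom}_{\mathbb{Z}/2}(\mathbb{Z}_\varepsilon,TD^2)\subset TD^2$ and $SD^2_\varepsilon=\mathbb{Z}_\varepsilon\otimes_{\mathbb{Z}/2}TD^2$; let $\bar SD^2_\varepsilon$ be the image of the norm $N:SD^2_\varepsilon\to\Gamma D^2_\varepsilon$, $N(1\otimes x)=x+\varepsilon\bar x$. There is a natural transformation $T\to TD^2$ (norm followed by inclusion, respectively inclusion). Let $\mathcal{A}^T$ be the category of elements: objects $(A,u)$ with $u\in T(A)$, morphisms $(A,u)\to(B,v)$ the $f\in\mathcal{A}(A,B)$ with $T(f)(v)=u$. $\mathbf{H}^T(\mathcal{A})$ is the full subcategory of $\mathcal{A}^T$ of the $(A,u)$ such that the image of $u$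 in $TD^2(A)=\mathcal{A}(A,DA)$ is invertible; $\pi^T$ is $(A,u)\mapsto A$. It is symmetric monoidal for the orthogonal sum: $(A,x)\oplus(B,y)$ is $A\oplus B$ with the image of $(x,y)$ under the canonical map $T(A)\oplus T(B)\to T(A\oplus B)$; its unit $(0,0)$ is an initial object. $\mathcal{A}$ is symmetric monoidal for the direct sum. (Symmetric monoidal categories are regarded as strict.) **The category $\widetilde{\mathcal{M}}$.** For a small symmetric monoidal category $(\mathcal{M},\oplus,0)$ with $0$ initial, $\widetilde{\mathcal{M}}$ has the same objects and $\widetilde{\mathcal{M}}(a,b)=\mathrm{colim}_{t\in\mathcal{M}}\,\mathcal{M}(a,b\oplus t)$; the composite of the classes of $f:a\to b\oplus t$ and $g:b\to c\oplus u$ is the class of $(g\oplus t)\circ f$. It is symmetric monoidal via $\oplus$, with $0$ a null object, and there is a monoidal functor $\eta_{\mathcal{M}}:\mathcal{M}\to\widetilde{\mathcal{M}}$, the identity on objects, sending $f:a\to b$ to its class with $t=0$. Any monoidal functor $\Phi:\mathcal{M}\to\mathcal{N}$ to a symmetric monoidal category with null unit extends uniquely to a monoidal functor $\widetilde{\mathcal{M}}\to\mathcal{N}$ along $\eta_{\mathcal{M}}$: it sends the class of $f:a\to b\oplus t$ to $\Phi(a)\xrightarrow{\Phi(f)}\Phi(b)\oplus\Phi(t)\to\Phi(b)$. **Polynomial functors.** For a small symmetric monoidal category $\mathcal{N}$ whose unit is a null object and an abelian category $\mathcal{B}$, $\mathcal{P}ol_n(\mathcal{N},\mathcal{B})$ is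 the full subcategory of $\mathbf{Fct}(\mathcal{N},\mathcal{B})$ (category of functors) defined inductively by: $\{0\}$ for $n<0$; for $n\ge0$, the functors $F$ such that for every object $x$ the cokernel $\delta_x(F)$ of the map $F\to F(x\oplus-)$ induced by $0\to x$ lies in $\mathcal{P}ol_{n-1}(\mathcal{N},\mathcal{B})$. *)

theory Defs
  imports "HOL-Algebra.Free_Abelian_Groups" "HOL-Algebra.Generated_Groups"
begin

section \<open>Categories, functors, natural transformations\<close>

text \<open>
  A category is given by families of hom-sets.  Hom-sets for different pairs of objects may overlap,
  so identities and composition carry the objects as arguments:
  \<open>Cmp C a b c g f\<close> is the composite of \<open>f : a \<rightarrow> b\<close> and \<open>g : b \<rightarrow> c\<close>.
\<close>

record ('o, 'm) cat =
  Ob :: "'o set"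
  Hom :: "'o \<Rightarrow> 'o \<Rightarrow> 'm set"
  Idn :: "'o \<Rightarrow> 'm"
  Cmp :: "'o \<Rightarrow> 'o \<Rightarrow> 'o \<Rightarrow> 'm \<Rightarrow> 'm \<Rightarrow> 'm"

locale category =
  fixes C :: "('o, 'm, 'z) cat_scheme"
  assumes Idn_in: "a \<in> Ob C \<Longrightarrow> Idn C a \<in> Hom C a a"
    and Cmp_in: "\<lbrakk>a \<in> Ob C; b \<in> Ob C; c \<in> Ob C; f \<in> Hom C a b; g \<in> Hom C b c\<rbrakk>
      \<Longrightarrow> Cmp C a b c g f \<in> Hom C a c"
    and Cmp_Idn_right: "\<lbrakk>a \<in> Ob C; b \<in> Ob C; f \<in> Hom C a b\<rbrakk> \<Longrightarrow> Cmp C a a b f (Idn C a) = f"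
    and Cmp_Idn_left: "\<lbrakk>a \<in> Ob C; b \<in> Ob C; f \<in> Hom C a b\<rbrakk> \<Longrightarrow> Cmp C a b b (Idn C b) f = f"
    and Cmp_assoc: "\<lbrakk>a \<in> Ob C; b \<in> Ob C; c \<in> Ob C; d \<in> Ob C;
        f \<in> Hom C a b; g \<in> Hom C b c; h \<in> Hom C c d\<rbrakk>
      \<Longrightarrow> Cmp C a c d h (Cmp C a b c g f) = Cmp C a b d (Cmp C b c d h g) f"

definition op_cat :: "('o, 'm, 'z) cat_scheme \<Rightarrow> ('o, 'm) cat" where
  "op_cat C = \<lparr>Ob = Ob C, Hom = (\<lambda>a b. Hom C b a), Idn = Idn C,
     Cmp = (\<lambda>a b c g f. Cmp C c b a f g)\<rparr>"

definition full_subcat :: "('o, 'm, 'z) cat_scheme \<Rightarrow> 'o set \<Rightarrow> ('o, 'm) cat" where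
  "full_subcat C S = \<lparr>Ob = Ob C \<inter> S, Hom = Hom C, Idn = Idn C, Cmp = Cmp C\<rparr>"

definition is_inverse :: "('o, 'm, 'z) cat_scheme \<Rightarrow> 'o \<Rightarrow> 'o \<Rightarrow> 'm \<Rightarrow> 'm \<Rightarrow> bool" where
  "is_inverse C a b f g \<longleftrightarrow> f \<in> Hom C a b \<and> g \<in> Hom C b a \<and>
     Cmp C a b a g f = Idn C a \<and> Cmp C b a b f g = Idn C b"

definition invertible :: "('o, 'm, 'z) cat_scheme \<Rightarrow> 'o \<Rightarrow> 'o \<Rightarrow> 'm \<Rightarrow> bool" where
  "invertible C a b f \<longleftrightarrow> (\<exists>g. is_inverse C a b f g)"

definition inverse_of :: "('o, 'm, 'z) cat_scheme \<Rightarrow> 'o \<Rightarrow> 'o \<Rightarrow> 'm \<Rightarrow> 'm" where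
  "inverse_of C a b f = (THE g. is_inverse C a b f g)"

definition isomorphic :: "('o, 'm, 'z) cat_scheme \<Rightarrow> 'o \<Rightarrow> 'o \<Rightarrow> bool" where
  "isomorphic C a b \<longleftrightarrow> a \<in> Ob C \<and> b \<in> Ob C \<and> (\<exists>f. invertible C a b f)"

text \<open>
  The object and arrow maps of a functor are \<open>undefined\<close> outside the source category, so that two
  functors are equal as records iff they agree on objects and arrows.  Natural transformations are
  likewise extensional families.
\<close>

record ('o, 'm, 'p, 'n) func =
  fobj :: "'o \<Rightarrow> 'p"
  fmor :: "'o \<Rightarrow> 'o \<Rightarrow> 'm \<Rightarrow> 'n"

definition mk_func ::
    "('o, 'm, 'z) cat_scheme \<Rightarrow> ('o \<Rightarrow> 'p) \<Rightarrow> ('o \<Rightarrow> 'o \<Rightarrow> 'm \<Rightarrow> 'n) \<Rightarrow> ('o, 'm, 'p, 'n) func" where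
  "mk_func C fo fm = \<lparr>fobj = restrict fo (Ob C),
     fmor = (\<lambda>a b. if a \<in> Ob C \<and> b \<in> Ob C then restrict (fm a b) (Hom C a b) else (\<lambda>_. undefined))\<rparr>"

definition is_functor ::
    "('o, 'm, 'y) cat_scheme \<Rightarrow> ('p, 'n, 'z) cat_scheme \<Rightarrow> ('o, 'm, 'p, 'n) func \<Rightarrow> bool" where
  "is_functor C D F \<longleftrightarrow>
     F = mk_func C (fobj F) (fmor F) \<and>
     (\<forall>a\<in>Ob C. fobj F a \<in> Ob D) \<and>
     (\<forall>a\<in>Ob C. \<forall>b\<in>Ob C. \<forall>f\<in>Hom C a b. fmor F a b f \<in> Hom D (fobj F a) (fobj F b)) \<and>
     (\<forall>a\<in>Ob C. fmor F a a (Idn C a) = Idn D (fobj F a)) \<and>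
     (\<forall>a\<in>Ob C. \<forall>b\<in>Ob C. \<forall>c\<in>Ob C. \<forall>f\<in>Hom C a b. \<forall>g\<in>Hom C b c.
        fmor F a c (Cmp C a b c g f) =
        Cmp D (fobj F a) (fobj F b) (fobj F c) (fmor F b c g) (fmor F a b f))"

definition id_func :: "('o, 'm, 'z) cat_scheme \<Rightarrow> ('o, 'm, 'o, 'm) func" where
  "id_func C = mk_func C (\<lambda>a. a) (\<lambda>a b f. f)"

definition comp_func ::
    "('o, 'm, 'z) cat_scheme \<Rightarrow> ('p, 'n, 'q, 'l) func \<Rightarrow> ('o, 'm, 'p, 'n) func
      \<Rightarrow> ('o, 'm, 'q, 'l) func" where
  "comp_func C G F = mk_func C (\<lambda>a. fobj G (fobj F a))
     (\<lambda>a b f. fmor G (fobj F a) (fobj F b) (fmor F a b f))"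

definition nat_trans ::
    "('o, 'm, 'y) cat_scheme \<Rightarrow> ('p, 'n, 'z) cat_scheme
      \<Rightarrow> ('o, 'm, 'p, 'n) func \<Rightarrow> ('o, 'm, 'p, 'n) func \<Rightarrow> ('o \<Rightarrow> 'n) set" where
  "nat_trans C D F G =
     {\<alpha> \<in> (\<Pi>\<^sub>E a\<in>Ob C. Hom D (fobj F a) (fobj G a)).
        \<forall>a\<in>Ob C. \<forall>b\<in>Ob C. \<forall>f\<in>Hom C a b.
          Cmp D (fobj F a) (fobj G a) (fobj G b) (fmor G a b f) (\<alpha> a) =
          Cmp D (fobj F a) (fobj F b) (fobj G b) (\<alpha> b) (fmor F a b f)}"

definition Fct ::
    "('o, 'm, 'y) cat_scheme \<Rightarrow> ('p, 'n, 'z) cat_scheme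
      \<Rightarrow> (('o, 'm, 'p, 'n) func, 'o \<Rightarrow> 'n) cat" where
  "Fct C D = \<lparr>Ob = {F. is_functor C D F},
     Hom = nat_trans C D,
     Idn = (\<lambda>F. \<lambda>a\<in>Ob C. Idn D (fobj F a)),
     Cmp = (\<lambda>F G H \<beta> \<alpha>. \<lambda>a\<in>Ob C. Cmp D (fobj F a) (fobj G a) (fobj H a) (\<beta> a) (\<alpha> a))\<rparr>"

definition is_equivalence ::
    "('o, 'm, 'y) cat_scheme \<Rightarrow> ('p, 'n, 'z) cat_scheme \<Rightarrow> ('o, 'm, 'p, 'n) func \<Rightarrow> bool" where
  "is_equivalence C D F \<longleftrightarrow>
     category C \<and> category D \<and> is_functor C D F \<and>
     (\<exists>G. is_functor D C G \<and>
        isomorphic (Fct C C) (comp_func C G F) (id_func C) \<and>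
        isomorphic (Fct D D) (comp_func D F G) (id_func D))"


section \<open>Null objects, kernels, cokernels; additive and abelian categories\<close>

definition is_null :: "('o, 'm, 'z) cat_scheme \<Rightarrow> 'o \<Rightarrow> bool" where
  "is_null C z \<longleftrightarrow> z \<in> Ob C \<and> (\<forall>a\<in>Ob C. (\<exists>!f. f \<in> Hom C z a) \<and> (\<exists>!f. f \<in> Hom C a z))"

definition is_zero_mor :: "('o, 'm, 'z) cat_scheme \<Rightarrow> 'o \<Rightarrow> 'o \<Rightarrow> 'm \<Rightarrow> bool" where
  "is_zero_mor C a b f \<longleftrightarrow>
     (\<exists>z h k. is_null C z \<and> h \<in> Hom C a z \<and> k \<in> Hom C z b \<and> f = Cmp C a z b k h)"

definition is_cokernel ::
    "('o, 'm, 'z) cat_scheme \<Rightarrow> 'o \<Rightarrow> 'o \<Rightarrow> 'm \<Rightarrow> 'o \<Rightarrow> 'm \<Rightarrow> bool" where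
  "is_cokernel C a b f c q \<longleftrightarrow>
     c \<in> Ob C \<and> q \<in> Hom C b c \<and> is_zero_mor C a c (Cmp C a b c q f) \<and>
     (\<forall>d\<in>Ob C. \<forall>g\<in>Hom C b d. is_zero_mor C a d (Cmp C a b d g f) \<longrightarrow>
        (\<exists>!h. h \<in> Hom C c d \<and> Cmp C b c d h q = g))"

definition is_kernel ::
    "('o, 'm, 'z) cat_scheme \<Rightarrow> 'o \<Rightarrow> 'o \<Rightarrow> 'm \<Rightarrow> 'o \<Rightarrow> 'm \<Rightarrow> bool" where
  "is_kernel C a b f k i \<longleftrightarrow>
     k \<in> Ob C \<and> i \<in> Hom C k a \<and> is_zero_mor C k b (Cmp C k a b f i) \<and>
     (\<forall>d\<in>Ob C. \<forall>g\<in>Hom C d a. is_zero_mor C d b (Cmp C d a b f g) \<longrightarrow>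
        (\<exists>!h. h \<in> Hom C d k \<and> Cmp C d k a i h = g))"

definition is_mono :: "('o, 'm, 'z) cat_scheme \<Rightarrow> 'o \<Rightarrow> 'o \<Rightarrow> 'm \<Rightarrow> bool" where
  "is_mono C a b f \<longleftrightarrow> f \<in> Hom C a b \<and>
     (\<forall>d\<in>Ob C. \<forall>g\<in>Hom C d a. \<forall>h\<in>Hom C d a. Cmp C d a b f g = Cmp C d a b f h \<longrightarrow> g = h)"

definition is_epi :: "('o, 'm, 'z) cat_scheme \<Rightarrow> 'o \<Rightarrow> 'o \<Rightarrow> 'm \<Rightarrow> bool" where
  "is_epi C a b f \<longleftrightarrow> f \<in> Hom C a b \<and>
     (\<forall>d\<in>Ob C. \<forall>g\<in>Hom C b d. \<forall>h\<in>Hom C b d. Cmp C a b d g f = Cmp C a b d h f \<longrightarrow> g = h)"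

text \<open>
  The hom-groups are groups in the sense of the library, hence written multiplicatively: the sum of
  two arrows is \<open>\<otimes>\<close>, the zero arrow \<open>\<one>\<close> and the \<open>z\<close>-fold multiple the power \<open>[^] z\<close>.
  A null object and binary biproducts are chosen.
\<close>

record ('o, 'm) addcat = "('o, 'm) cat" +
  Hgrp :: "'o \<Rightarrow> 'o \<Rightarrow> 'm monoid"
  Zob :: 'o
  Sum :: "'o \<Rightarrow> 'o \<Rightarrow> 'o"
  In1 :: "'o \<Rightarrow> 'o \<Rightarrow> 'm"
  In2 :: "'o \<Rightarrow> 'o \<Rightarrow> 'm"
  Pr1 :: "'o \<Rightarrow> 'o \<Rightarrow> 'm"
  Pr2 :: "'o \<Rightarrow> 'o \<Rightarrow> 'm"

locale additive_category = category A for A :: "('o, 'm, 'z) addcat_scheme" +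
  assumes Hgrp_carrier: "\<lbrakk>a \<in> Ob A; b \<in> Ob A\<rbrakk> \<Longrightarrow> carrier (Hgrp A a b) = Hom A a b"
    and Hgrp_comm_group: "\<lbrakk>a \<in> Ob A; b \<in> Ob A\<rbrakk> \<Longrightarrow> comm_group (Hgrp A a b)"
    and Cmp_add_right: "\<lbrakk>a \<in> Ob A; b \<in> Ob A; c \<in> Ob A;
        f \<in> Hom A a b; f' \<in> Hom A a b; g \<in> Hom A b c\<rbrakk>
      \<Longrightarrow> Cmp A a b c g (f \<otimes>\<^bsub>Hgrp A a b\<^esub> f') =
          Cmp A a b c g f \<otimes>\<^bsub>Hgrp A a c\<^esub> Cmp A a b c g f'"
    and Cmp_add_left: "\<lbrakk>a \<in> Ob A; b \<in> Ob A; c \<in> Ob A;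
        f \<in> Hom A a b; g \<in> Hom A b c; g' \<in> Hom A b c\<rbrakk>
      \<Longrightarrow> Cmp A a b c (g \<otimes>\<^bsub>Hgrp A b c\<^esub> g') f =
          Cmp A a b c g f \<otimes>\<^bsub>Hgrp A a c\<^esub> Cmp A a b c g' f"
    and Zob_null: "is_null A (Zob A)"
    and Sum_in: "\<lbrakk>a \<in> Ob A; b \<in> Ob A\<rbrakk> \<Longrightarrow> Sum A a b \<in> Ob A"
    and In1_in: "\<lbrakk>a \<in> Ob A; b \<in> Ob A\<rbrakk> \<Longrightarrow> In1 A a b \<in> Hom A a (Sum A a b)"
    and In2_in: "\<lbrakk>a \<in> Ob A; b \<in> Ob A\<rbrakk> \<Longrightarrow> In2 A a b \<in> Hom A b (Sum A a b)"
    and Pr1_in: "\<lbrakk>a \<in> Ob A; b \<in> Ob A\<rbrakk> \<Longrightarrow> Pr1 A a b \<in> Hom A (Sum A a b) a"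
    and Pr2_in: "\<lbrakk>a \<in> Ob A; b \<in> Ob A\<rbrakk> \<Longrightarrow> Pr2 A a b \<in> Hom A (Sum A a b) b"
    and Pr1_In1: "\<lbrakk>a \<in> Ob A; b \<in> Ob A\<rbrakk>
      \<Longrightarrow> Cmp A a (Sum A a b) a (Pr1 A a b) (In1 A a b) = Idn A a"
    and Pr2_In2: "\<lbrakk>a \<in> Ob A; b \<in> Ob A\<rbrakk>
      \<Longrightarrow> Cmp A b (Sum A a b) b (Pr2 A a b) (In2 A a b) = Idn A b"
    and Pr2_In1: "\<lbrakk>a \<in> Ob A; b \<in> Ob A\<rbrakk>
      \<Longrightarrow> Cmp A a (Sum A a b) b (Pr2 A a b) (In1 A a b) = \<one>\<^bsub>Hgrp A a b\<^esub>"
    and Pr1_In2: "\<lbrakk>a \<in> Ob A; b \<in> Ob A\<rbrakk>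
      \<Longrightarrow> Cmp A b (Sum A a b) a (Pr1 A a b) (In2 A a b) = \<one>\<^bsub>Hgrp A b a\<^esub>"
    and In_Pr: "\<lbrakk>a \<in> Ob A; b \<in> Ob A\<rbrakk>
      \<Longrightarrow> Cmp A (Sum A a b) a (Sum A a b) (In1 A a b) (Pr1 A a b)
          \<otimes>\<^bsub>Hgrp A (Sum A a b) (Sum A a b)\<^esub>
          Cmp A (Sum A a b) b (Sum A a b) (In2 A a b) (Pr2 A a b) = Idn A (Sum A a b)"

locale abelian_category = additive_category B for B :: "('o, 'm, 'z) addcat_scheme" +
  assumes has_kernel: "\<lbrakk>a \<in> Ob B; b \<in> Ob B; f \<in> Hom B a b\<rbrakk> \<Longrightarrow> \<exists>k i. is_kernel B a b f k i"
    and has_cokernel: "\<lbrakk>a \<in> Ob B; b \<in> Ob B; f \<in> Hom B a b\<rbrakk> \<Longrightarrow> \<exists>c q. is_cokernel B a b f c q"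
    and mono_normal: "\<lbrakk>a \<in> Ob B; b \<in> Ob B; is_mono B a b f\<rbrakk>
      \<Longrightarrow> \<exists>c\<in>Ob B. \<exists>g\<in>Hom B b c. is_kernel B b c g a f"
    and epi_normal: "\<lbrakk>a \<in> Ob B; b \<in> Ob B; is_epi B a b f\<rbrakk>
      \<Longrightarrow> \<exists>c\<in>Ob B. \<exists>g\<in>Hom B c a. is_cokernel B c a g b f"


section \<open>Symmetric monoidal categories and the category \<open>tilde M\<close>\<close>

text \<open>
  The coherence isomorphisms are part of the data (direct sums are not strictly associative):
  \<open>Asc a b c : (a \<oplus> b) \<oplus> c \<rightarrow> a \<oplus> (b \<oplus> c)\<close>, \<open>Lun a : 0 \<oplus> a \<rightarrow> a\<close>, \<open>Run a : a \<oplus> 0 \<rightarrow> a\<close>,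
  \<open>Sym a b : a \<oplus> b \<rightarrow> b \<oplus> a\<close>.  For \<open>f : a \<rightarrow> b\<close> and \<open>g : c \<rightarrow> d\<close>,
  \<open>Tmor a b c d f g : a \<oplus> c \<rightarrow> b \<oplus> d\<close>.
\<close>

record ('o, 'm) smcat = "('o, 'm) cat" +
  Tens :: "'o \<Rightarrow> 'o \<Rightarrow> 'o"
  Tmor :: "'o \<Rightarrow> 'o \<Rightarrow> 'o \<Rightarrow> 'o \<Rightarrow> 'm \<Rightarrow> 'm \<Rightarrow> 'm"
  Unt :: 'o
  Asc :: "'o \<Rightarrow> 'o \<Rightarrow> 'o \<Rightarrow> 'm"
  Lun :: "'o \<Rightarrow> 'm"
  Run :: "'o \<Rightarrow> 'm"
  Sym :: "'o \<Rightarrow> 'o \<Rightarrow> 'm"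

definition pairing :: "('o, 'm, 'z) addcat_scheme \<Rightarrow> 'o \<Rightarrow> 'o \<Rightarrow> 'o \<Rightarrow> 'm \<Rightarrow> 'm \<Rightarrow> 'm" where
  "pairing A x a b f g =
     Cmp A x a (Sum A a b) (In1 A a b) f \<otimes>\<^bsub>Hgrp A x (Sum A a b)\<^esub> Cmp A x b (Sum A a b) (In2 A a b) g"

definition dsum_smcat :: "('o, 'm, 'z) addcat_scheme \<Rightarrow> ('o, 'm) smcat" where
  "dsum_smcat A = \<lparr>Ob = Ob A, Hom = Hom A, Idn = Idn A, Cmp = Cmp A,
     Tens = Sum A,
     Tmor = (\<lambda>a b c d f g. pairing A (Sum A a c) b d
        (Cmp A (Sum A a c) a b f (Pr1 A a c)) (Cmp A (Sum A a c) c d g (Pr2 A a c))),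
     Unt = Zob A,
     Asc = (\<lambda>a b c. let s = Sum A (Sum A a b) c; p = Pr1 A (Sum A a b) c in
        pairing A s a (Sum A b c) (Cmp A s (Sum A a b) a (Pr1 A a b) p)
          (pairing A s b c (Cmp A s (Sum A a b) b (Pr2 A a b) p) (Pr2 A (Sum A a b) c))),
     Lun = (\<lambda>a. Pr2 A (Zob A) a),
     Run = (\<lambda>a. Pr1 A a (Zob A)),
     Sym = (\<lambda>a b. pairing A (Sum A a b) b a (Pr2 A a b) (Pr1 A a b))\<rparr>"

text \<open>
  \<open>tilde_hom M a b\<close> is the colimit of the sets \<open>M(a, b \<oplus> t)\<close> over \<open>t\<close>, i.e. the quotient of their
  disjoint union by the equivalence relation generated by \<open>(t, f) \<sim> (t', (b \<oplus> h) \<circ> f)\<close> for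
  \<open>h : t \<rightarrow> t'\<close>.
\<close>

definition tilde_pre :: "('o, 'm, 'z) smcat_scheme \<Rightarrow> 'o \<Rightarrow> 'o \<Rightarrow> ('o \<times> 'm) set" where
  "tilde_pre M a b = (SIGMA t:Ob M. Hom M a (Tens M b t))"

definition tilde_step ::
    "('o, 'm, 'z) smcat_scheme \<Rightarrow> 'o \<Rightarrow> 'o \<Rightarrow> (('o \<times> 'm) \<times> ('o \<times> 'm)) set" where
  "tilde_step M a b =
     {((t, f), (t', Cmp M a (Tens M b t) (Tens M b t') (Tmor M b b t t' (Idn M b) h) f)) |
        t t' f h. (t, f) \<in> tilde_pre M a b \<and> t' \<in> Ob M \<and> h \<in> Hom M t t'}"

definition tilde_rel ::
    "('o, 'm, 'z) smcat_scheme \<Rightarrow> 'o \<Rightarrow> 'o \<Rightarrow> (('o \<times> 'm) \<times> ('o \<times> 'm)) set" where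
  "tilde_rel M a b = Restr ((tilde_step M a b \<union> (tilde_step M a b)\<inverse>)\<^sup>*) (tilde_pre M a b)"

definition tilde_hom :: "('o, 'm, 'z) smcat_scheme \<Rightarrow> 'o \<Rightarrow> 'o \<Rightarrow> ('o \<times> 'm) set set" where
  "tilde_hom M a b = tilde_pre M a b // tilde_rel M a b"

definition tilde_class :: "('o, 'm, 'z) smcat_scheme \<Rightarrow> 'o \<Rightarrow> 'o \<Rightarrow> 'o \<Rightarrow> 'm \<Rightarrow> ('o \<times> 'm) set" where
  "tilde_class M a b t f = tilde_rel M a b `` {(t, f)}"

definition tilde_unit :: "('o, 'm, 'z) smcat_scheme \<Rightarrow> 'o \<Rightarrow> 'o \<Rightarrow> 'm \<Rightarrow> ('o \<times> 'm) set" where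
  "tilde_unit M a b f = tilde_class M a b (Unt M)
     (Cmp M a b (Tens M b (Unt M)) (inverse_of M (Tens M b (Unt M)) b (Run M b)) f)"

definition tilde_cmp ::
    "('o, 'm, 'z) smcat_scheme \<Rightarrow> 'o \<Rightarrow> 'o \<Rightarrow> 'o
      \<Rightarrow> ('o \<times> 'm) set \<Rightarrow> ('o \<times> 'm) set \<Rightarrow> ('o \<times> 'm) set" where
  "tilde_cmp M a b c G F = (\<Union>(t, f)\<in>F. \<Union>(u, g)\<in>G.
     tilde_class M a c (Tens M u t)
       (Cmp M a (Tens M (Tens M c u) t) (Tens M c (Tens M u t)) (Asc M c u t)
         (Cmp M a (Tens M b t) (Tens M (Tens M c u) t)
           (Tmor M b (Tens M c u) t t g (Idn M t)) f)))"

text \<open>The middle interchange \<open>(b \<oplus> t) \<oplus> (d \<oplus> u) \<rightarrow> (b \<oplus> d) \<oplus> (t \<oplus> u)\<close>.\<close>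

definition mid_swap :: "('o, 'm, 'z) smcat_scheme \<Rightarrow> 'o \<Rightarrow> 'o \<Rightarrow> 'o \<Rightarrow> 'o \<Rightarrow> 'm" where
  "mid_swap M b t d u =
    (let T = Tens M;
         x0 = T (T b t) (T d u);
         x1 = T b (T t (T d u)); s1 = Asc M b t (T d u);
         x2 = T b (T (T t d) u);
         s2 = Tmor M b b (T t (T d u)) (T (T t d) u) (Idn M b)
                (inverse_of M (T (T t d) u) (T t (T d u)) (Asc M t d u));
         x3 = T b (T (T d t) u);
         s3 = Tmor M b b (T (T t d) u) (T (T d t) u) (Idn M b)
                (Tmor M (T t d) (T d t) u u (Sym M t d) (Idn M u));
         x4 = T b (T d (T t u));
         s4 = Tmor M b b (T (T d t) u) (T d (T t u)) (Idn M b) (Asc M d t u);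
         x5 = T (T b d) (T t u);
         s5 = inverse_of M x5 x4 (Asc M b d (T t u))
     in Cmp M x0 x4 x5 s5 (Cmp M x0 x3 x4 s4 (Cmp M x0 x2 x3 s3 (Cmp M x0 x1 x2 s2 s1))))"

definition tilde_tmor ::
    "('o, 'm, 'z) smcat_scheme \<Rightarrow> 'o \<Rightarrow> 'o \<Rightarrow> 'o \<Rightarrow> 'o
      \<Rightarrow> ('o \<times> 'm) set \<Rightarrow> ('o \<times> 'm) set \<Rightarrow> ('o \<times> 'm) set" where
  "tilde_tmor M a b c d F G = (\<Union>(t, f)\<in>F. \<Union>(u, g)\<in>G.
     tilde_class M (Tens M a c) (Tens M b d) (Tens M t u)
       (Cmp M (Tens M a c) (Tens M (Tens M b t) (Tens M d u)) (Tens M (Tens M b d) (Tens M t u))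
         (mid_swap M b t d u)
         (Tmor M a (Tens M b t) c (Tens M d u) f g)))"

definition tilde :: "('o, 'm, 'z) smcat_scheme \<Rightarrow> ('o, ('o \<times> 'm) set) smcat" where
  "tilde M = \<lparr>Ob = Ob M, Hom = tilde_hom M,
     Idn = (\<lambda>a. tilde_unit M a a (Idn M a)),
     Cmp = tilde_cmp M,
     Tens = Tens M, Tmor = tilde_tmor M, Unt = Unt M,
     Asc = (\<lambda>a b c. tilde_unit M (Tens M (Tens M a b) c) (Tens M a (Tens M b c)) (Asc M a b c)),
     Lun = (\<lambda>a. tilde_unit M (Tens M (Unt M) a) a (Lun M a)),
     Run = (\<lambda>a. tilde_unit M (Tens M a (Unt M)) a (Run M a)),
     Sym = (\<lambda>a b. tilde_unit M (Tens M a b) (Tens M b a) (Sym M a b))\<rparr>"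

text \<open>
  The extension to \<open>tilde M\<close> of a functor \<open>\<Phi> : M \<rightarrow> N\<close>, where the unit of \<open>N\<close> is null and \<open>\<Phi>\<close>
  preserves the monoidal structure on the nose: the class of \<open>f : a \<rightarrow> b \<oplus> t\<close> is sent to
  \<open>\<Phi> a \<rightarrow> \<Phi> b \<oplus> \<Phi> t \<rightarrow> \<Phi> b \<oplus> 0 \<rightarrow> \<Phi> b\<close>.
\<close>

definition tilde_ext ::
    "('o, 'm, 'y) smcat_scheme \<Rightarrow> ('p, 'n, 'z) smcat_scheme \<Rightarrow> ('o, 'm, 'p, 'n) func
      \<Rightarrow> ('o, ('o \<times> 'm) set, 'p, 'n) func" where
  "tilde_ext M N \<Phi> = mk_func (tilde M) (fobj \<Phi>)
     (\<lambda>a b F. the_elem ((\<lambda>(t, f).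
        Cmp N (fobj \<Phi> a) (Tens N (fobj \<Phi> b) (fobj \<Phi> t)) (fobj \<Phi> b)
          (Cmp N (Tens N (fobj \<Phi> b) (fobj \<Phi> t)) (Tens N (fobj \<Phi> b) (Unt N)) (fobj \<Phi> b)
             (Run N (fobj \<Phi> b))
             (Tmor N (fobj \<Phi> b) (fobj \<Phi> b) (fobj \<Phi> t) (Unt N) (Idn N (fobj \<Phi> b))
                (the_elem (Hom N (fobj \<Phi> t) (Unt N)))))
          (fmor \<Phi> a (Tens M b t) f)) ` F))"


section \<open>Polynomial functors\<close>

definition shift_func ::
    "('o, 'm, 'z) smcat_scheme \<Rightarrow> 'o \<Rightarrow> ('o, 'm, 'p, 'n) func \<Rightarrow> ('o, 'm, 'p, 'n) func" where
  "shift_func N x F = mk_func N (\<lambda>y. fobj F (Tens N x y))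
     (\<lambda>y z f. fmor F (Tens N x y) (Tens N x z) (Tmor N x x y z (Idn N x) f))"

text \<open>The map \<open>F \<rightarrow> F(x \<oplus> -)\<close> induced by \<open>y \<cong> 0 \<oplus> y \<rightarrow> x \<oplus> y\<close>.\<close>

definition shift_map ::
    "('o, 'm, 'z) smcat_scheme \<Rightarrow> 'o \<Rightarrow> ('o, 'm, 'p, 'n) func \<Rightarrow> 'o \<Rightarrow> 'n" where
  "shift_map N x F = (\<lambda>y\<in>Ob N. fmor F y (Tens N x y)
     (Cmp N y (Tens N (Unt N) y) (Tens N x y)
        (Tmor N (Unt N) x y y (the_elem (Hom N (Unt N) x)) (Idn N y))
        (inverse_of N (Tens N (Unt N) y) y (Lun N y))))"

text \<open>
  \<open>pol_below N B k\<close> consists of the polynomial functors of degree less than \<open>k\<close>; degree less than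
  \<open>0\<close> covers all negative degrees.  The cokernel is taken in the functor category.
\<close>

primrec pol_below ::
    "('o, 'm, 'y) smcat_scheme \<Rightarrow> ('p, 'n, 'z) cat_scheme \<Rightarrow> nat \<Rightarrow> ('o, 'm, 'p, 'n) func set" where
  "pol_below N B 0 = {F. is_null (Fct N B) F}"
| "pol_below N B (Suc n) = {F \<in> Ob (Fct N B). \<forall>x\<in>Ob N. \<exists>\<delta> q.
     is_cokernel (Fct N B) F (shift_func N x F) (shift_map N x F) \<delta> q \<and> \<delta> \<in> pol_below N B n}"

definition Pol ::
    "('o, 'm, 'y) smcat_scheme \<Rightarrow> ('p, 'n, 'z) cat_scheme \<Rightarrow> nat
      \<Rightarrow> (('o, 'm, 'p, 'n) func, 'o \<Rightarrow> 'n) cat" where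
  "Pol N B n = full_subcat (Fct N B) (pol_below N B (Suc n))"

text \<open>Precomposition with \<open>\<Phi> : M \<rightarrow> N\<close>, on a category \<open>P\<close> of functors on \<open>N\<close>.\<close>

definition precomp_func ::
    "(('p, 'n, 'q, 'l) func, 'p \<Rightarrow> 'l, 'y) cat_scheme \<Rightarrow> ('o, 'm, 'z) cat_scheme
      \<Rightarrow> ('o, 'm, 'p, 'n) func
      \<Rightarrow> (('p, 'n, 'q, 'l) func, 'p \<Rightarrow> 'l, ('o, 'm, 'q, 'l) func, 'o \<Rightarrow> 'l) func" where
  "precomp_func P M \<Phi> = mk_func P (\<lambda>F. comp_func M F \<Phi>) (\<lambda>F G \<alpha>. \<lambda>a\<in>Ob M. \<alpha> (fobj \<Phi> a))"


section \<open>Duality and hermitian objects\<close>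

text \<open>
  For \<open>f : x \<rightarrow> y\<close>, the arrow \<open>D f : D y \<rightarrow> D x\<close> is \<open>fmor D y x f\<close>.  The last assumption says that the
  unit \<open>x \<rightarrow> D (D x)\<close> of the adjunction is invertible.
\<close>

locale duality = additive_category A for A :: "('o, 'm, 'z) addcat_scheme" +
  fixes D :: "('o, 'm, 'o, 'm) func" and \<sigma> :: "'o \<Rightarrow> 'o \<Rightarrow> 'm \<Rightarrow> 'm"
  assumes D_functor: "is_functor (op_cat A) A D"
    and \<sigma>_bij: "\<lbrakk>x \<in> Ob A; y \<in> Ob A\<rbrakk>
      \<Longrightarrow> bij_betw (\<sigma> x y) (Hom A x (fobj D y)) (Hom A y (fobj D x))"
    and \<sigma>_natural: "\<lbrakk>x \<in> Ob A; x' \<in> Ob A; y \<in> Ob A; y' \<in> Ob A;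
        f \<in> Hom A x' x; g \<in> Hom A y' y; a \<in> Hom A x (fobj D y)\<rbrakk>
      \<Longrightarrow> \<sigma> x' y' (Cmp A x' (fobj D y) (fobj D y') (fmor D y y' g) (Cmp A x' x (fobj D y) a f)) =
          Cmp A y' (fobj D x) (fobj D x') (fmor D x x' f) (Cmp A y' y (fobj D x) (\<sigma> x y a) g)"
    and \<sigma>_inverse: "\<lbrakk>x \<in> Ob A; y \<in> Ob A; a \<in> Hom A x (fobj D y)\<rbrakk> \<Longrightarrow> \<sigma> y x (\<sigma> x y a) = a"
    and unit_invertible: "x \<in> Ob A
      \<Longrightarrow> invertible A x (fobj D (fobj D x)) (\<sigma> (fobj D x) x (Idn A (fobj D x)))"

text \<open>
  A contravariant functor \<open>T\<close> from \<open>A\<close> to abelian groups with a natural map to \<open>x \<mapsto> A(x, D x)\<close>: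
  \<open>Tmap T x y f : T y \<rightarrow> T x\<close> for \<open>f : x \<rightarrow> y\<close>, and \<open>Tform T x : T x \<rightarrow> A(x, D x)\<close>.
\<close>

record ('o, 'm, 't) form_functor =
  Tgrp :: "'o \<Rightarrow> 't monoid"
  Tmap :: "'o \<Rightarrow> 'o \<Rightarrow> 'm \<Rightarrow> 't \<Rightarrow> 't"
  Tform :: "'o \<Rightarrow> 't \<Rightarrow> 'm"

definition TD2_grp :: "('o, 'm, 'z) addcat_scheme \<Rightarrow> ('o, 'm, 'o, 'm) func \<Rightarrow> 'o \<Rightarrow> 'm monoid" where
  "TD2_grp A D x = Hgrp A x (fobj D x)"

definition TD2_map ::
    "('o, 'm, 'z) addcat_scheme \<Rightarrow> ('o, 'm, 'o, 'm) func \<Rightarrow> 'o \<Rightarrow> 'o \<Rightarrow> 'm \<Rightarrow> 'm \<Rightarrow> 'm" where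
  "TD2_map A D x y f v =
     Cmp A x (fobj D y) (fobj D x) (fmor D y x f) (Cmp A x y (fobj D y) v f)"

text \<open>
  \<open>Z\<^sub>\<epsilon> \<otimes> G\<close> over \<open>Z[Z/2]\<close>, for an abelian group \<open>G\<close> with involution \<open>s\<close>: the free abelian group on
  the pairs \<open>(z, x)\<close> modulo the relations of biadditivity and \<open>(\<epsilon> z, x) = (z, s x)\<close>.
\<close>

definition eps_tensor_free :: "('m, 'z) monoid_scheme \<Rightarrow> ((int \<times> 'm) \<Rightarrow>\<^sub>0 int) monoid" where
  "eps_tensor_free G = free_Abelian_group (UNIV \<times> carrier G)"

definition eps_tensor_rels ::
    "int \<Rightarrow> ('m, 'z) monoid_scheme \<Rightarrow> ('m \<Rightarrow> 'm) \<Rightarrow> ((int \<times> 'm) \<Rightarrow>\<^sub>0 int) set" where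
  "eps_tensor_rels \<epsilon> G s =
     {frag_of (z + w, x) - frag_of (z, x) - frag_of (w, x) | z w x. x \<in> carrier G} \<union>
     {frag_of (z, x \<otimes>\<^bsub>G\<^esub> y) - frag_of (z, x) - frag_of (z, y) | z x y. x \<in> carrier G \<and> y \<in> carrier G} \<union>
     {frag_of (\<epsilon> * z, x) - frag_of (z, s x) | z x. x \<in> carrier G}"

definition eps_tensor ::
    "int \<Rightarrow> ('m, 'z) monoid_scheme \<Rightarrow> ('m \<Rightarrow> 'm) \<Rightarrow> ((int \<times> 'm) \<Rightarrow>\<^sub>0 int) set monoid" where
  "eps_tensor \<epsilon> G s =
     eps_tensor_free G Mod generate (eps_tensor_free G) (eps_tensor_rels \<epsilon> G s)"

definition pure_tensor ::
    "int \<Rightarrow> ('m, 'z) monoid_scheme \<Rightarrow> ('m \<Rightarrow> 'm) \<Rightarrow> int \<Rightarrow> 'm \<Rightarrow> ((int \<times> 'm) \<Rightarrow>\<^sub>0 int) set" where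
  "pure_tensor \<epsilon> G s z x =
     generate (eps_tensor_free G) (eps_tensor_rels \<epsilon> G s) #>\<^bsub>eps_tensor_free G\<^esub> frag_of (z, x)"

text \<open>The homomorphism to \<open>H\<close> that sends \<open>z \<otimes> x\<close> to \<open>\<phi> z x\<close>.\<close>

definition eps_tensor_lift ::
    "int \<Rightarrow> ('m, 'z) monoid_scheme \<Rightarrow> ('m \<Rightarrow> 'm) \<Rightarrow> ('h, 'y) monoid_scheme
      \<Rightarrow> (int \<Rightarrow> 'm \<Rightarrow> 'h) \<Rightarrow> ((int \<times> 'm) \<Rightarrow>\<^sub>0 int) set \<Rightarrow> 'h" where
  "eps_tensor_lift \<epsilon> G s H \<phi> =
     (THE h. h \<in> hom (eps_tensor \<epsilon> G s) H \<and> h \<in> extensional (carrier (eps_tensor \<epsilon> G s)) \<and>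
        (\<forall>z. \<forall>x\<in>carrier G. h (pure_tensor \<epsilon> G s z x) = \<phi> z x))"

definition SD2_grp ::
    "('o, 'm, 'z) addcat_scheme \<Rightarrow> ('o, 'm, 'o, 'm) func \<Rightarrow> ('o \<Rightarrow> 'o \<Rightarrow> 'm \<Rightarrow> 'm) \<Rightarrow> int
      \<Rightarrow> 'o \<Rightarrow> ((int \<times> 'm) \<Rightarrow>\<^sub>0 int) set monoid" where
  "SD2_grp A D \<sigma> \<epsilon> x = eps_tensor \<epsilon> (TD2_grp A D x) (\<sigma> x x)"

text \<open>
  The norm \<open>1 \<otimes> v \<mapsto> v + \<epsilon> \<sigma>(v)\<close>.  Its values are \<open>\<epsilon>\<close>-symmetric, and the subgroup of
  \<open>\<epsilon>\<close>-symmetric elements is included into \<open>A(x, D x)\<close>, which is taken as the target.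
\<close>

definition SD2_norm ::
    "('o, 'm, 'z) addcat_scheme \<Rightarrow> ('o, 'm, 'o, 'm) func \<Rightarrow> ('o \<Rightarrow> 'o \<Rightarrow> 'm \<Rightarrow> 'm) \<Rightarrow> int
      \<Rightarrow> 'o \<Rightarrow> ((int \<times> 'm) \<Rightarrow>\<^sub>0 int) set \<Rightarrow> 'm" where
  "SD2_norm A D \<sigma> \<epsilon> x =
     eps_tensor_lift \<epsilon> (TD2_grp A D x) (\<sigma> x x) (TD2_grp A D x)
       (\<lambda>z v. (v \<otimes>\<^bsub>TD2_grp A D x\<^esub> (\<sigma> x x v [^]\<^bsub>TD2_grp A D x\<^esub> \<epsilon>)) [^]\<^bsub>TD2_grp A D x\<^esub> z)"

definition SD2 ::
    "('o, 'm, 'z) addcat_scheme \<Rightarrow> ('o, 'm, 'o, 'm) func \<Rightarrow> ('o \<Rightarrow> 'o \<Rightarrow> 'm \<Rightarrow> 'm) \<Rightarrow> int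
      \<Rightarrow> ('o, 'm, ((int \<times> 'm) \<Rightarrow>\<^sub>0 int) set) form_functor" where
  "SD2 A D \<sigma> \<epsilon> = \<lparr>Tgrp = SD2_grp A D \<sigma> \<epsilon>,
     Tmap = (\<lambda>x y f. eps_tensor_lift \<epsilon> (TD2_grp A D y) (\<sigma> y y) (SD2_grp A D \<sigma> \<epsilon> x)
        (\<lambda>z v. pure_tensor \<epsilon> (TD2_grp A D x) (\<sigma> x x) z (TD2_map A D x y f v))),
     Tform = SD2_norm A D \<sigma> \<epsilon>\<rparr>"

definition SbarD2 ::
    "('o, 'm, 'z) addcat_scheme \<Rightarrow> ('o, 'm, 'o, 'm) func \<Rightarrow> ('o \<Rightarrow> 'o \<Rightarrow> 'm \<Rightarrow> 'm) \<Rightarrow> int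
      \<Rightarrow> ('o, 'm, 'm) form_functor" where
  "SbarD2 A D \<sigma> \<epsilon> = \<lparr>Tgrp = (\<lambda>x. (TD2_grp A D x)
        \<lparr>carrier := SD2_norm A D \<sigma> \<epsilon> x ` carrier (SD2_grp A D \<sigma> \<epsilon> x)\<rparr>),
     Tmap = TD2_map A D,
     Tform = (\<lambda>x v. v)\<rparr>"

text \<open>
  The category of hermitian objects with the orthogonal sum; \<open>herm_incl T x y\<close> is the canonical map
  \<open>T x \<oplus> T y \<rightarrow> T (x \<oplus> y)\<close>.  The coherence isomorphisms are those of the direct sum in \<open>A\<close>.
\<close>

definition herm_incl ::
    "('o, 'm, 'z) addcat_scheme \<Rightarrow> ('o, 'm, 't) form_functor \<Rightarrow> 'o \<Rightarrow> 'o \<Rightarrow> 't \<Rightarrow> 't \<Rightarrow> 't" where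
  "herm_incl A T x y u v =
     Tmap T (Sum A x y) x (Pr1 A x y) u \<otimes>\<^bsub>Tgrp T (Sum A x y)\<^esub> Tmap T (Sum A x y) y (Pr2 A x y) v"

definition herm ::
    "('o, 'm, 'z) addcat_scheme \<Rightarrow> ('o, 'm, 'o, 'm) func \<Rightarrow> ('o, 'm, 't) form_functor
      \<Rightarrow> ('o \<times> 't, 'm) smcat" where
  "herm A D T = \<lparr>
     Ob = {(x, u). x \<in> Ob A \<and> u \<in> carrier (Tgrp T x) \<and> invertible A x (fobj D x) (Tform T x u)},
     Hom = (\<lambda>(x, u) (y, v). {f \<in> Hom A x y. Tmap T x y f v = u}),
     Idn = (\<lambda>(x, u). Idn A x),
     Cmp = (\<lambda>(x, u) (y, v) (z, w). Cmp A x y z),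
     Tens = (\<lambda>(x, u) (y, v). (Sum A x y, herm_incl A T x y u v)),
     Tmor = (\<lambda>a b c d. Tmor (dsum_smcat A) (fst a) (fst b) (fst c) (fst d)),
     Unt = (Zob A, \<one>\<^bsub>Tgrp T (Zob A)\<^esub>),
     Asc = (\<lambda>a b c. Asc (dsum_smcat A) (fst a) (fst b) (fst c)),
     Lun = (\<lambda>a. Lun (dsum_smcat A) (fst a)),
     Run = (\<lambda>a. Run (dsum_smcat A) (fst a)),
     Sym = (\<lambda>a b. Sym (dsum_smcat A) (fst a) (fst b))\<rparr>"

definition herm_forget ::
    "('o, 'm, 'z) addcat_scheme \<Rightarrow> ('o, 'm, 'o, 'm) func \<Rightarrow> ('o, 'm, 't) form_functor
      \<Rightarrow> ('o \<times> 't, 'm, 'o, 'm) func" where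
  "herm_forget A D T = mk_func (herm A D T) fst (\<lambda>_ _ f. f)"

definition herm_forget_ext ::
    "('o, 'm, 'z) addcat_scheme \<Rightarrow> ('o, 'm, 'o, 'm) func \<Rightarrow> ('o, 'm, 't) form_functor
      \<Rightarrow> ('o \<times> 't, (('o \<times> 't) \<times> 'm) set, 'o, 'm) func" where
  "herm_forget_ext A D T = tilde_ext (herm A D T) (dsum_smcat A) (herm_forget A D T)"

end

theory Submission
  imports Defs
begin

text \<open>Write an arrow \<open>(A, u) \<rightarrow> (B, v)\<close> of the category \<open>tilde H\<close> as the class \<open>(f, e)\<close> of
  \<open>f : A \<rightarrow> B\<close> and of \<open>e = [C, w, g]\<close> with \<open>g : A \<rightarrow> C\<close> and \<open>f\<^sup>* v + g\<^sup>* w = u\<close>.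
  The functor to \<open>A\<close> forgets \<open>e\<close> and is full, because every form extends to a nondegenerate one on
  \<open>X \<oplus> D X\<close>; the point is that a polynomial functor \<open>F\<close> does not see \<open>e\<close>.
  It suffices to show \<open>F(1, e) = 1\<close> when the form \<open>g\<^sup>* w\<close> is zero: forms have additive inverses, so any two
  choices of \<open>e\<close> become equal after adding classes of zero form.

  Suppose \<open>u = q\<^sub>0 + q\<^sub>1\<close> with \<open>q\<^sub>0\<close>, \<open>q\<^sub>1\<close> nondegenerate. The diagonal
  \<open>\<alpha> : (A, u) \<rightarrow> (A, q\<^sub>1) \<oplus> (A, q\<^sub>0)\<close> satisfies \<open>\<alpha> \<circ> (1, e) = (1 \<oplus> (1, e)) \<circ> \<alpha>\<close>. By induction on the degree, the
  cross effect of \<open>F\<close> does not distinguish \<open>1 \<oplus> (1, e)\<close> from the identity, and neither do the components of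
  \<open>\<alpha>\<close>, because \<open>e\<close> is determined by its form as soon as this form is nondegenerate. Hence
  \<open>F(\<alpha>) \<circ> F(1, e) = F(\<alpha>)\<close>, and \<open>\<alpha>\<close> is a split monomorphism of \<open>tilde H\<close>. In general \<open>(A, u)\<close> is an
  orthogonal summand of \<open>(A, u) \<oplus> (A, u)\<close>, whose form is a sum of two nondegenerate ones.

  So \<open>F\<close> is defined on those objects of \<open>A\<close> that carry a nondegenerate form, and every object \<open>X\<close> is a
  direct summand of such an object, namely of \<open>X \<oplus> D X\<close>. As the maps \<open>F \<rightarrow> F(x \<oplus> -)\<close> are split, polynomiality
  is inherited by retracts and can be tested after restriction along the forgetful functor.\<close>

section \<open>Functor categories and equivalences\<close>

text \<open>A step in the colimit composes g with an isometry h between nondegenerate objects, and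
  such an h is a split monomorphism. So the vanishing of g is an invariant of the class: the
  inclusion of X into X \<oplus> D X with the hyperbolic form induces the zero form on X, yet it is
  not equivalent to 0 when X is nonzero. The forgetful functor is therefore not faithful, and forms
  alone do not decide equality of arrows; this is why polynomiality has to enter, and why the
  argument passes through sums of two nondegenerate forms. Two more points shape the formal proof. A
  cokernel in a functor category is given by a universal property, about which restriction along a
  functor says nothing directly; the projection x \<oplus> y -> y turns it into the image of an
  idempotent, hence into equations that restriction preserves. And an object of A need not carry a
  nondegenerate form, so a functor on A can only be built by cutting its value at X out of the value
  at X \<oplus> D X. One lemma on splitting idempotents in B serves both purposes.\<close>

context category
begin

declare Idn_in [simp] Cmp_in [simp] Cmp_Idn_right [simp] Cmp_Idn_left [simp]

lemma Cmp_assoc_right [simp]: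
  "\<lbrakk>a \<in> Ob C; b \<in> Ob C; c \<in> Ob C; d \<in> Ob C; f \<in> Hom C a b; g \<in> Hom C b c; h \<in> Hom C c d\<rbrakk>
    \<Longrightarrow> Cmp C a b d (Cmp C b c d h g) f = Cmp C a c d h (Cmp C a b c g f)"
  by (simp add: Cmp_assoc)

text \<open>Simplification brackets composites to the right, so an equation for g \<circ> f no
  longer matches inside g \<circ> (f \<circ> h). This is the form in which such equations are
  applied.\<close>

lemma Cmp_cong_assoc:
  "\<lbrakk>Cmp C b c d g f = k; x \<in> Ob C; b \<in> Ob C; c \<in> Ob C; d \<in> Ob C;
     h \<in> Hom C x b; f \<in> Hom C b c; g \<in> Hom C c d\<rbrakk>
    \<Longrightarrow> Cmp C x c d g (Cmp C x b c f h) = Cmp C x b d k h"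
  by (simp add: Cmp_assoc del: Cmp_assoc_right)

lemma is_inverse_unique:
  assumes "a \<in> Ob C" "b \<in> Ob C" "is_inverse C a b f g" "is_inverse C a b f h"
  shows "g = h"
proof -
  have *: "f \<in> Hom C a b" "g \<in> Hom C b a" "h \<in> Hom C b a"
      "Cmp C a b a g f = Idn C a" "Cmp C b a b f h = Idn C b"
    using assms by (auto simp: is_inverse_def)
  have "g = Cmp C b b a g (Cmp C b a b f h)" using * assms(1,2) by simp
  also have "\<dots> = Cmp C b a a (Cmp C a b a g f) h"
    using Cmp_assoc[of b a b a h f g] *(1-3) assms(1,2) by blast
  also have "\<dots> = h" using * assms(1,2) by (simp del: Cmp_assoc_right)
  finally show ?thesis .
qed

lemma inverse_of_eq:
  assumes "a \<in> Ob C" "b \<in> Ob C" "is_inverse C a b f g"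
  shows "inverse_of C a b f = g"
  unfolding inverse_of_def using assms is_inverse_unique by blast

lemma category_full_subcat: "category (full_subcat C S)"
  by unfold_locales (auto simp: full_subcat_def)

end

lemma fobj_mk_func [simp]: "a \<in> Ob C \<Longrightarrow> fobj (mk_func C fo fm) a = fo a"
  by (simp add: mk_func_def)

lemma fmor_mk_func [simp]:
  "\<lbrakk>a \<in> Ob C; b \<in> Ob C; f \<in> Hom C a b\<rbrakk> \<Longrightarrow> fmor (mk_func C fo fm) a b f = fm a b f"
  by (simp add: mk_func_def)

lemma mk_func_cong:
  assumes "\<And>a. a \<in> Ob C \<Longrightarrow> fo a = fo' a"
    and "\<And>a b f. \<lbrakk>a \<in> Ob C; b \<in> Ob C; f \<in> Hom C a b\<rbrakk> \<Longrightarrow> fm a b f = fm' a b f"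
  shows "mk_func C fo fm = mk_func C fo' fm'"
  using assms by (auto simp: mk_func_def fun_eq_iff)

lemma mk_func_mk_func:
  "mk_func C (fobj (mk_func C fo fm)) (fmor (mk_func C fo fm)) = mk_func C fo fm"
  by (rule mk_func_cong) auto

lemma is_functorD:
  assumes "is_functor C D F"
  shows "F = mk_func C (fobj F) (fmor F)"
    and "a \<in> Ob C \<Longrightarrow> fobj F a \<in> Ob D"
    and "\<lbrakk>a \<in> Ob C; b \<in> Ob C; f \<in> Hom C a b\<rbrakk> \<Longrightarrow> fmor F a b f \<in> Hom D (fobj F a) (fobj F b)"
    and "a \<in> Ob C \<Longrightarrow> fmor F a a (Idn C a) = Idn D (fobj F a)"
    and "\<lbrakk>a \<in> Ob C; b \<in> Ob C; c \<in> Ob C; f \<in> Hom C a b; g \<in> Hom C b c\<rbrakk>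
      \<Longrightarrow> fmor F a c (Cmp C a b c g f) =
        Cmp D (fobj F a) (fobj F b) (fobj F c) (fmor F b c g) (fmor F a b f)"
  using assms unfolding is_functor_def by blast+

lemma is_functor_mk_func:
  assumes "category C"
    and "\<And>a. a \<in> Ob C \<Longrightarrow> fo a \<in> Ob D"
    and "\<And>a b f. \<lbrakk>a \<in> Ob C; b \<in> Ob C; f \<in> Hom C a b\<rbrakk> \<Longrightarrow> fm a b f \<in> Hom D (fo a) (fo b)"
    and "\<And>a. a \<in> Ob C \<Longrightarrow> fm a a (Idn C a) = Idn D (fo a)"
    and "\<And>a b c f g. \<lbrakk>a \<in> Ob C; b \<in> Ob C; c \<in> Ob C; f \<in> Hom C a b; g \<in> Hom C b c\<rbrakk>
      \<Longrightarrow> fm a c (Cmp C a b c g f) = Cmp D (fo a) (fo b) (fo c) (fm b c g) (fm a b f)"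
  shows "is_functor C D (mk_func C fo fm)"
proof -
  interpret category C by fact
  show ?thesis unfolding is_functor_def using assms(2-) by (auto simp: mk_func_mk_func)
qed

lemma is_functor_comp_func:
  assumes "category C" "is_functor C D F" "is_functor D E G"
  shows "is_functor C E (comp_func C G F)"
  unfolding comp_func_def
  by (rule is_functor_mk_func) (use assms is_functorD[OF assms(2)] is_functorD[OF assms(3)] in auto)

lemma is_functor_id_func: "category C \<Longrightarrow> is_functor C C (id_func C)"
  unfolding id_func_def by (rule is_functor_mk_func) auto

lemma fobj_comp_func [simp]: "a \<in> Ob C \<Longrightarrow> fobj (comp_func C G F) a = fobj G (fobj F a)"
  by (simp add: comp_func_def)

lemma fmor_comp_func [simp]:
  "\<lbrakk>a \<in> Ob C; b \<in> Ob C; f \<in> Hom C a b\<rbrakk>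
    \<Longrightarrow> fmor (comp_func C G F) a b f = fmor G (fobj F a) (fobj F b) (fmor F a b f)"
  by (simp add: comp_func_def)

lemma fobj_id_func [simp]: "a \<in> Ob C \<Longrightarrow> fobj (id_func C) a = a"
  by (simp add: id_func_def)

lemma fmor_id_func [simp]: "\<lbrakk>a \<in> Ob C; b \<in> Ob C; f \<in> Hom C a b\<rbrakk> \<Longrightarrow> fmor (id_func C) a b f = f"
  by (simp add: id_func_def)

lemma nat_transI:
  assumes "\<alpha> \<in> extensional (Ob C)"
    and "\<And>a. a \<in> Ob C \<Longrightarrow> \<alpha> a \<in> Hom D (fobj F a) (fobj G a)"
    and "\<And>a b f. \<lbrakk>a \<in> Ob C; b \<in> Ob C; f \<in> Hom C a b\<rbrakk> \<Longrightarrow>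
      Cmp D (fobj F a) (fobj G a) (fobj G b) (fmor G a b f) (\<alpha> a) =
      Cmp D (fobj F a) (fobj F b) (fobj G b) (\<alpha> b) (fmor F a b f)"
  shows "\<alpha> \<in> nat_trans C D F G"
  using assms by (auto simp: nat_trans_def PiE_def)

lemma nat_transD:
  assumes "\<alpha> \<in> nat_trans C D F G"
  shows "\<alpha> \<in> extensional (Ob C)"
    and "a \<in> Ob C \<Longrightarrow> \<alpha> a \<in> Hom D (fobj F a) (fobj G a)"
    and "\<lbrakk>a \<in> Ob C; b \<in> Ob C; f \<in> Hom C a b\<rbrakk> \<Longrightarrow>
      Cmp D (fobj F a) (fobj G a) (fobj G b) (fmor G a b f) (\<alpha> a) =
      Cmp D (fobj F a) (fobj F b) (fobj G b) (\<alpha> b) (fmor F a b f)"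
  using assms by (auto simp: nat_trans_def PiE_def)

lemma Fct_simps [simp]:
  "Ob (Fct C D) = {F. is_functor C D F}"
  "Hom (Fct C D) = nat_trans C D"
  "Idn (Fct C D) = (\<lambda>F. \<lambda>a\<in>Ob C. Idn D (fobj F a))"
  "Cmp (Fct C D) = (\<lambda>F G H \<beta> \<alpha>. \<lambda>a\<in>Ob C. Cmp D (fobj F a) (fobj G a) (fobj H a) (\<beta> a) (\<alpha> a))"
  by (simp_all add: Fct_def)

lemma category_Fct:
  assumes "category D"
  shows "category (Fct C D)"
proof -
  interpret D: category D by fact
  show ?thesis
  proof (unfold_locales, goal_cases)
    case (1 F)
    then have F: "is_functor C D F" by simp
    show ?case by (simp, rule nat_transI) (use is_functorD[OF F] in auto)
  next
    case (2 F G H \<alpha> \<beta>)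
    then have F: "is_functor C D F" "is_functor C D G" "is_functor C D H"
      and n: "\<alpha> \<in> nat_trans C D F G" "\<beta> \<in> nat_trans C D G H" by simp_all
    note [simp] = is_functorD(2,3)[OF F(1)] is_functorD(2,3)[OF F(2)] is_functorD(2,3)[OF F(3)]
      nat_transD(2)[OF n(1)] nat_transD(2)[OF n(2)]
    show ?case
    proof (simp, rule nat_transI, goal_cases)
      case (3 a b f)
      then have "Cmp D (fobj F a) (fobj H a) (fobj H b) (fmor H a b f)
          (Cmp D (fobj F a) (fobj G a) (fobj H a) (\<beta> a) (\<alpha> a)) =
        Cmp D (fobj F a) (fobj G a) (fobj H b) (Cmp D (fobj G a) (fobj H a) (fobj H b) (fmor H a b f) (\<beta> a)) (\<alpha> a)"
        by simp
      also have "\<dots> = Cmp D (fobj F a) (fobj G a) (fobj H b)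
          (Cmp D (fobj G a) (fobj G b) (fobj H b) (\<beta> b) (fmor G a b f)) (\<alpha> a)"
        using 3 nat_transD(3)[OF n(2)] by simp
      also have "\<dots> = Cmp D (fobj F a) (fobj G b) (fobj H b) (\<beta> b)
          (Cmp D (fobj F a) (fobj F b) (fobj G b) (\<alpha> b) (fmor F a b f))"
        using 3 nat_transD(3)[OF n(1)] by simp
      finally show ?case using 3 by simp
    qed auto
  next
    case (3 F G \<alpha>)
    then have F: "is_functor C D F" "is_functor C D G" and n: "\<alpha> \<in> nat_trans C D F G" by simp_all
    show ?case
      by (rule extensionalityI[of _ "Ob C"])
        (auto simp: F[THEN is_functorD(2)] nat_transD[OF n])
  next
    case (4 F G \<alpha>)
    then have F: "is_functor C D F" "is_functor C D G" and n: "\<alpha> \<in> nat_trans C D F G" by simp_all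
    show ?case
      by (rule extensionalityI[of _ "Ob C"])
        (auto simp: F[THEN is_functorD(2)] nat_transD[OF n])
  next
    case (5 F G H K \<alpha> \<beta> \<gamma>)
    then have F: "is_functor C D F" "is_functor C D G" "is_functor C D H" "is_functor C D K"
      and n: "\<alpha> \<in> nat_trans C D F G" "\<beta> \<in> nat_trans C D G H" "\<gamma> \<in> nat_trans C D H K" by simp_all
    note [simp] = F[THEN is_functorD(2)] n[THEN nat_transD(2)]
    show ?case by (auto simp: fun_eq_iff)
  qed
qed

text \<open>Naturality is asked of \<alpha> only: conjugating its naturality square by the pointwise
  inverses gives that of \<beta>.\<close>

lemma isomorphic_Fct:
  assumes "category D" "is_functor C D F" "is_functor C D G"
    and "\<And>a. a \<in> Ob C \<Longrightarrow> \<alpha> a \<in> Hom D (fobj F a) (fobj G a)"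
    and "\<And>a. a \<in> Ob C \<Longrightarrow> \<beta> a \<in> Hom D (fobj G a) (fobj F a)"
    and "\<And>a. a \<in> Ob C \<Longrightarrow> Cmp D (fobj F a) (fobj G a) (fobj F a) (\<beta> a) (\<alpha> a) = Idn D (fobj F a)"
    and "\<And>a. a \<in> Ob C \<Longrightarrow> Cmp D (fobj G a) (fobj F a) (fobj G a) (\<alpha> a) (\<beta> a) = Idn D (fobj G a)"
    and nat: "\<And>a b f. \<lbrakk>a \<in> Ob C; b \<in> Ob C; f \<in> Hom C a b\<rbrakk> \<Longrightarrow>
      Cmp D (fobj F a) (fobj G a) (fobj G b) (fmor G a b f) (\<alpha> a) =
      Cmp D (fobj F a) (fobj F b) (fobj G b) (\<alpha> b) (fmor F a b f)"
  shows "isomorphic (Fct C D) F G"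
proof -
  interpret D: category D by fact
  note [simp] = assms(4,5) is_functorD(2,3)[OF assms(2)] is_functorD(2,3)[OF assms(3)]
  have 1: "restrict \<alpha> (Ob C) \<in> nat_trans C D F G"
    by (rule nat_transI) (use assms in auto)
  have 2: "restrict \<beta> (Ob C) \<in> nat_trans C D G F"
  proof (rule nat_transI, goal_cases)
    case (3 a b f)
    have "Cmp D (fobj G a) (fobj F a) (fobj F b) (fmor F a b f) (\<beta> a) =
      Cmp D (fobj G a) (fobj F a) (fobj F b) (Cmp D (fobj F a) (fobj G b) (fobj F b) (\<beta> b)
        (Cmp D (fobj F a) (fobj F b) (fobj G b) (\<alpha> b) (fmor F a b f))) (\<beta> a)"
      using 3 D.Cmp_cong_assoc[OF assms(6)[of b], of "fobj G a"
          "Cmp D (fobj G a) (fobj F a) (fobj F b) (fmor F a b f) (\<beta> a)"] by simp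
    also have "\<dots> = Cmp D (fobj G a) (fobj G b) (fobj F b) (\<beta> b)
       (Cmp D (fobj G a) (fobj G a) (fobj G b) (fmor G a b f)
         (Cmp D (fobj G a) (fobj F a) (fobj G a) (\<alpha> a) (\<beta> a)))"
      using 3 by (subst nat[symmetric]) (auto simp del: assms(7))
    also have "\<dots> = Cmp D (fobj G a) (fobj G b) (fobj F b) (\<beta> b) (fmor G a b f)"
      using 3 assms(7)[of a] by simp
    finally show ?case using 3 by simp
  qed auto
  have "is_inverse (Fct C D) F G (restrict \<alpha> (Ob C)) (restrict \<beta> (Ob C))"
    unfolding is_inverse_def using 1 2 assms(6,7) by (auto simp: fun_eq_iff)
  then show ?thesis using assms(2,3) by (auto simp: isomorphic_def invertible_def)
qed

text \<open>The quasi-inverse chooses preimages up to isomorphism, conjugates arrows by the chosen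
  isomorphisms (\<open>m\<close>) and lifts them by full faithfulness (\<open>R\<close>). Equations
  between lifts are checked after applying F, which is injective on arrows.\<close>

lemma equivalence_if_ff_es:
  assumes C: "category C" and D: "category D" and F: "is_functor C D F"
    and ff: "\<And>a b. \<lbrakk>a \<in> Ob C; b \<in> Ob C\<rbrakk>
      \<Longrightarrow> bij_betw (fmor F a b) (Hom C a b) (Hom D (fobj F a) (fobj F b))"
    and es: "\<And>d. d \<in> Ob D \<Longrightarrow> \<exists>c\<in>Ob C. isomorphic D (fobj F c) d"
  shows "is_equivalence C D F"
proof -
  interpret C: category C by fact
  interpret D: category D by fact
  have "\<exists>c i k. c \<in> Ob C \<and> is_inverse D (fobj F c) d i k" if "d \<in> Ob D" for d
    using es[OF that] by (auto simp: isomorphic_def invertible_def)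
  then obtain g i k where g: "\<And>d. d \<in> Ob D \<Longrightarrow> g d \<in> Ob C"
    and ik: "\<And>d. d \<in> Ob D \<Longrightarrow> is_inverse D (fobj F (g d)) d (i d) (k d)"
    by metis
  have i: "i d \<in> Hom D (fobj F (g d)) d" and k: "k d \<in> Hom D d (fobj F (g d))"
    and ki: "Cmp D (fobj F (g d)) d (fobj F (g d)) (k d) (i d) = Idn D (fobj F (g d))"
    and ik: "Cmp D d (fobj F (g d)) d (i d) (k d) = Idn D d" if "d \<in> Ob D" for d
    using ik[OF that] by (auto simp: is_inverse_def)
  note Fo = is_functorD(2)[OF F] and Fm = is_functorD(3)[OF F] and Fi = is_functorD(4)[OF F]
    and Fc = is_functorD(5)[OF F]
  note [simp] = g i k Fo Fm Fi
  define R where "R a b h = inv_into (Hom C a b) (fmor F a b) h" for a b h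
  have R_in: "R a b h \<in> Hom C a b" and FR: "fmor F a b (R a b h) = h"
    if "a \<in> Ob C" "b \<in> Ob C" "h \<in> Hom D (fobj F a) (fobj F b)" for a b h
    using ff[OF that(1,2)] that(3) unfolding R_def
    by (auto simp: bij_betw_def inv_into_into f_inv_into_f)
  have RF: "R a b f = f'" if "a \<in> Ob C" "b \<in> Ob C" "f' \<in> Hom C a b" "fmor F a b f' = f" for a b f f'
    using ff[OF that(1,2)] that(3,4) unfolding R_def by (auto simp: bij_betw_def)
  have inj: "f = f'" if "a \<in> Ob C" "b \<in> Ob C" "f \<in> Hom C a b" "f' \<in> Hom C a b"
      "fmor F a b f = fmor F a b f'" for a b f f'
    using ff[OF that(1,2)] that(3-) by (auto simp: bij_betw_def inj_on_def)
  note [simp] = R_in FR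
  define m where "m d e h = Cmp D (fobj F (g d)) d (fobj F (g e)) (Cmp D d e (fobj F (g e)) (k e) h) (i d)"
    for d e h
  have m_in [simp]: "m d e h \<in> Hom D (fobj F (g d)) (fobj F (g e))"
    if "d \<in> Ob D" "e \<in> Ob D" "h \<in> Hom D d e" for d e h
    using that by (simp add: m_def)
  define G where "G = mk_func D g (\<lambda>d e h. R (g d) (g e) (m d e h))"
  have cancel: "Cmp D x (fobj F (g d)) d (i d) (Cmp D x d (fobj F (g d)) (k d) h) = h"
    if "d \<in> Ob D" "x \<in> Ob D" "h \<in> Hom D x d" for x d h
    using that D.Cmp_assoc[of x d "fobj F (g d)" d h "k d" "i d"] by (simp add: ik)
  have cancel': "Cmp D x d (fobj F (g d)) (k d) (Cmp D x (fobj F (g d)) d (i d) h) = h"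
    if "d \<in> Ob D" "x \<in> Ob D" "h \<in> Hom D x (fobj F (g d))" for x d h
    using that D.Cmp_assoc[of x "fobj F (g d)" d "fobj F (g d)" h "i d" "k d"] by (simp add: ki)
  have G: "is_functor D C G" unfolding G_def
  proof (rule is_functor_mk_func, goal_cases)
    case (4 a)
    then show ?case by (intro RF) (auto simp: m_def ki)
  next
    case (5 a b c f h)
    have "fmor F (g a) (g c) (Cmp C (g a) (g b) (g c) (R (g b) (g c) (m b c h)) (R (g a) (g b) (m a b f)))
        = m a c (Cmp D a b c h f)"
      using 5 by (simp add: Fc) (simp add: m_def cancel)
    then show ?case using 5 by (intro RF) auto
  qed (auto simp: D)
  have GF: "is_functor C C (comp_func C G F)" and FG: "is_functor D D (comp_func D F G)"
    using C D F G is_functor_comp_func by blast+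
  have [simp]: "fobj G d = g d" if "d \<in> Ob D" for d using that by (simp add: G_def)
  have [simp]: "fmor F (g d) (g e) (fmor G d e h) = m d e h" if "d \<in> Ob D" "e \<in> Ob D" "h \<in> Hom D d e" for d e h
    using that by (simp add: G_def)
  have [simp]: "fmor G d e h \<in> Hom C (g d) (g e)" if "d \<in> Ob D" "e \<in> Ob D" "h \<in> Hom D d e" for d e h
    using that is_functorD(3)[OF G] by simp
  have "isomorphic (Fct C C) (comp_func C G F) (id_func C)"
  proof (rule isomorphic_Fct[where \<alpha> = "\<lambda>c. R (g (fobj F c)) c (i (fobj F c))"
        and \<beta> = "\<lambda>c. R c (g (fobj F c)) (k (fobj F c))"], goal_cases)
    case (6 a)
    then show ?case by (simp, intro inj[of "g (fobj F a)" "g (fobj F a)"]) (auto simp: Fc ki)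
  next
    case (7 a)
    then show ?case by (simp, intro inj[of a a]) (auto simp: Fc ik)
  next
    case (8 a b f)
    then show ?case by (simp, intro inj[of "g (fobj F a)" b]) (auto simp: Fc m_def cancel)
  qed (auto simp: C GF is_functor_id_func)
  moreover have "isomorphic (Fct D D) (comp_func D F G) (id_func D)"
    by (rule isomorphic_Fct[where \<alpha> = i and \<beta> = k])
      (auto simp: D FG is_functor_id_func ik ki m_def cancel)
  ultimately show ?thesis unfolding is_equivalence_def using C D F G by blast
qed

section \<open>Additive categories and splitting of idempotents\<close>

context additive_category
begin

abbreviation (input) zero :: "'o \<Rightarrow> 'o \<Rightarrow> 'm" where "zero a b \<equiv> \<one>\<^bsub>Hgrp A a b\<^esub>"

lemma Hgrp_group: "\<lbrakk>a \<in> Ob A; b \<in> Ob A\<rbrakk> \<Longrightarrow> group (Hgrp A a b)"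
  using Hgrp_comm_group comm_group.axioms(2) by blast

lemma add_in [simp]:
  "\<lbrakk>a \<in> Ob A; b \<in> Ob A; f \<in> Hom A a b; g \<in> Hom A a b\<rbrakk> \<Longrightarrow> f \<otimes>\<^bsub>Hgrp A a b\<^esub> g \<in> Hom A a b"
  using Hgrp_carrier Hgrp_comm_group by (metis Hgrp_group group.is_monoid monoid.m_closed)

lemma zero_in [simp]: "\<lbrakk>a \<in> Ob A; b \<in> Ob A\<rbrakk> \<Longrightarrow> (zero a b) \<in> Hom A a b"
  using Hgrp_carrier Hgrp_comm_group by (metis Hgrp_group group.is_monoid monoid.one_closed)

lemma neg_in [simp]:
  "\<lbrakk>a \<in> Ob A; b \<in> Ob A; f \<in> Hom A a b\<rbrakk> \<Longrightarrow> inv\<^bsub>Hgrp A a b\<^esub> f \<in> Hom A a b"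
  using Hgrp_carrier Hgrp_comm_group by (metis Hgrp_group group.inv_closed)

lemma add_assoc:
  "\<lbrakk>a \<in> Ob A; b \<in> Ob A; f \<in> Hom A a b; g \<in> Hom A a b; h \<in> Hom A a b\<rbrakk>
    \<Longrightarrow> f \<otimes>\<^bsub>Hgrp A a b\<^esub> g \<otimes>\<^bsub>Hgrp A a b\<^esub> h = f \<otimes>\<^bsub>Hgrp A a b\<^esub> (g \<otimes>\<^bsub>Hgrp A a b\<^esub> h)"
  using Hgrp_carrier Hgrp_comm_group by (metis Hgrp_group group.is_monoid monoid.m_assoc)

lemma add_comm:
  "\<lbrakk>a \<in> Ob A; b \<in> Ob A; f \<in> Hom A a b; g \<in> Hom A a b\<rbrakk>
    \<Longrightarrow> f \<otimes>\<^bsub>Hgrp A a b\<^esub> g = g \<otimes>\<^bsub>Hgrp A a b\<^esub> f"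
  using Hgrp_carrier Hgrp_comm_group by (metis comm_group.axioms(1) comm_monoid.m_comm)

lemma add_lcomm:
  assumes "a \<in> Ob A" "b \<in> Ob A" "f \<in> Hom A a b" "g \<in> Hom A a b" "h \<in> Hom A a b"
  shows "f \<otimes>\<^bsub>Hgrp A a b\<^esub> (g \<otimes>\<^bsub>Hgrp A a b\<^esub> h) = g \<otimes>\<^bsub>Hgrp A a b\<^esub> (f \<otimes>\<^bsub>Hgrp A a b\<^esub> h)"
  using assms add_assoc add_comm by metis

lemmas add_ac = add_assoc add_comm add_lcomm

lemma add_zero [simp]:
  "\<lbrakk>a \<in> Ob A; b \<in> Ob A; f \<in> Hom A a b\<rbrakk> \<Longrightarrow> f \<otimes>\<^bsub>Hgrp A a b\<^esub> (zero a b) = f"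
  using Hgrp_carrier Hgrp_comm_group by (metis Hgrp_group group.is_monoid monoid.r_one)

lemma zero_add [simp]:
  "\<lbrakk>a \<in> Ob A; b \<in> Ob A; f \<in> Hom A a b\<rbrakk> \<Longrightarrow> (zero a b) \<otimes>\<^bsub>Hgrp A a b\<^esub> f = f"
  using Hgrp_carrier Hgrp_comm_group by (metis Hgrp_group group.is_monoid monoid.l_one)

lemma add_neg [simp]:
  "\<lbrakk>a \<in> Ob A; b \<in> Ob A; f \<in> Hom A a b\<rbrakk> \<Longrightarrow> f \<otimes>\<^bsub>Hgrp A a b\<^esub> inv\<^bsub>Hgrp A a b\<^esub> f = zero a b"
  using Hgrp_carrier Hgrp_comm_group by (metis Hgrp_group group.r_inv)

lemma neg_add [simp]:
  "\<lbrakk>a \<in> Ob A; b \<in> Ob A; f \<in> Hom A a b\<rbrakk> \<Longrightarrow> inv\<^bsub>Hgrp A a b\<^esub> f \<otimes>\<^bsub>Hgrp A a b\<^esub> f = zero a b"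
  using Hgrp_carrier Hgrp_comm_group by (metis Hgrp_group group.l_inv)

lemma add_neg_cancel [simp]:
  "\<lbrakk>a \<in> Ob A; b \<in> Ob A; f \<in> Hom A a b; g \<in> Hom A a b\<rbrakk>
    \<Longrightarrow> f \<otimes>\<^bsub>Hgrp A a b\<^esub> (inv\<^bsub>Hgrp A a b\<^esub> f \<otimes>\<^bsub>Hgrp A a b\<^esub> g) = g"
  by (simp flip: add_assoc)

lemma neg_add_cancel [simp]:
  "\<lbrakk>a \<in> Ob A; b \<in> Ob A; f \<in> Hom A a b; g \<in> Hom A a b\<rbrakk>
    \<Longrightarrow> inv\<^bsub>Hgrp A a b\<^esub> f \<otimes>\<^bsub>Hgrp A a b\<^esub> (f \<otimes>\<^bsub>Hgrp A a b\<^esub> g) = g"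
  by (simp flip: add_assoc)

lemma add_left_cancel:
  "\<lbrakk>a \<in> Ob A; b \<in> Ob A; f \<in> Hom A a b; g \<in> Hom A a b; h \<in> Hom A a b\<rbrakk>
    \<Longrightarrow> f \<otimes>\<^bsub>Hgrp A a b\<^esub> g = f \<otimes>\<^bsub>Hgrp A a b\<^esub> h \<longleftrightarrow> g = h"
  by (metis neg_add_cancel)

lemma add_right_cancel:
  "\<lbrakk>a \<in> Ob A; b \<in> Ob A; f \<in> Hom A a b; g \<in> Hom A a b; h \<in> Hom A a b\<rbrakk>
    \<Longrightarrow> g \<otimes>\<^bsub>Hgrp A a b\<^esub> f = h \<otimes>\<^bsub>Hgrp A a b\<^esub> f \<longleftrightarrow> g = h"
  by (metis add_left_cancel add_comm)

lemma neg_unique: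
  "\<lbrakk>a \<in> Ob A; b \<in> Ob A; f \<in> Hom A a b; g \<in> Hom A a b; f \<otimes>\<^bsub>Hgrp A a b\<^esub> g = (zero a b)\<rbrakk>
    \<Longrightarrow> g = inv\<^bsub>Hgrp A a b\<^esub> f"
  by (metis add_neg add_left_cancel neg_in)

lemma neg_neg [simp]:
  "\<lbrakk>a \<in> Ob A; b \<in> Ob A; f \<in> Hom A a b\<rbrakk> \<Longrightarrow> inv\<^bsub>Hgrp A a b\<^esub> (inv\<^bsub>Hgrp A a b\<^esub> f) = f"
  by (metis neg_unique neg_add neg_in)

lemma neg_zero [simp]: "\<lbrakk>a \<in> Ob A; b \<in> Ob A\<rbrakk> \<Longrightarrow> inv\<^bsub>Hgrp A a b\<^esub> (zero a b) = zero a b"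
  by (metis neg_unique zero_add zero_in)

lemma diff_zeroD:
  assumes "a \<in> Ob A" "b \<in> Ob A" "f \<in> Hom A a b" "g \<in> Hom A a b"
    and "f \<otimes>\<^bsub>Hgrp A a b\<^esub> inv\<^bsub>Hgrp A a b\<^esub> g = zero a b"
  shows "f = g"
proof -
  have "inv\<^bsub>Hgrp A a b\<^esub> g = inv\<^bsub>Hgrp A a b\<^esub> f" using assms neg_unique neg_in by blast
  then show ?thesis using neg_neg[OF assms(1,2,3)] neg_neg[OF assms(1,2,4)] by simp
qed

declare Cmp_add_left [simp] Cmp_add_right [simp]

lemma idem_zero:
  assumes "a \<in> Ob A" "b \<in> Ob A" "f \<in> Hom A a b" "f \<otimes>\<^bsub>Hgrp A a b\<^esub> f = f"
  shows "f = zero a b"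
  using assms by (metis add_zero add_left_cancel zero_in)

lemma Cmp_zero_right [simp]:
  assumes "a \<in> Ob A" "b \<in> Ob A" "c \<in> Ob A" "g \<in> Hom A b c"
  shows "Cmp A a b c g (zero a b) = zero a c"
  using assms Cmp_add_right[of a b c "(zero a b)" "(zero a b)" g] by (intro idem_zero) auto

lemma Cmp_zero_left [simp]:
  assumes "a \<in> Ob A" "b \<in> Ob A" "c \<in> Ob A" "f \<in> Hom A a b"
  shows "Cmp A a b c (zero b c) f = zero a c"
  using assms Cmp_add_left[of a b c f "(zero b c)" "(zero b c)"] by (intro idem_zero) auto

lemma Cmp_neg_right [simp]:
  assumes "a \<in> Ob A" "b \<in> Ob A" "c \<in> Ob A" "f \<in> Hom A a b" "g \<in> Hom A b c"
  shows "Cmp A a b c g (inv\<^bsub>Hgrp A a b\<^esub> f) = inv\<^bsub>Hgrp A a c\<^esub> (Cmp A a b c g f)"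
  using assms by (intro neg_unique) (auto simp flip: Cmp_add_right)

lemma Cmp_neg_left [simp]:
  assumes "a \<in> Ob A" "b \<in> Ob A" "c \<in> Ob A" "f \<in> Hom A a b" "g \<in> Hom A b c"
  shows "Cmp A a b c (inv\<^bsub>Hgrp A b c\<^esub> g) f = inv\<^bsub>Hgrp A a c\<^esub> (Cmp A a b c g f)"
  using assms by (intro neg_unique) (auto simp flip: Cmp_add_left)

lemma null_in: "is_null A z \<Longrightarrow> z \<in> Ob A"
  by (simp add: is_null_def)

lemma null_from: "\<lbrakk>is_null A z; a \<in> Ob A; f \<in> Hom A z a\<rbrakk> \<Longrightarrow> f = zero z a"
  using zero_in unfolding is_null_def by blast

lemma null_to: "\<lbrakk>is_null A z; a \<in> Ob A; f \<in> Hom A a z\<rbrakk> \<Longrightarrow> f = zero a z"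
  using zero_in unfolding is_null_def by blast

lemma Zob_in [simp]: "Zob A \<in> Ob A"
  using Zob_null null_in by blast

lemma is_zero_mor_iff:
  assumes "a \<in> Ob A" "b \<in> Ob A"
  shows "is_zero_mor A a b f \<longleftrightarrow> f = zero a b"
proof
  assume "is_zero_mor A a b f"
  then obtain z h k where z: "is_null A z" "h \<in> Hom A a z" "k \<in> Hom A z b" "f = Cmp A a z b k h"
    by (auto simp: is_zero_mor_def)
  then show "f = zero a b"
    using assms null_to[OF z(1) assms(1) z(2)] null_in by simp
next
  assume "f = zero a b"
  then show "is_zero_mor A a b f"
    unfolding is_zero_mor_def using assms Zob_null
    by (intro exI[of _ "Zob A"] exI[of _ "(zero a (Zob A))"] exI[of _ "(zero (Zob A) b)"]) auto
qed

lemma is_null_iff: "is_null A a \<longleftrightarrow> a \<in> Ob A \<and> Idn A a = zero a a"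
proof
  assume "is_null A a"
  then show "a \<in> Ob A \<and> Idn A a = zero a a"
    using null_in null_from Idn_in by blast
next
  assume a: "a \<in> Ob A \<and> Idn A a = zero a a"
  have "f = zero a b" if "b \<in> Ob A" "f \<in> Hom A a b" for b f
    using a that Cmp_Idn_right[of a b f] by (simp del: Cmp_Idn_right)
  moreover have "f = zero b a" if "b \<in> Ob A" "f \<in> Hom A b a" for b f
    using a that Cmp_Idn_left[of b a f] by (simp del: Cmp_Idn_left)
  ultimately show "is_null A a" unfolding is_null_def using a zero_in by blast
qed

lemma null_retract:
  assumes "is_null A b" "a \<in> Ob A" "s \<in> Hom A a b" "r \<in> Hom A b a" "Cmp A a b a r s = Idn A a"
  shows "is_null A a"
  using assms null_to[OF assms(1,2,3)] null_in[OF assms(1)] by (simp add: is_null_iff)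

end

context abelian_category
begin

text \<open>The image of e is the kernel i of 1 - e. As (1 - e) e = 0, e factors as i q; and e i = i
  gives i (q i) = i, whence q i = 1 by uniqueness.\<close>

lemma idempotent_splits:
  assumes a: "a \<in> Ob B" and e: "e \<in> Hom B a a" and ee: "Cmp B a a a e e = e"
  shows "\<exists>c q h. c \<in> Ob B \<and> q \<in> Hom B a c \<and> h \<in> Hom B c a \<and>
    Cmp B c a c q h = Idn B c \<and> Cmp B a c a h q = e"
proof -
  let ?f = "Idn B a \<otimes>\<^bsub>Hgrp B a a\<^esub> inv\<^bsub>Hgrp B a a\<^esub> e"
  have f: "?f \<in> Hom B a a" using a e by simp
  obtain k i where "is_kernel B a a ?f k i" using has_kernel[OF a a f] by blast
  then have k: "k \<in> Ob B" and i: "i \<in> Hom B k a" and z: "is_zero_mor B k a (Cmp B k a a ?f i)"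
    and u: "\<And>d g. \<lbrakk>d \<in> Ob B; g \<in> Hom B d a; is_zero_mor B d a (Cmp B d a a ?f g)\<rbrakk>
       \<Longrightarrow> \<exists>!h. h \<in> Hom B d k \<and> Cmp B d k a i h = g"
    unfolding is_kernel_def by blast+
  have "i \<otimes>\<^bsub>Hgrp B k a\<^esub> inv\<^bsub>Hgrp B k a\<^esub> (Cmp B k a a e i) = \<one>\<^bsub>Hgrp B k a\<^esub>"
    using z a k i e by (simp add: is_zero_mor_iff)
  then have ei: "Cmp B k a a e i = i"
    using a k i e diff_zeroD[of k a i "Cmp B k a a e i"] by simp
  have "is_zero_mor B a a (Cmp B a a a ?f e)"
    using a e ee by (simp add: is_zero_mor_iff)
  then obtain q where q: "q \<in> Hom B a k" "Cmp B a k a i q = e" using u[OF a e] by blast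
  have "is_zero_mor B k a (Cmp B k a a ?f i)" by fact
  then have "\<exists>!h. h \<in> Hom B k k \<and> Cmp B k k a i h = i" using u[OF k i] by blast
  moreover have "Cmp B k k a i (Cmp B k a k q i) = i"
    using Cmp_assoc[of k a k a i q i] q ei i k a by simp
  moreover have "Cmp B k k a i (Idn B k) = i" using i k a by simp
  ultimately have "Cmp B k a k q i = Idn B k" using q i k a by (metis Cmp_in Idn_in)
  then show ?thesis using k i q by blast
qed

text \<open>The data \<open>ko\<close>, \<open>km\<close> respect composition, while the identity of
  a may go to any idempotent of \<open>ko a\<close>. F takes a to the image of this idempotent, with
  projection \<open>q a\<close> and inclusion \<open>h a\<close>.\<close>

definition splits_semifunctor ::
    "('p, 'n, 'y) cat_scheme \<Rightarrow> ('p \<Rightarrow> 'o) \<Rightarrow> ('p \<Rightarrow> 'p \<Rightarrow> 'n \<Rightarrow> 'm) \<Rightarrow> ('p, 'n, 'o, 'm) func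
      \<Rightarrow> ('p \<Rightarrow> 'm) \<Rightarrow> ('p \<Rightarrow> 'm) \<Rightarrow> bool" where
  "splits_semifunctor C ko km F q h \<longleftrightarrow> is_functor C B F \<and>
    (\<forall>a\<in>Ob C. q a \<in> Hom B (ko a) (fobj F a) \<and> h a \<in> Hom B (fobj F a) (ko a) \<and>
      Cmp B (fobj F a) (ko a) (fobj F a) (q a) (h a) = Idn B (fobj F a) \<and>
      Cmp B (ko a) (fobj F a) (ko a) (h a) (q a) = km a a (Idn C a)) \<and>
    (\<forall>a\<in>Ob C. \<forall>b\<in>Ob C. \<forall>f\<in>Hom C a b. fmor F a b f =
      Cmp B (fobj F a) (ko a) (fobj F b) (Cmp B (ko a) (ko b) (fobj F b) (q b) (km a b f)) (h a))"

lemma semifunctor_splits: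
  fixes C :: "('p, 'n, 'y) cat_scheme"
  assumes C: "category C"
    and ko: "\<And>a. a \<in> Ob C \<Longrightarrow> ko a \<in> Ob B"
    and km: "\<And>a b f. \<lbrakk>a \<in> Ob C; b \<in> Ob C; f \<in> Hom C a b\<rbrakk> \<Longrightarrow> km a b f \<in> Hom B (ko a) (ko b)"
    and kc: "\<And>a b c f g. \<lbrakk>a \<in> Ob C; b \<in> Ob C; c \<in> Ob C; f \<in> Hom C a b; g \<in> Hom C b c\<rbrakk>
      \<Longrightarrow> km a c (Cmp C a b c g f) = Cmp B (ko a) (ko b) (ko c) (km b c g) (km a b f)"
  shows "\<exists>F q h. splits_semifunctor C ko km F q h"
proof -
  interpret C: category C by fact
  have "\<exists>c q h. c \<in> Ob B \<and> q \<in> Hom B (ko a) c \<and> h \<in> Hom B c (ko a) \<and>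
    Cmp B c (ko a) c q h = Idn B c \<and> Cmp B (ko a) c (ko a) h q = km a a (Idn C a)"
    if a: "a \<in> Ob C" for a
    using idempotent_splits[of "ko a" "km a a (Idn C a)"] a ko km kc[of a a a "Idn C a" "Idn C a"] by simp
  then obtain c q h where c: "\<And>a. a \<in> Ob C \<Longrightarrow> c a \<in> Ob B"
    and q: "\<And>a. a \<in> Ob C \<Longrightarrow> q a \<in> Hom B (ko a) (c a)"
    and h: "\<And>a. a \<in> Ob C \<Longrightarrow> h a \<in> Hom B (c a) (ko a)"
    and qh: "\<And>a. a \<in> Ob C \<Longrightarrow> Cmp B (c a) (ko a) (c a) (q a) (h a) = Idn B (c a)"
    and hq: "\<And>a. a \<in> Ob C \<Longrightarrow> Cmp B (ko a) (c a) (ko a) (h a) (q a) = km a a (Idn C a)"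
    by metis
  note [simp] = ko km c q h
  define F where "F = mk_func C c (\<lambda>a b f.
    Cmp B (c a) (ko a) (c b) (Cmp B (ko a) (ko b) (c b) (q b) (km a b f)) (h a))"
  have hq': "Cmp B x (c a) (ko a) (h a) (Cmp B x (ko a) (c a) (q a) f) = Cmp B x (ko a) (ko a) (km a a (Idn C a)) f"
    if "a \<in> Ob C" "x \<in> Ob B" "f \<in> Hom B x (ko a)" for a x f
    using that Cmp_cong_assoc[OF hq] by simp
  have kq: "Cmp B x (ko a) (ko b) (km a b g) (Cmp B x (ko a) (ko a) (km a a (Idn C a)) f) =
      Cmp B x (ko a) (ko b) (km a b g) f"
    if "a \<in> Ob C" "b \<in> Ob C" "g \<in> Hom C a b" "x \<in> Ob B" "f \<in> Hom B x (ko a)" for a b g x f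
    using that Cmp_cong_assoc[OF kc[of a a b "Idn C a" g, symmetric]] by simp
  have hk: "Cmp B (c a) (ko a) (ko a) (km a a (Idn C a)) (h a) = h a" if "a \<in> Ob C" for a
    using that Cmp_cong_assoc[OF hq, of a "c a" "h a"] qh[of a] by simp
  have F: "is_functor C B F" unfolding F_def
  proof (rule is_functor_mk_func, goal_cases)
    case (4 a)
    then show ?case using hk qh by simp
  next
    case (5 a b c f g)
    then show ?case by (simp add: hq' kq kc)
  qed (auto simp: C)
  then show ?thesis
    by (intro exI[of _ F] exI[of _ q] exI[of _ h]) (auto simp: splits_semifunctor_def F_def hq qh)
qed

end

section \<open>Shifts and polynomial functors\<close>

context additive_category
begin

text \<open>Identity and zero transformation are both endomorphisms of Z, so they coincide when Z is
  null; evaluated at a, this makes Z a null.\<close>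

lemma Fct_null_iff:
  assumes N: "category N"
  shows "is_null (Fct N A) Z \<longleftrightarrow> is_functor N A Z \<and> (\<forall>a\<in>Ob N. is_null A (fobj Z a))"
proof safe
  assume Z: "is_null (Fct N A) Z"
  then show F: "is_functor N A Z" by (simp add: is_null_def)
  fix a assume a: "a \<in> Ob N"
  note [simp] = is_functorD(2,3)[OF F]
  have "(\<lambda>a\<in>Ob N. Idn A (fobj Z a)) \<in> nat_trans N A Z Z"
    by (rule nat_transI) auto
  moreover have "(\<lambda>a\<in>Ob N. \<one>\<^bsub>Hgrp A (fobj Z a) (fobj Z a)\<^esub>) \<in> nat_trans N A Z Z"
    by (rule nat_transI) auto
  ultimately have "(\<lambda>a\<in>Ob N. Idn A (fobj Z a)) = (\<lambda>a\<in>Ob N. \<one>\<^bsub>Hgrp A (fobj Z a) (fobj Z a)\<^esub>)"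
    using Z by (auto simp: is_null_def)
  from fun_cong[OF this, of a] a show "is_null A (fobj Z a)" by (simp add: is_null_iff)
next
  assume F: "is_functor N A Z" and Z: "\<forall>a\<in>Ob N. is_null A (fobj Z a)"
  have "\<exists>!\<alpha>. \<alpha> \<in> nat_trans N A Z G" and "\<exists>!\<alpha>. \<alpha> \<in> nat_trans N A G Z" if G: "is_functor N A G" for G
  proof -
    note [simp] = is_functorD(2,3)[OF F] is_functorD(2,3)[OF G]
    have "(\<lambda>a\<in>Ob N. \<one>\<^bsub>Hgrp A (fobj Z a) (fobj G a)\<^esub>) \<in> nat_trans N A Z G"
      by (rule nat_transI) auto
    moreover have "\<alpha> = (\<lambda>a\<in>Ob N. \<one>\<^bsub>Hgrp A (fobj Z a) (fobj G a)\<^esub>)" if "\<alpha> \<in> nat_trans N A Z G" for \<alpha>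
      by (rule extensionalityI[of _ "Ob N"]) (use Z nat_transD[OF that] null_from in auto)
    ultimately show "\<exists>!\<alpha>. \<alpha> \<in> nat_trans N A Z G" by blast
    have "(\<lambda>a\<in>Ob N. \<one>\<^bsub>Hgrp A (fobj G a) (fobj Z a)\<^esub>) \<in> nat_trans N A G Z"
      by (rule nat_transI) auto
    moreover have "\<alpha> = (\<lambda>a\<in>Ob N. \<one>\<^bsub>Hgrp A (fobj G a) (fobj Z a)\<^esub>)" if "\<alpha> \<in> nat_trans N A G Z" for \<alpha>
      by (rule extensionalityI[of _ "Ob N"]) (use Z nat_transD[OF that] null_to in auto)
    ultimately show "\<exists>!\<alpha>. \<alpha> \<in> nat_trans N A G Z" by blast
  qed
  then show "is_null (Fct N A) Z" using F by (simp add: is_null_def)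
qed

lemma Fct_zero_mor_iff:
  assumes N: "category N" and F: "is_functor N A F" and G: "is_functor N A G"
    and \<alpha>: "\<alpha> \<in> nat_trans N A F G"
  shows "is_zero_mor (Fct N A) F G \<alpha> \<longleftrightarrow> (\<forall>a\<in>Ob N. \<alpha> a = \<one>\<^bsub>Hgrp A (fobj F a) (fobj G a)\<^esub>)"
proof safe
  note [simp] = is_functorD(2,3)[OF F] is_functorD(2,3)[OF G]
  fix a assume "is_zero_mor (Fct N A) F G \<alpha>" and a: "a \<in> Ob N"
  then obtain Z h k where Z: "is_null (Fct N A) Z" and h: "h \<in> nat_trans N A F Z" and k: "k \<in> nat_trans N A Z G"
    and e: "\<alpha> = (\<lambda>a\<in>Ob N. Cmp A (fobj F a) (fobj Z a) (fobj G a) (k a) (h a))"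
    by (auto simp: is_zero_mor_def)
  have z: "is_null A (fobj Z a)" using Z a Fct_null_iff[OF N] by blast
  have [simp]: "fobj Z a \<in> Ob A" "fobj F a \<in> Ob A" "fobj G a \<in> Ob A" using z null_in a by auto
  have "k a = \<one>\<^bsub>Hgrp A (fobj Z a) (fobj G a)\<^esub>" using null_from[OF z] nat_transD(2)[OF k a] by simp
  then show "\<alpha> a = \<one>\<^bsub>Hgrp A (fobj F a) (fobj G a)\<^esub>"
    using nat_transD(2)[OF h a] a by (simp add: e)
next
  note [simp] = is_functorD(2,3)[OF F] is_functorD(2,3)[OF G]
  assume z: "\<forall>a\<in>Ob N. \<alpha> a = \<one>\<^bsub>Hgrp A (fobj F a) (fobj G a)\<^esub>"
  \<comment> \<open>A pointwise zero transformation factors through the constant functor at the null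
    object.\<close>
  let ?Z = "mk_func N (\<lambda>_. Zob A) (\<lambda>_ _ _. Idn A (Zob A))"
  have "is_functor N A ?Z" by (rule is_functor_mk_func) (auto simp: N)
  then have Z: "is_null (Fct N A) ?Z" using Fct_null_iff[OF N] Zob_null by simp
  have h: "(\<lambda>a\<in>Ob N. \<one>\<^bsub>Hgrp A (fobj F a) (Zob A)\<^esub>) \<in> nat_trans N A F ?Z"
    by (rule nat_transI) auto
  have k: "(\<lambda>a\<in>Ob N. \<one>\<^bsub>Hgrp A (Zob A) (fobj G a)\<^esub>) \<in> nat_trans N A ?Z G"
    by (rule nat_transI) auto
  have "\<alpha> = (\<lambda>a\<in>Ob N. Cmp A (fobj F a) (fobj ?Z a) (fobj G a)
      ((\<lambda>a\<in>Ob N. \<one>\<^bsub>Hgrp A (Zob A) (fobj G a)\<^esub>) a) ((\<lambda>a\<in>Ob N. \<one>\<^bsub>Hgrp A (fobj F a) (Zob A)\<^esub>) a))"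
    by (rule extensionalityI[of _ "Ob N"]) (use z nat_transD(1)[OF \<alpha>] in auto)
  then show "is_zero_mor (Fct N A) F G \<alpha>"
    unfolding is_zero_mor_def Fct_simps using Z h k by blast
qed

end

section \<open>Split cokernels of the shift maps\<close>

definition shift_in :: "('o, 'm, 'z) smcat_scheme \<Rightarrow> 'o \<Rightarrow> 'o \<Rightarrow> 'm" where
  "shift_in N x y = Cmp N y (Tens N (Unt N) y) (Tens N x y)
     (Tmor N (Unt N) x y y (the_elem (Hom N (Unt N) x)) (Idn N y))
     (inverse_of N (Tens N (Unt N) y) y (Lun N y))"

lemma shift_map_eq: "shift_map N x F = (\<lambda>y\<in>Ob N. fmor F y (Tens N x y) (shift_in N x y))"
  by (simp add: shift_map_def shift_in_def)

text \<open>The common ground of the direct sum on A and of \<open>tilde M\<close>: x \<oplus> - is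
  a functor, y -> x \<oplus> y is natural, and it has the natural retraction \<open>p\<close>,
  induced by x -> 0 when the unit is null. Through \<open>p\<close> every functor splits the map F
  -> F(x \<oplus> -).\<close>

locale shiftable = category N for N :: "('o, 'm, 'z) smcat_scheme" +
  fixes p :: "'o \<Rightarrow> 'o \<Rightarrow> 'm"
  assumes Tens_in [simp]: "\<lbrakk>x \<in> Ob N; y \<in> Ob N\<rbrakk> \<Longrightarrow> Tens N x y \<in> Ob N"
    and whisker_in [simp]: "\<lbrakk>x \<in> Ob N; y \<in> Ob N; z \<in> Ob N; f \<in> Hom N y z\<rbrakk>
      \<Longrightarrow> Tmor N x x y z (Idn N x) f \<in> Hom N (Tens N x y) (Tens N x z)"
    and whisker_Idn [simp]: "\<lbrakk>x \<in> Ob N; y \<in> Ob N\<rbrakk>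
      \<Longrightarrow> Tmor N x x y y (Idn N x) (Idn N y) = Idn N (Tens N x y)"
    and whisker_Cmp [simp]: "\<lbrakk>x \<in> Ob N; y \<in> Ob N; z \<in> Ob N; w \<in> Ob N; f \<in> Hom N y z; g \<in> Hom N z w\<rbrakk>
      \<Longrightarrow> Tmor N x x y w (Idn N x) (Cmp N y z w g f) =
        Cmp N (Tens N x y) (Tens N x z) (Tens N x w)
          (Tmor N x x z w (Idn N x) g) (Tmor N x x y z (Idn N x) f)"
    and shift_in_in [simp]: "\<lbrakk>x \<in> Ob N; y \<in> Ob N\<rbrakk> \<Longrightarrow> shift_in N x y \<in> Hom N y (Tens N x y)"
    and shift_in_nat: "\<lbrakk>x \<in> Ob N; y \<in> Ob N; z \<in> Ob N; f \<in> Hom N y z\<rbrakk>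
      \<Longrightarrow> Cmp N y (Tens N x y) (Tens N x z) (Tmor N x x y z (Idn N x) f) (shift_in N x y) =
        Cmp N y z (Tens N x z) (shift_in N x z) f"
    and p_in [simp]: "\<lbrakk>x \<in> Ob N; y \<in> Ob N\<rbrakk> \<Longrightarrow> p x y \<in> Hom N (Tens N x y) y"
    and p_nat: "\<lbrakk>x \<in> Ob N; y \<in> Ob N; z \<in> Ob N; f \<in> Hom N y z\<rbrakk>
      \<Longrightarrow> Cmp N (Tens N x y) (Tens N x z) z (p x z) (Tmor N x x y z (Idn N x) f) =
        Cmp N (Tens N x y) y z f (p x y)"
    and p_shift_in [simp]: "\<lbrakk>x \<in> Ob N; y \<in> Ob N\<rbrakk>
      \<Longrightarrow> Cmp N y (Tens N x y) y (p x y) (shift_in N x y) = Idn N y"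
begin

lemma category_N: "category N" by unfold_locales

text \<open>The idempotent of x \<oplus> y that kills x and keeps y.\<close>

definition ip :: "'o \<Rightarrow> 'o \<Rightarrow> 'm" where
  "ip x y = Cmp N (Tens N x y) y (Tens N x y) (shift_in N x y) (p x y)"

lemma ip_in [simp]: "\<lbrakk>x \<in> Ob N; y \<in> Ob N\<rbrakk> \<Longrightarrow> ip x y \<in> Hom N (Tens N x y) (Tens N x y)"
  by (simp add: ip_def)

lemma ip_shift_in [simp]: "\<lbrakk>x \<in> Ob N; y \<in> Ob N\<rbrakk>
    \<Longrightarrow> Cmp N y (Tens N x y) (Tens N x y) (ip x y) (shift_in N x y) = shift_in N x y"
  by (simp add: ip_def)

lemma ip_ip [simp]: "\<lbrakk>x \<in> Ob N; y \<in> Ob N\<rbrakk>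
    \<Longrightarrow> Cmp N (Tens N x y) (Tens N x y) (Tens N x y) (ip x y) (ip x y) = ip x y"
  using Cmp_cong_assoc[OF ip_shift_in, of x y "Tens N x y" "p x y"] by (simp add: ip_def)

lemma ip_nat:
  assumes "x \<in> Ob N" "y \<in> Ob N" "z \<in> Ob N" "f \<in> Hom N y z"
  shows "Cmp N (Tens N x y) (Tens N x y) (Tens N x z) (Tmor N x x y z (Idn N x) f) (ip x y) =
    Cmp N (Tens N x y) (Tens N x z) (Tens N x z) (ip x z) (Tmor N x x y z (Idn N x) f)"
  using assms Cmp_cong_assoc[OF shift_in_nat, of x y z f "Tens N x y" "p x y"]
  by (simp add: ip_def p_nat)

text \<open>Presents x \<oplus> - as a retract of x' \<oplus> -, compatibly with inclusion and
  projection of the second summand. It arises from a retract x of x', but the two families S and R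
  are all that the cokernels see.\<close>

definition shift_retraction :: "'o \<Rightarrow> 'o \<Rightarrow> ('o \<Rightarrow> 'm) \<Rightarrow> ('o \<Rightarrow> 'm) \<Rightarrow> bool" where
  "shift_retraction x x' S R \<longleftrightarrow>
    (\<forall>y\<in>Ob N. S y \<in> Hom N (Tens N x y) (Tens N x' y) \<and> R y \<in> Hom N (Tens N x' y) (Tens N x y) \<and>
       Cmp N (Tens N x y) (Tens N x' y) (Tens N x y) (R y) (S y) = Idn N (Tens N x y) \<and>
       Cmp N y (Tens N x' y) (Tens N x y) (R y) (shift_in N x' y) = shift_in N x y \<and>
       Cmp N (Tens N x y) (Tens N x' y) y (p x' y) (S y) = p x y) \<and>
    (\<forall>y\<in>Ob N. \<forall>z\<in>Ob N. \<forall>f\<in>Hom N y z.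
       Cmp N (Tens N x y) (Tens N x' y) (Tens N x' z) (Tmor N x' x' y z (Idn N x') f) (S y) =
       Cmp N (Tens N x y) (Tens N x z) (Tens N x' z) (S z) (Tmor N x x y z (Idn N x) f) \<and>
       Cmp N (Tens N x' y) (Tens N x y) (Tens N x z) (Tmor N x x y z (Idn N x) f) (R y) =
       Cmp N (Tens N x' y) (Tens N x' z) (Tens N x z) (R z) (Tmor N x' x' y z (Idn N x') f))"

text \<open>The cokernel of F -> F(x \<oplus> -) as a direct summand: \<delta> is the image of the
  idempotent 1 - F(\<open>ip\<close>). Being equational, this survives precomposition.\<close>

definition split_cok ::
    "('p, 'n, 'w) addcat_scheme \<Rightarrow> 'o \<Rightarrow> ('o, 'm, 'p, 'n) func \<Rightarrow> ('o, 'm, 'p, 'n) func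
      \<Rightarrow> ('o \<Rightarrow> 'n) \<Rightarrow> ('o \<Rightarrow> 'n) \<Rightarrow> bool" where
  "split_cok B x F \<delta> q h \<longleftrightarrow> is_functor N B \<delta> \<and>
     q \<in> nat_trans N B (shift_func N x F) \<delta> \<and> h \<in> nat_trans N B \<delta> (shift_func N x F) \<and>
     (\<forall>y\<in>Ob N. Cmp B (fobj \<delta> y) (fobj F (Tens N x y)) (fobj \<delta> y) (q y) (h y) = Idn B (fobj \<delta> y) \<and>
        Cmp B (fobj F (Tens N x y)) (fobj \<delta> y) (fobj F (Tens N x y)) (h y) (q y)
          \<otimes>\<^bsub>Hgrp B (fobj F (Tens N x y)) (fobj F (Tens N x y))\<^esub>
          fmor F (Tens N x y) (Tens N x y) (ip x y) = Idn B (fobj F (Tens N x y)))"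

lemma is_functor_shift_func:
  assumes "is_functor N B F" "x \<in> Ob N"
  shows "is_functor N B (shift_func N x F)"
  unfolding shift_func_def
  by (rule is_functor_mk_func)
    (use assms is_functorD[OF assms(1)] category_N in auto)

lemma fobj_shift_func [simp]: "y \<in> Ob N \<Longrightarrow> fobj (shift_func N x F) y = fobj F (Tens N x y)"
  by (simp add: shift_func_def)

lemma fmor_shift_func [simp]: "\<lbrakk>y \<in> Ob N; z \<in> Ob N; f \<in> Hom N y z\<rbrakk> \<Longrightarrow>
    fmor (shift_func N x F) y z f = fmor F (Tens N x y) (Tens N x z) (Tmor N x x y z (Idn N x) f)"
  by (simp add: shift_func_def)

lemma shift_map_in:
  assumes "is_functor N B F" "x \<in> Ob N"
  shows "shift_map N x F \<in> nat_trans N B F (shift_func N x F)"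
  unfolding shift_map_eq
  by (rule nat_transI)
    (use assms is_functorD(3)[OF assms(1)] is_functorD(5)[OF assms(1), symmetric] shift_in_nat in auto)

end

locale shiftable_abelian = shiftable N p + B: abelian_category B
  for N :: "('o, 'm, 'z) smcat_scheme" and p and B :: "('p, 'n, 'w) addcat_scheme"
begin

text \<open>The section h is the factorisation through q of e = 1 - F(\<open>ip\<close>), which
  kills the shift map because \<open>ip\<close> fixes \<open>shift_in\<close>.\<close>

lemma cokernel_imp_split_cok:
  assumes F: "is_functor N B F" and x: "x \<in> Ob N"
    and cok: "is_cokernel (Fct N B) F (shift_func N x F) (shift_map N x F) \<delta> q"
  shows "\<exists>h. split_cok B x F \<delta> q h"
proof -
  let ?S = "shift_func N x F" and ?x = "\<lambda>y. fobj F (Tens N x y)"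
  note S = is_functor_shift_func[OF F x]
  have \<delta>: "is_functor N B \<delta>" and q: "q \<in> nat_trans N B ?S \<delta>"
    using cok unfolding is_cokernel_def by auto
  note [simp] = is_functorD(2,3)[OF F] is_functorD(2)[OF \<delta>] x
  note Fc = is_functorD(5)[OF F]
  interpret Fct: category "Fct N B" by (rule category_Fct) (rule B.category_axioms)
  have q_in [simp]: "q y \<in> Hom B (?x y) (fobj \<delta> y)" if "y \<in> Ob N" for y
    using nat_transD(2)[OF q that] that by simp
  have "is_zero_mor (Fct N B) F \<delta> (Cmp (Fct N B) F ?S \<delta> q (shift_map N x F))"
    using cok unfolding is_cokernel_def by blast
  moreover have "Cmp (Fct N B) F ?S \<delta> q (shift_map N x F) \<in> Hom (Fct N B) F \<delta>"
    by (rule Fct.Cmp_in) (use F S \<delta> q shift_map_in[OF F x] in auto)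
  ultimately have "Cmp (Fct N B) F ?S \<delta> q (shift_map N x F) y = \<one>\<^bsub>Hgrp B (fobj F y) (fobj \<delta> y)\<^esub>"
    if "y \<in> Ob N" for y
    using B.Fct_zero_mor_iff[OF category_N F \<delta>] that by simp
  then have qi: "Cmp B (fobj F y) (?x y) (fobj \<delta> y) (q y) (fmor F y (Tens N x y) (shift_in N x y)) =
      \<one>\<^bsub>Hgrp B (fobj F y) (fobj \<delta> y)\<^esub>" if "y \<in> Ob N" for y
    using that by (simp add: shift_map_eq)
  define e where "e = (\<lambda>y\<in>Ob N. Idn B (?x y) \<otimes>\<^bsub>Hgrp B (?x y) (?x y)\<^esub>
    inv\<^bsub>Hgrp B (?x y) (?x y)\<^esub> (fmor F (Tens N x y) (Tens N x y) (ip x y)))"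
  have e: "e \<in> nat_trans N B ?S ?S"
    by (rule nat_transI) (auto simp: e_def ip_nat simp flip: Fc)
  have "Cmp (Fct N B) F ?S ?S e (shift_map N x F) \<in> Hom (Fct N B) F ?S"
    by (rule Fct.Cmp_in) (use F S e shift_map_in[OF F x] in auto)
  then have "is_zero_mor (Fct N B) F ?S (Cmp (Fct N B) F ?S ?S e (shift_map N x F))"
    by (subst B.Fct_zero_mor_iff[OF category_N F S]) (auto simp: e_def shift_map_eq simp flip: Fc)
  then have "\<exists>!h. h \<in> Hom (Fct N B) \<delta> ?S \<and> Cmp (Fct N B) ?S \<delta> ?S h q = e"
    using cok S e unfolding is_cokernel_def by simp
  then obtain h where h: "h \<in> nat_trans N B \<delta> ?S" and hq: "Cmp (Fct N B) ?S \<delta> ?S h q = e" by auto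
  have h_in [simp]: "h y \<in> Hom B (fobj \<delta> y) (?x y)" if "y \<in> Ob N" for y
    using nat_transD(2)[OF h that] that by simp
  have hq: "Cmp B (?x y) (fobj \<delta> y) (?x y) (h y) (q y) = e y" if "y \<in> Ob N" for y
    using fun_cong[OF hq, of y] that by simp
  have Fip: "fmor F (Tens N x y) (Tens N x y) (ip x y) = Cmp B (?x y) (fobj F y) (?x y)
      (fmor F y (Tens N x y) (shift_in N x y)) (fmor F (Tens N x y) y (p x y))" if "y \<in> Ob N" for y
    using that by (simp add: Fc ip_def)
  have qF: "Cmp B (?x y) (?x y) (fobj \<delta> y) (q y) (fmor F (Tens N x y) (Tens N x y) (ip x y)) =
      \<one>\<^bsub>Hgrp B (?x y) (fobj \<delta> y)\<^esub>" if "y \<in> Ob N" for y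
    using that B.Cmp_cong_assoc[OF qi, of y "?x y" "fmor F (Tens N x y) y (p x y)"] by (simp add: Fip)
  have qe: "Cmp B (?x y) (?x y) (fobj \<delta> y) (q y) (e y) = q y" if "y \<in> Ob N" for y
    using that qF by (simp add: e_def)
  have "\<exists>!k. k \<in> Hom (Fct N B) \<delta> \<delta> \<and> Cmp (Fct N B) ?S \<delta> \<delta> k q = q"
    using cok \<delta> q unfolding is_cokernel_def by simp
  moreover have "Cmp (Fct N B) \<delta> ?S \<delta> q h \<in> Hom (Fct N B) \<delta> \<delta>"
    by (rule Fct.Cmp_in) (use S \<delta> q h in auto)
  moreover have "Cmp (Fct N B) ?S \<delta> \<delta> (Cmp (Fct N B) \<delta> ?S \<delta> q h) q = q"
    using S \<delta> q h by (subst Fct.Cmp_assoc_right)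
      (auto intro!: extensionalityI[of _ "Ob N"] nat_transD(1)[OF q] simp: hq qe)
  moreover have "Idn (Fct N B) \<delta> \<in> Hom (Fct N B) \<delta> \<delta>"
    by (rule Fct.Idn_in) (use \<delta> in auto)
  moreover have "Cmp (Fct N B) ?S \<delta> \<delta> (Idn (Fct N B) \<delta>) q = q"
    by (rule Fct.Cmp_Idn_left) (use S \<delta> q in auto)
  \<comment> \<open>Both q h and the identity of \<delta> factor q through itself, so uniqueness
    identifies them.\<close>
  ultimately have qh: "Cmp (Fct N B) \<delta> ?S \<delta> q h = Idn (Fct N B) \<delta>" by blast
  have "Cmp B (fobj \<delta> y) (?x y) (fobj \<delta> y) (q y) (h y) = Idn B (fobj \<delta> y)" if "y \<in> Ob N" for y
    using fun_cong[OF qh, of y] that by simp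
  then show ?thesis unfolding split_cok_def using \<delta> q h
    by (intro exI[of _ h]) (auto simp: hq e_def B.add_assoc)
qed

text \<open>A transformation g that kills the shift map also kills F(\<open>ip\<close>), since
  \<open>ip\<close> factors through \<open>shift_in\<close>; so g = g h q, and g h is the
  factorisation, unique because q h = 1.\<close>

lemma split_cok_imp_cokernel:
  assumes F: "is_functor N B F" and x: "x \<in> Ob N" and s: "split_cok B x F \<delta> q h"
  shows "is_cokernel (Fct N B) F (shift_func N x F) (shift_map N x F) \<delta> q"
proof -
  let ?S = "shift_func N x F" and ?x = "\<lambda>y. fobj F (Tens N x y)"
  note S = is_functor_shift_func[OF F x]
  have \<delta>: "is_functor N B \<delta>" and q: "q \<in> nat_trans N B ?S \<delta>" and h: "h \<in> nat_trans N B \<delta> ?S"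
    using s unfolding split_cok_def by auto
  have qh: "Cmp B (fobj \<delta> y) (?x y) (fobj \<delta> y) (q y) (h y) = Idn B (fobj \<delta> y)"
    and hq: "Cmp B (?x y) (fobj \<delta> y) (?x y) (h y) (q y)
          \<otimes>\<^bsub>Hgrp B (?x y) (?x y)\<^esub> fmor F (Tens N x y) (Tens N x y) (ip x y) = Idn B (?x y)"
    if "y \<in> Ob N" for y
    using s that unfolding split_cok_def by auto
  note [simp] = is_functorD(2,3)[OF F] is_functorD(2)[OF \<delta>] x
  note Fc = is_functorD(5)[OF F]
  interpret Fct: category "Fct N B" by (rule category_Fct) (rule B.category_axioms)
  have [simp]: "q y \<in> Hom B (?x y) (fobj \<delta> y)" "h y \<in> Hom B (fobj \<delta> y) (?x y)" if "y \<in> Ob N" for y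
    using nat_transD(2)[OF q that] nat_transD(2)[OF h that] that by simp_all
  let ?i = "\<lambda>y. fmor F y (Tens N x y) (shift_in N x y)"
  have i: "?i y \<in> Hom B (fobj F y) (?x y)" if "y \<in> Ob N" for y using that by simp
  \<comment> \<open>Composing h q + F(\<open>ip\<close>) = 1 with the shift map i gives h q i + i =
    i; as h is a split monomorphism, q i = 0 follows.\<close>
  have hqi: "Cmp B (fobj F y) (fobj \<delta> y) (?x y) (h y) (Cmp B (fobj F y) (?x y) (fobj \<delta> y) (q y) (?i y)) =
      \<one>\<^bsub>Hgrp B (fobj F y) (?x y)\<^esub>" if y: "y \<in> Ob N" for y
  proof -
    have "Cmp B (fobj F y) (?x y) (?x y) (Cmp B (?x y) (fobj \<delta> y) (?x y) (h y) (q y)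
        \<otimes>\<^bsub>Hgrp B (?x y) (?x y)\<^esub> fmor F (Tens N x y) (Tens N x y) (ip x y)) (?i y) = ?i y"
      using y by (subst hq) auto
    then have "Cmp B (fobj F y) (fobj \<delta> y) (?x y) (h y) (Cmp B (fobj F y) (?x y) (fobj \<delta> y) (q y) (?i y))
       \<otimes>\<^bsub>Hgrp B (fobj F y) (?x y)\<^esub> ?i y = ?i y"
      using y by (simp flip: Fc)
    then show ?thesis
      using y B.add_right_cancel[of "fobj F y" "?x y" "?i y" _ "\<one>\<^bsub>Hgrp B (fobj F y) (?x y)\<^esub>"] by simp
  qed
  have qi: "Cmp B (fobj F y) (?x y) (fobj \<delta> y) (q y) (?i y) = \<one>\<^bsub>Hgrp B (fobj F y) (fobj \<delta> y)\<^esub>"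
    if y: "y \<in> Ob N" for y
    using arg_cong[OF hqi[OF y], of "Cmp B (fobj F y) (?x y) (fobj \<delta> y) (q y)"] y
      B.Cmp_cong_assoc[OF qh[OF y], of "fobj F y" "Cmp B (fobj F y) (?x y) (fobj \<delta> y) (q y) (?i y)"]
    by simp
  have sm: "shift_map N x F \<in> nat_trans N B F ?S" by (rule shift_map_in[OF F x])
  have z: "is_zero_mor (Fct N B) F G (Cmp (Fct N B) F ?S G g (shift_map N x F)) \<longleftrightarrow>
      (\<forall>y\<in>Ob N. Cmp B (fobj F y) (?x y) (fobj G y) (g y) (?i y) = \<one>\<^bsub>Hgrp B (fobj F y) (fobj G y)\<^esub>)"
    if G: "is_functor N B G" and g: "g \<in> nat_trans N B ?S G" for G g
  proof -
    have "Cmp (Fct N B) F ?S G g (shift_map N x F) \<in> Hom (Fct N B) F G"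
      by (rule Fct.Cmp_in) (use F S G g sm in auto)
    then show ?thesis using B.Fct_zero_mor_iff[OF category_N F G] by (simp add: shift_map_eq)
  qed
  have "\<exists>!k. k \<in> nat_trans N B \<delta> G \<and> Cmp (Fct N B) ?S \<delta> G k q = g"
    if G: "is_functor N B G" and g: "g \<in> nat_trans N B ?S G"
      and gi: "\<forall>y\<in>Ob N. Cmp B (fobj F y) (?x y) (fobj G y) (g y) (?i y) = \<one>\<^bsub>Hgrp B (fobj F y) (fobj G y)\<^esub>"
    for G g
  proof -
    note [simp] = is_functorD(2)[OF G]
    have [simp]: "g y \<in> Hom B (?x y) (fobj G y)" if "y \<in> Ob N" for y
      using nat_transD(2)[OF g that] that by simp
    let ?k = "Cmp (Fct N B) \<delta> ?S G g h"
    have k: "?k \<in> nat_trans N B \<delta> G"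
      using Fct.Cmp_in[of \<delta> ?S G h g] S \<delta> G g h by simp
    have ghq: "Cmp B (?x y) (fobj \<delta> y) (fobj G y) (Cmp B (fobj \<delta> y) (?x y) (fobj G y) (g y) (h y)) (q y) = g y"
      if y: "y \<in> Ob N" for y
    proof -
      have "g y = Cmp B (?x y) (?x y) (fobj G y) (g y) (Cmp B (?x y) (fobj \<delta> y) (?x y) (h y) (q y)
        \<otimes>\<^bsub>Hgrp B (?x y) (?x y)\<^esub> fmor F (Tens N x y) (Tens N x y) (ip x y))"
        using y by (subst hq) auto
      also have "\<dots> = Cmp B (?x y) (?x y) (fobj G y) (g y) (Cmp B (?x y) (fobj \<delta> y) (?x y) (h y) (q y))
         \<otimes>\<^bsub>Hgrp B (?x y) (fobj G y)\<^esub> Cmp B (?x y) (?x y) (fobj G y) (g y)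
          (fmor F (Tens N x y) (Tens N x y) (ip x y))"
        using y by simp
      also have "Cmp B (?x y) (?x y) (fobj G y) (g y) (fmor F (Tens N x y) (Tens N x y) (ip x y)) =
          \<one>\<^bsub>Hgrp B (?x y) (fobj G y)\<^esub>"
        using y gi B.Cmp_cong_assoc[OF bspec[OF gi y], of "?x y" "fmor F (Tens N x y) y (p x y)"]
        by (simp add: ip_def Fc)
      finally show ?thesis using y by simp
    qed
    have "Cmp (Fct N B) ?S \<delta> G ?k q = g"
      by (rule extensionalityI[of _ "Ob N"]) (use ghq nat_transD(1)[OF g] in auto)
    moreover have "k = ?k" if k: "k \<in> nat_trans N B \<delta> G" "Cmp (Fct N B) ?S \<delta> G k q = g" for k
    proof (rule extensionalityI[of _ "Ob N"])
      fix y assume y: "y \<in> Ob N"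
      have [simp]: "k y \<in> Hom B (fobj \<delta> y) (fobj G y)" using nat_transD(2)[OF k(1) y] .
      have "Cmp B (?x y) (fobj \<delta> y) (fobj G y) (k y) (q y) = g y"
        using fun_cong[OF k(2), of y] y by simp
      from B.Cmp_cong_assoc[OF this, of "fobj \<delta> y" "h y"] show "k y = ?k y" using y qh by simp
    qed (use nat_transD(1)[OF k(1)] in auto)
    ultimately show ?thesis using k by blast
  qed
  then show ?thesis unfolding is_cokernel_def using \<delta> q z[OF \<delta> q] qi z by auto
qed

lemma split_cok_exists:
  assumes F: "is_functor N B F" and x: "x \<in> Ob N"
  shows "\<exists>\<delta> q h. split_cok B x F \<delta> q h"
proof -
  let ?x = "\<lambda>y. fobj F (Tens N x y)"
  let ?w = "\<lambda>y z f. fmor F (Tens N x y) (Tens N x z) (Tmor N x x y z (Idn N x) f)"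
  note [simp] = is_functorD(2,3)[OF F] x
  note Fc = is_functorD(5)[OF F]
  define e where "e y = Idn B (?x y) \<otimes>\<^bsub>Hgrp B (?x y) (?x y)\<^esub>
    inv\<^bsub>Hgrp B (?x y) (?x y)\<^esub> (fmor F (Tens N x y) (Tens N x y) (ip x y))" for y
  have e_in [simp]: "e y \<in> Hom B (?x y) (?x y)" if "y \<in> Ob N" for y using that by (simp add: e_def)
  have ee [simp]: "Cmp B (?x y) (?x y) (?x y) (e y) (e y) = e y" if "y \<in> Ob N" for y
    using that by (simp add: e_def flip: Fc)
  have en: "Cmp B (?x y) (?x y) (?x z) (?w y z f) (e y) = Cmp B (?x y) (?x z) (?x z) (e z) (?w y z f)"
    if "y \<in> Ob N" "z \<in> Ob N" "f \<in> Hom N y z" for y z f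
    using that by (simp add: e_def ip_nat flip: Fc)
  \<comment> \<open>Restricting the shifted functor to the image of e: f acts as F(x \<oplus> f) e,
    and the identity goes to e itself.\<close>
  define km where "km y z f = Cmp B (?x y) (?x y) (?x z) (?w y z f) (e y)" for y z f
  have "\<exists>\<delta> q h. B.splits_semifunctor N ?x km \<delta> q h"
  proof (rule B.semifunctor_splits[OF category_N], goal_cases)
    case (3 a b c f g)
    then show ?case
      using B.Cmp_cong_assoc[OF en[of b c g], of "?x a" "?w a b f"]
        B.Cmp_cong_assoc[OF ee[of c], of "?x a" "Cmp B (?x a) (?x b) (?x c) (?w b c g) (?w a b f)"]
      by (simp add: km_def en Fc)
  qed (auto simp: km_def)
  then obtain \<delta> q h where *: "B.splits_semifunctor N ?x km \<delta> q h"
    by blast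
  have \<delta>: "is_functor N B \<delta>"
    and q: "\<And>a. a \<in> Ob N \<Longrightarrow> q a \<in> Hom B (?x a) (fobj \<delta> a)"
    and h: "\<And>a. a \<in> Ob N \<Longrightarrow> h a \<in> Hom B (fobj \<delta> a) (?x a)"
    and qh: "\<And>a. a \<in> Ob N \<Longrightarrow> Cmp B (fobj \<delta> a) (?x a) (fobj \<delta> a) (q a) (h a) = Idn B (fobj \<delta> a)"
    and hq: "\<And>a. a \<in> Ob N \<Longrightarrow> Cmp B (?x a) (fobj \<delta> a) (?x a) (h a) (q a) = km a a (Idn N a)"
    and \<delta>m: "\<And>a b f. \<lbrakk>a \<in> Ob N; b \<in> Ob N; f \<in> Hom N a b\<rbrakk> \<Longrightarrow> fmor \<delta> a b f =
      Cmp B (fobj \<delta> a) (?x a) (fobj \<delta> b) (Cmp B (?x a) (?x b) (fobj \<delta> b) (q b) (km a b f)) (h a)"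
    using * by (simp_all add: B.splits_semifunctor_def)
  note [simp] = is_functorD(2,3)[OF \<delta>] q h
  have hq': "Cmp B (?x y) (fobj \<delta> y) (?x y) (h y) (q y) = e y" if "y \<in> Ob N" for y
    using that hq[OF that] is_functorD(4)[OF F] by (simp add: km_def)
  have qe: "Cmp B (?x y) (?x y) (fobj \<delta> y) (q y) (e y) = q y" if y: "y \<in> Ob N" for y
    using B.Cmp_cong_assoc[OF qh, of y "?x y" "q y"] y by (simp add: hq')
  have eh: "Cmp B (fobj \<delta> y) (?x y) (?x y) (e y) (h y) = h y" if y: "y \<in> Ob N" for y
    using B.Cmp_cong_assoc[OF hq', of y "fobj \<delta> y" "h y"] y by (simp add: qh)
  have "restrict q (Ob N) \<in> nat_trans N B (shift_func N x F) \<delta>"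
  proof (rule nat_transI, goal_cases)
    case (3 y z f)
    then show ?case
      using B.Cmp_cong_assoc[OF qe, of z "?x y" "?w y z f"]
      by (simp add: \<delta>m km_def hq' en[symmetric])
  qed auto
  moreover have "restrict h (Ob N) \<in> nat_trans N B \<delta> (shift_func N x F)"
  proof (rule nat_transI, goal_cases)
    case (3 y z f)
    then show ?case
      using B.Cmp_cong_assoc[OF hq', of z "fobj \<delta> y" "Cmp B (fobj \<delta> y) (?x y) (?x z) (?w y z f) (h y)"]
        B.Cmp_cong_assoc[OF en[symmetric], of y z f "fobj \<delta> y" "h y"]
      by (simp add: \<delta>m km_def eh)
  qed auto
  ultimately show ?thesis
    unfolding split_cok_def using \<delta> qh hq'
    by (intro exI[of _ \<delta>] exI[of _ "restrict q (Ob N)"] exI[of _ "restrict h (Ob N)"])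
      (auto simp: e_def B.add_assoc)
qed

definition retract_of :: "('o, 'm, 'p, 'n) func \<Rightarrow> ('o, 'm, 'p, 'n) func \<Rightarrow> bool" where
  "retract_of F G \<longleftrightarrow> (\<exists>s\<in>nat_trans N B F G. \<exists>r\<in>nat_trans N B G F.
     \<forall>y\<in>Ob N. Cmp B (fobj F y) (fobj G y) (fobj F y) (r y) (s y) = Idn B (fobj F y))"

text \<open>From r s = 1 and r G(\<open>ip\<close>) s = F(\<open>ip\<close>) the complementary
  idempotents satisfy r (1 - G(\<open>ip\<close>)) s = 1 - F(\<open>ip\<close>), so s and r pass to
  the cokernels. The lemma serves for retracts of functors, for two choices of one cokernel, and for
  retracts of the shifting object.\<close>

lemma retract_split_cok:
  assumes F: "is_functor N B F" and G: "is_functor N B G" and x: "x \<in> Ob N" and x': "x' \<in> Ob N"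
    and sF: "split_cok B x F \<delta> q h" and sG: "split_cok B x' G \<delta>' q' h'"
    and s: "s \<in> nat_trans N B (shift_func N x F) (shift_func N x' G)"
    and r: "r \<in> nat_trans N B (shift_func N x' G) (shift_func N x F)"
    and rs: "\<And>y. y \<in> Ob N \<Longrightarrow> Cmp B (fobj F (Tens N x y)) (fobj G (Tens N x' y)) (fobj F (Tens N x y)) (r y) (s y) =
      Idn B (fobj F (Tens N x y))"
    and rips: "\<And>y. y \<in> Ob N \<Longrightarrow> Cmp B (fobj F (Tens N x y)) (fobj G (Tens N x' y)) (fobj F (Tens N x y)) (r y)
      (Cmp B (fobj F (Tens N x y)) (fobj G (Tens N x' y)) (fobj G (Tens N x' y))
        (fmor G (Tens N x' y) (Tens N x' y) (ip x' y)) (s y)) =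
      fmor F (Tens N x y) (Tens N x y) (ip x y)"
  shows "retract_of \<delta> \<delta>'"
proof -
  let ?S = "shift_func N x F" and ?S' = "shift_func N x' G"
  let ?x = "\<lambda>y. fobj F (Tens N x y)" and ?x' = "\<lambda>y. fobj G (Tens N x' y)"
  note S = is_functor_shift_func[OF F x] and S' = is_functor_shift_func[OF G x']
  have \<delta>: "is_functor N B \<delta>" and q: "q \<in> nat_trans N B ?S \<delta>" and h: "h \<in> nat_trans N B \<delta> ?S"
    and \<delta>': "is_functor N B \<delta>'" and q': "q' \<in> nat_trans N B ?S' \<delta>'" and h': "h' \<in> nat_trans N B \<delta>' ?S'"
    and qh: "\<And>y. y \<in> Ob N \<Longrightarrow> Cmp B (fobj \<delta> y) (?x y) (fobj \<delta> y) (q y) (h y) = Idn B (fobj \<delta> y)"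
    and hq: "\<And>y. y \<in> Ob N \<Longrightarrow> Cmp B (?x y) (fobj \<delta> y) (?x y) (h y) (q y)
          \<otimes>\<^bsub>Hgrp B (?x y) (?x y)\<^esub> fmor F (Tens N x y) (Tens N x y) (ip x y) = Idn B (?x y)"
    and hq': "\<And>y. y \<in> Ob N \<Longrightarrow> Cmp B (?x' y) (fobj \<delta>' y) (?x' y) (h' y) (q' y)
          \<otimes>\<^bsub>Hgrp B (?x' y) (?x' y)\<^esub> fmor G (Tens N x' y) (Tens N x' y) (ip x' y) = Idn B (?x' y)"
    using sF sG unfolding split_cok_def by auto
  interpret Fct: category "Fct N B" by (rule category_Fct) (rule B.category_axioms)
  note [simp] = is_functorD(2,3)[OF F] is_functorD(2,3)[OF G] is_functorD(2)[OF \<delta>] is_functorD(2)[OF \<delta>'] x x'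
  have [simp]: "q y \<in> Hom B (?x y) (fobj \<delta> y)" "h y \<in> Hom B (fobj \<delta> y) (?x y)"
    "q' y \<in> Hom B (?x' y) (fobj \<delta>' y)" "h' y \<in> Hom B (fobj \<delta>' y) (?x' y)"
    "s y \<in> Hom B (?x y) (?x' y)" "r y \<in> Hom B (?x' y) (?x y)" if "y \<in> Ob N" for y
    using nat_transD(2)[OF q that] nat_transD(2)[OF h that] nat_transD(2)[OF q' that] nat_transD(2)[OF h' that]
      nat_transD(2)[OF s that] nat_transD(2)[OF r that] that by simp_all
  let ?s = "Cmp (Fct N B) \<delta> ?S' \<delta>' q' (Cmp (Fct N B) \<delta> ?S ?S' s h)"
  let ?r = "Cmp (Fct N B) \<delta>' ?S \<delta> q (Cmp (Fct N B) \<delta>' ?S' ?S r h')"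
  have s': "?s \<in> Hom (Fct N B) \<delta> \<delta>'"
    by (intro Fct.Cmp_in) (use S S' \<delta> \<delta>' q' s h in auto)
  have r': "?r \<in> Hom (Fct N B) \<delta>' \<delta>"
    by (intro Fct.Cmp_in) (use S S' \<delta> \<delta>' h' r q in auto)
  have *: "Cmp B (fobj \<delta> y) (fobj \<delta>' y) (fobj \<delta> y) (?r y) (?s y) = Idn B (fobj \<delta> y)" if y: "y \<in> Ob N" for y
  proof -
    let ?g = "fmor G (Tens N x' y) (Tens N x' y) (ip x' y)"
    let ?f = "fmor F (Tens N x y) (Tens N x y) (ip x y)"
    let ?t = "Cmp B (?x y) (?x' y) (?x y) (r y) (Cmp B (?x y) (?x' y) (?x' y) (Cmp B (?x' y) (fobj \<delta>' y) (?x' y) (h' y) (q' y)) (s y))"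
    have "Cmp B (?x y) (?x' y) (?x y) (r y) (Cmp B (?x y) (?x' y) (?x' y) (Cmp B (?x' y) (fobj \<delta>' y) (?x' y) (h' y) (q' y)
          \<otimes>\<^bsub>Hgrp B (?x' y) (?x' y)\<^esub> ?g) (s y)) = Idn B (?x y)"
      using y by (subst hq') (auto simp: rs)
    then have "?t \<otimes>\<^bsub>Hgrp B (?x y) (?x y)\<^esub> ?f =
        Cmp B (?x y) (fobj \<delta> y) (?x y) (h y) (q y) \<otimes>\<^bsub>Hgrp B (?x y) (?x y)\<^esub> ?f"
      using y by (simp add: rips hq)
    then have t: "?t = Cmp B (?x y) (fobj \<delta> y) (?x y) (h y) (q y)"
      using y by (subst (asm) B.add_right_cancel) auto
    have "Cmp B (fobj \<delta> y) (fobj \<delta>' y) (fobj \<delta> y) (?r y) (?s y) =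
        Cmp B (fobj \<delta> y) (?x y) (fobj \<delta> y) (q y) (Cmp B (fobj \<delta> y) (?x y) (?x y) ?t (h y))"
      using y by simp
    also have "\<dots> = Idn B (fobj \<delta> y)"
      unfolding t using y B.Cmp_cong_assoc[OF qh, of y "fobj \<delta> y" "Cmp B (fobj \<delta> y) (?x y) (fobj \<delta> y) (q y) (h y)"]
      by (simp add: qh)
    finally show ?thesis .
  qed
  show ?thesis unfolding retract_of_def
    by (rule bexI[of _ ?s], rule bexI[of _ ?r]) (use * s' r' in auto)
qed

lemma pol_below_functor: "F \<in> pol_below N B k \<Longrightarrow> is_functor N B F"
  by (cases k) (auto simp: is_null_def)

lemma pol_below_Suc_split:
  "F \<in> pol_below N B (Suc k) \<longleftrightarrow> is_functor N B F \<and>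
    (\<forall>x\<in>Ob N. \<exists>\<delta> q h. split_cok B x F \<delta> q h \<and> \<delta> \<in> pol_below N B k)"
proof -
  have "(\<exists>\<delta> q. is_cokernel (Fct N B) F (shift_func N x F) (shift_map N x F) \<delta> q \<and> \<delta> \<in> pol_below N B k) \<longleftrightarrow>
      (\<exists>\<delta> q h. split_cok B x F \<delta> q h \<and> \<delta> \<in> pol_below N B k)" if "is_functor N B F" "x \<in> Ob N" for x
    using cokernel_imp_split_cok[OF that] split_cok_imp_cokernel[OF that] by blast
  then show ?thesis by auto
qed

text \<open>A retract of functors restricts to a retract of their cokernels, one degree lower; in
  degree below 0, a retract of a null object is null.\<close>

lemma pol_below_retract:
  assumes "G \<in> pol_below N B k" "is_functor N B F" "retract_of F G"
  shows "F \<in> pol_below N B k"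
  using assms
proof (induction k arbitrary: F G)
  case 0
  then obtain s r where s: "s \<in> nat_trans N B F G" and r: "r \<in> nat_trans N B G F"
    and rs: "\<forall>y\<in>Ob N. Cmp B (fobj F y) (fobj G y) (fobj F y) (r y) (s y) = Idn B (fobj F y)"
    unfolding retract_of_def by blast
  have "is_null B (fobj G a)" if "a \<in> Ob N" for a
    using 0(1) that B.Fct_null_iff[OF category_N] by simp
  then have "is_null B (fobj F a)" if a: "a \<in> Ob N" for a
    using a is_functorD(2)[OF 0(2) a] nat_transD(2)[OF s a] nat_transD(2)[OF r a] rs
    by (intro B.null_retract[of "fobj G a" "fobj F a" "s a" "r a"]) auto
  then show ?case using 0 B.Fct_null_iff[OF category_N] by simp
next
  case (Suc k)
  then obtain s r where s: "s \<in> nat_trans N B F G" and r: "r \<in> nat_trans N B G F"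
    and rs: "\<forall>y\<in>Ob N. Cmp B (fobj F y) (fobj G y) (fobj F y) (r y) (s y) = Idn B (fobj F y)"
    unfolding retract_of_def by blast
  have F: "is_functor N B F" and G: "is_functor N B G" using Suc.prems pol_below_functor by auto
  note [simp] = is_functorD(2,3)[OF F] is_functorD(2,3)[OF G] nat_transD(2)[OF s] nat_transD(2)[OF r]
  have "\<exists>\<delta> q h. split_cok B x F \<delta> q h \<and> \<delta> \<in> pol_below N B k" if x: "x \<in> Ob N" for x
  proof -
    obtain \<delta> q h where 1: "split_cok B x F \<delta> q h" using split_cok_exists[OF F x] by blast
    obtain \<delta>' q' h' where 2: "split_cok B x G \<delta>' q' h'" and \<delta>': "\<delta>' \<in> pol_below N B k"
      using Suc.prems(1) x unfolding pol_below_Suc_split by blast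
    have "retract_of \<delta> \<delta>'"
    proof (rule retract_split_cok[OF F G x x 1 2,
          of "\<lambda>y\<in>Ob N. s (Tens N x y)" "\<lambda>y\<in>Ob N. r (Tens N x y)"], goal_cases)
      case 1
      show ?case by (rule nat_transI) (auto simp: x nat_transD(3)[OF s])
    next
      case 2
      show ?case by (rule nat_transI) (auto simp: x nat_transD(3)[OF r])
    next
      case (4 y)
      then show ?case
        using x rs B.Cmp_cong_assoc[OF bspec[OF rs], of "Tens N x y" "fobj F (Tens N x y)"]
        by (simp add: nat_transD(3)[OF s])
    qed (auto simp: x rs)
    then have "\<delta> \<in> pol_below N B k"
      using Suc.IH[OF \<delta>'] 1 unfolding split_cok_def by blast
    then show ?thesis using 1 by blast
  qed
  then show ?case using F unfolding pol_below_Suc_split by blast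
qed

lemma split_cok_retract:
  assumes F: "is_functor N B F" and x: "x \<in> Ob N"
    and 1: "split_cok B x F \<delta> q h" and 2: "split_cok B x F \<delta>' q' h'"
  shows "retract_of \<delta> \<delta>'"
proof -
  note [simp] = is_functorD(2,3)[OF F] x
  show ?thesis
  proof (rule retract_split_cok[OF F F x x 1 2,
        of "\<lambda>y\<in>Ob N. Idn B (fobj F (Tens N x y))" "\<lambda>y\<in>Ob N. Idn B (fobj F (Tens N x y))"], goal_cases)
    case 1
    show ?case by (rule nat_transI) auto
  next
    case 2
    show ?case by (rule nat_transI) auto
  qed auto
qed

text \<open>The definition provides some cokernel of lower degree. Any other one is a retract of it,
  so it has lower degree too.\<close>

lemma pol_below_split_cok:
  assumes "F \<in> pol_below N B (Suc k)" "x \<in> Ob N" "split_cok B x F \<delta> q h"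
  shows "\<delta> \<in> pol_below N B k"
proof -
  obtain \<delta>' q' h' where "split_cok B x F \<delta>' q' h'" "\<delta>' \<in> pol_below N B k"
    using assms unfolding pol_below_Suc_split by blast
  moreover have "is_functor N B \<delta>" using assms(3) unfolding split_cok_def by blast
  ultimately show ?thesis
    using pol_below_retract split_cok_retract[OF pol_below_functor[OF assms(1)] assms(2,3)] by blast
qed

end

section \<open>Polynomiality and restriction along a monoidal functor\<close>

locale shift_functor = N: shiftable_abelian N p B + M: shiftable_abelian M p' B
  for N :: "('o, 'm, 'z) smcat_scheme" and p and M :: "('o2, 'm2, 'z2) smcat_scheme" and p'
    and B :: "('p, 'n, 'w) addcat_scheme" +
  fixes \<Phi> :: "('o, 'm, 'o2, 'm2) func"
  assumes \<Phi>: "is_functor N M \<Phi>"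
    and \<Phi>_Tens [simp]: "\<lbrakk>x \<in> Ob N; y \<in> Ob N\<rbrakk> \<Longrightarrow> fobj \<Phi> (Tens N x y) = Tens M (fobj \<Phi> x) (fobj \<Phi> y)"
    and \<Phi>_whisker [simp]: "\<lbrakk>x \<in> Ob N; y \<in> Ob N; z \<in> Ob N; f \<in> Hom N y z\<rbrakk>
      \<Longrightarrow> fmor \<Phi> (Tens N x y) (Tens N x z) (Tmor N x x y z (Idn N x) f) =
        Tmor M (fobj \<Phi> x) (fobj \<Phi> x) (fobj \<Phi> y) (fobj \<Phi> z) (Idn M (fobj \<Phi> x)) (fmor \<Phi> y z f)"
    and \<Phi>_shift_in [simp]: "\<lbrakk>x \<in> Ob N; y \<in> Ob N\<rbrakk>
      \<Longrightarrow> fmor \<Phi> y (Tens N x y) (shift_in N x y) = shift_in M (fobj \<Phi> x) (fobj \<Phi> y)"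
    and \<Phi>_p [simp]: "\<lbrakk>x \<in> Ob N; y \<in> Ob N\<rbrakk>
      \<Longrightarrow> fmor \<Phi> (Tens N x y) y (p x y) = p' (fobj \<Phi> x) (fobj \<Phi> y)"
    and obj_retract: "X \<in> Ob M \<Longrightarrow> \<exists>x\<in>Ob N. \<exists>s\<in>Hom M X (fobj \<Phi> x). \<exists>r\<in>Hom M (fobj \<Phi> x) X.
        Cmp M X (fobj \<Phi> x) X r s = Idn M X"
    and shift_retract: "X \<in> Ob M \<Longrightarrow> \<exists>x\<in>Ob N. \<exists>S R. M.shift_retraction X (fobj \<Phi> x) S R"
begin

lemmas \<Phi>_in [simp] = is_functorD(2,3)[OF \<Phi>]

lemma \<Phi>_ip [simp]: "\<lbrakk>x \<in> Ob N; y \<in> Ob N\<rbrakk> \<Longrightarrow>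
    fmor \<Phi> (Tens N x y) (Tens N x y) (N.ip x y) = M.ip (fobj \<Phi> x) (fobj \<Phi> y)"
  by (simp add: N.ip_def M.ip_def is_functorD(5)[OF \<Phi>])

lemma \<Phi>_in' [simp]:
  "\<lbrakk>x \<in> Ob N; y \<in> Ob N; z \<in> Ob N; f \<in> Hom N y (Tens N x z)\<rbrakk> \<Longrightarrow>
    fmor \<Phi> y (Tens N x z) f \<in> Hom M (fobj \<Phi> y) (Tens M (fobj \<Phi> x) (fobj \<Phi> z))"
  using \<Phi>_in(2)[of y "Tens N x z" f] by simp

lemma is_functor_precomp: "is_functor M B F \<Longrightarrow> is_functor N B (comp_func N F \<Phi>)"
  by (rule is_functor_comp_func[OF N.category_N \<Phi>])

lemma shift_comp:
  assumes x: "x \<in> Ob N"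
  shows "shift_func N x (comp_func N F \<Phi>) = comp_func N (shift_func M (fobj \<Phi> x) F) \<Phi>"
  unfolding shift_func_def[of N] comp_func_def[of N "shift_func M _ F"] by (rule mk_func_cong) (auto simp: x)

lemma nat_trans_precomp:
  assumes "\<alpha> \<in> nat_trans M B F G"
  shows "(\<lambda>y\<in>Ob N. \<alpha> (fobj \<Phi> y)) \<in> nat_trans N B (comp_func N F \<Phi>) (comp_func N G \<Phi>)"
  by (rule nat_transI) (use nat_transD[OF assms] in auto)

lemma split_cok_precomp:
  assumes x: "x \<in> Ob N" and s: "M.split_cok B (fobj \<Phi> x) F \<delta> q h"
  shows "N.split_cok B x (comp_func N F \<Phi>) (comp_func N \<delta> \<Phi>)
    (\<lambda>y\<in>Ob N. q (fobj \<Phi> y)) (\<lambda>y\<in>Ob N. h (fobj \<Phi> y))"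
  using s x nat_trans_precomp[of q "shift_func M (fobj \<Phi> x) F" \<delta>]
    nat_trans_precomp[of h \<delta> "shift_func M (fobj \<Phi> x) F"]
  unfolding N.split_cok_def M.split_cok_def shift_comp[OF x]
  by (auto simp: is_functor_precomp)

lemma pol_below_precomp:
  "F \<in> pol_below M B k \<Longrightarrow> comp_func N F \<Phi> \<in> pol_below N B k"
proof (induction k arbitrary: F)
  case 0
  then show ?case
    using N.B.Fct_null_iff[OF N.category_N] N.B.Fct_null_iff[OF M.category_N] is_functor_precomp by simp
next
  case (Suc k)
  then have F: "is_functor M B F" using M.pol_below_functor by blast
  have "\<exists>\<delta> q h. N.split_cok B x (comp_func N F \<Phi>) \<delta> q h \<and> \<delta> \<in> pol_below N B k" if x: "x \<in> Ob N" for x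
  proof -
    obtain \<delta> q h where "M.split_cok B (fobj \<Phi> x) F \<delta> q h" "\<delta> \<in> pol_below M B k"
      using Suc.prems x unfolding M.pol_below_Suc_split by (meson \<Phi>_in(1))
    then show ?thesis using split_cok_precomp[OF x] Suc.IH by blast
  qed
  then show ?case unfolding N.pol_below_Suc_split using is_functor_precomp[OF F] by blast
qed

text \<open>The hypothesis on the restriction concerns shifts by objects \<Phi> x only. For
  arbitrary X, the cokernel at X is a retract of the one at some \<Phi> x; after restriction it has
  lower degree as a retract, and the induction hypothesis applies to it.\<close>

lemma pol_below_if_precomp:
  assumes "is_functor M B F" "comp_func N F \<Phi> \<in> pol_below N B k"
  shows "F \<in> pol_below M B k"
  using assms
proof (induction k arbitrary: F)
  case 0
  have "is_null B (fobj F X)" if X: "X \<in> Ob M" for X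
  proof -
    note F = is_functorD[OF 0(1)]
    obtain x s r where x: "x \<in> Ob N" "s \<in> Hom M X (fobj \<Phi> x)" "r \<in> Hom M (fobj \<Phi> x) X"
      and rs: "Cmp M X (fobj \<Phi> x) X r s = Idn M X" using obj_retract[OF X] by blast
    have "is_null B (fobj F (fobj \<Phi> x))"
      using 0(2) x N.B.Fct_null_iff[OF N.category_N] by simp
    then show ?thesis
      using x X F(2,3) F(4)[OF X] F(5)[of X "fobj \<Phi> x" X s r] rs
      by (intro N.B.null_retract[of "fobj F (fobj \<Phi> x)" "fobj F X" "fmor F X (fobj \<Phi> x) s" "fmor F (fobj \<Phi> x) X r"])
         auto
  qed
  then show ?case using 0 N.B.Fct_null_iff[OF M.category_N] by simp
next
  case (Suc k)
  note F = Suc.prems(1)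
  note [simp] = is_functorD(2,3)[OF F]
  note Fc = is_functorD(5)[OF F]
  have "\<exists>\<delta> q h. M.split_cok B X F \<delta> q h \<and> \<delta> \<in> pol_below M B k" if X: "X \<in> Ob M" for X
  proof -
    obtain x S R where x: "x \<in> Ob N"
and SR: "M.shift_retraction X (fobj \<Phi> x) S R"
      using shift_retract[OF X] by blast
    have S [simp]: "\<And>Y. Y \<in> Ob M \<Longrightarrow> S Y \<in> Hom M (Tens M X Y) (Tens M (fobj \<Phi> x) Y)"
      and R [simp]: "\<And>Y. Y \<in> Ob M \<Longrightarrow> R Y \<in> Hom M (Tens M (fobj \<Phi> x) Y) (Tens M X Y)"
      and RS: "\<And>Y. Y \<in> Ob M \<Longrightarrow> Cmp M (Tens M X Y) (Tens M (fobj \<Phi> x) Y) (Tens M X Y) (R Y) (S Y) = Idn M (Tens M X Y)"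
      and Ri: "\<And>Y. Y \<in> Ob M \<Longrightarrow> Cmp M Y (Tens M (fobj \<Phi> x) Y) (Tens M X Y) (R Y) (shift_in M (fobj \<Phi> x) Y) = shift_in M X Y"
      and pS: "\<And>Y. Y \<in> Ob M \<Longrightarrow> Cmp M (Tens M X Y) (Tens M (fobj \<Phi> x) Y) Y (p' (fobj \<Phi> x) Y) (S Y) = p' X Y"
      and Sn: "\<And>Y Z f. \<lbrakk>Y \<in> Ob M; Z \<in> Ob M; f \<in> Hom M Y Z\<rbrakk> \<Longrightarrow>
          Cmp M (Tens M X Y) (Tens M (fobj \<Phi> x) Y) (Tens M (fobj \<Phi> x) Z)
            (Tmor M (fobj \<Phi> x) (fobj \<Phi> x) Y Z (Idn M (fobj \<Phi> x)) f) (S Y) =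
          Cmp M (Tens M X Y) (Tens M X Z) (Tens M (fobj \<Phi> x) Z) (S Z) (Tmor M X X Y Z (Idn M X) f)"
      and Rn: "\<And>Y Z f. \<lbrakk>Y \<in> Ob M; Z \<in> Ob M; f \<in> Hom M Y Z\<rbrakk> \<Longrightarrow>
          Cmp M (Tens M (fobj \<Phi> x) Y) (Tens M X Y) (Tens M X Z)
            (Tmor M X X Y Z (Idn M X) f) (R Y) =
          Cmp M (Tens M (fobj \<Phi> x) Y) (Tens M (fobj \<Phi> x) Z) (Tens M X Z) (R Z)
            (Tmor M (fobj \<Phi> x) (fobj \<Phi> x) Y Z (Idn M (fobj \<Phi> x)) f)"
      using SR unfolding M.shift_retraction_def by blast+
    have x' [simp]: "fobj \<Phi> x \<in> Ob M" using x by simp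
    obtain \<delta> q h where 1: "M.split_cok B X F \<delta> q h" using M.split_cok_exists[OF F X] by blast
    obtain \<delta>' q' h' where 2: "M.split_cok B (fobj \<Phi> x) F \<delta>' q' h'" using M.split_cok_exists[OF F x'] by blast
    have 3: "comp_func N \<delta>' \<Phi> \<in> pol_below N B k"
      using N.pol_below_split_cok[OF Suc.prems(2) x split_cok_precomp[OF x 2]] .
    have "M.retract_of \<delta> \<delta>'"
    proof (rule M.retract_split_cok[OF F F X x' 1 2,
          of "\<lambda>Y\<in>Ob M. fmor F (Tens M X Y) (Tens M (fobj \<Phi> x) Y) (S Y)"
             "\<lambda>Y\<in>Ob M. fmor F (Tens M (fobj \<Phi> x) Y) (Tens M X Y) (R Y)"], goal_cases)
      case 1
      show ?case by (rule nat_transI) (use X in \<open>auto simp: Sn simp flip: Fc\<close>)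
    next
      case 2
      show ?case by (rule nat_transI) (use X in \<open>auto simp: Rn simp flip: Fc\<close>)
    next
      case (3 Y)
      then show ?case using X is_functorD(4)[OF F] by (simp add: RS flip: Fc)
    next
      case (4 Y)
      then show ?case
        using X M.Cmp_cong_assoc[OF Ri, of Y "Tens M X Y" "p' X Y"]
        by (simp add: M.ip_def pS flip: Fc)
    qed
    then obtain s r where s: "s \<in> nat_trans M B \<delta> \<delta>'" and r: "r \<in> nat_trans M B \<delta>' \<delta>"
      and rs: "\<forall>y\<in>Ob M. Cmp B (fobj \<delta> y) (fobj \<delta>' y) (fobj \<delta> y) (r y) (s y) = Idn B (fobj \<delta> y)"
      unfolding M.retract_of_def by blast
    have \<delta>: "is_functor M B \<delta>" using 1 unfolding M.split_cok_def by blast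
    have "N.retract_of (comp_func N \<delta> \<Phi>) (comp_func N \<delta>' \<Phi>)"
      unfolding N.retract_of_def
      by (rule bexI[OF _ nat_trans_precomp[OF s]], rule bexI[OF _ nat_trans_precomp[OF r]])
         (use rs in auto)
    then have "comp_func N \<delta> \<Phi> \<in> pol_below N B k"
      using N.pol_below_retract[OF 3 is_functor_precomp[OF \<delta>]] by blast
    then show ?thesis using Suc.IH[OF \<delta>] 1 by blast
  qed
  then show ?case unfolding M.pol_below_Suc_split using F by blast
qed

end

section \<open>Dualities and forms\<close>

context additive_category
begin

lemma add_swap_neg [simp]:
  "\<lbrakk>a \<in> Ob A; b \<in> Ob A; f \<in> Hom A a b; g \<in> Hom A a b\<rbrakk>
    \<Longrightarrow> f \<otimes>\<^bsub>Hgrp A a b\<^esub> (g \<otimes>\<^bsub>Hgrp A a b\<^esub> inv\<^bsub>Hgrp A a b\<^esub> f) = g"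
  using add_lcomm[of a b f g "inv\<^bsub>Hgrp A a b\<^esub> f"] by simp

lemma add_swap_neg2 [simp]:
  "\<lbrakk>a \<in> Ob A; b \<in> Ob A; f \<in> Hom A a b; g \<in> Hom A a b; h \<in> Hom A a b\<rbrakk>
    \<Longrightarrow> f \<otimes>\<^bsub>Hgrp A a b\<^esub> (g \<otimes>\<^bsub>Hgrp A a b\<^esub> (h \<otimes>\<^bsub>Hgrp A a b\<^esub> inv\<^bsub>Hgrp A a b\<^esub> f)) = g \<otimes>\<^bsub>Hgrp A a b\<^esub> h"
  using add_swap_neg[of a b f "g \<otimes>\<^bsub>Hgrp A a b\<^esub> h"] by (simp add: add_assoc)

declare Sum_in [simp] In1_in [simp] In2_in [simp] Pr1_in [simp] Pr2_in [simp]
  Pr1_In1 [simp] Pr2_In2 [simp] Pr2_In1 [simp] Pr1_In2 [simp]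

lemma Pr_In_assoc [simp]:
  assumes "x \<in> Ob A" "a \<in> Ob A" "b \<in> Ob A"
  shows "f \<in> Hom A x a \<Longrightarrow> Cmp A x (Sum A a b) a (Pr1 A a b) (Cmp A x a (Sum A a b) (In1 A a b) f) = f"
    and "f \<in> Hom A x a \<Longrightarrow> Cmp A x (Sum A a b) b (Pr2 A a b) (Cmp A x a (Sum A a b) (In1 A a b) f) = zero x b"
    and "g \<in> Hom A x b \<Longrightarrow> Cmp A x (Sum A a b) a (Pr1 A a b) (Cmp A x b (Sum A a b) (In2 A a b) g) = zero x a"
    and "g \<in> Hom A x b \<Longrightarrow> Cmp A x (Sum A a b) b (Pr2 A a b) (Cmp A x b (Sum A a b) (In2 A a b) g) = g"
  using assms Cmp_cong_assoc[OF Pr1_In1, of a b x f] Cmp_cong_assoc[OF Pr2_In1, of a b x f]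
    Cmp_cong_assoc[OF Pr1_In2, of a b x g] Cmp_cong_assoc[OF Pr2_In2, of a b x g] by auto

lemma pairing_in [simp]:
  "\<lbrakk>x \<in> Ob A; a \<in> Ob A; b \<in> Ob A; f \<in> Hom A x a; g \<in> Hom A x b\<rbrakk> \<Longrightarrow> pairing A x a b f g \<in> Hom A x (Sum A a b)"
  by (simp add: pairing_def)

lemma Pr_pairing [simp]:
  assumes "x \<in> Ob A" "a \<in> Ob A" "b \<in> Ob A" "f \<in> Hom A x a" "g \<in> Hom A x b"
  shows "Cmp A x (Sum A a b) a (Pr1 A a b) (pairing A x a b f g) = f"
    and "Cmp A x (Sum A a b) b (Pr2 A a b) (pairing A x a b f g) = g"
  using assms by (simp_all add: pairing_def)

lemma Pr_pairing_assoc [simp]: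
  assumes "y \<in> Ob A" "x \<in> Ob A" "a \<in> Ob A" "b \<in> Ob A" "f \<in> Hom A x a" "g \<in> Hom A x b" "h \<in> Hom A y x"
  shows "Cmp A y (Sum A a b) a (Pr1 A a b) (Cmp A y x (Sum A a b) (pairing A x a b f g) h) = Cmp A y x a f h"
    and "Cmp A y (Sum A a b) b (Pr2 A a b) (Cmp A y x (Sum A a b) (pairing A x a b f g) h) = Cmp A y x b g h"
  using assms Cmp_cong_assoc[OF Pr_pairing(1)] Cmp_cong_assoc[OF Pr_pairing(2)] by simp_all

lemma sum_decomp:
  assumes "x \<in> Ob A" "a \<in> Ob A" "b \<in> Ob A" "f \<in> Hom A x (Sum A a b)"
  shows "pairing A x a b (Cmp A x (Sum A a b) a (Pr1 A a b) f) (Cmp A x (Sum A a b) b (Pr2 A a b) f) = f"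
proof -
  have "Cmp A x (Sum A a b) (Sum A a b) (Idn A (Sum A a b)) f = f" using assms by simp
  then show ?thesis
    using assms by (simp add: pairing_def flip: In_Pr)
qed

lemma pairing_eqI:
  assumes "x \<in> Ob A" "a \<in> Ob A" "b \<in> Ob A" "f \<in> Hom A x (Sum A a b)" "g \<in> Hom A x (Sum A a b)"
    and "Cmp A x (Sum A a b) a (Pr1 A a b) f = Cmp A x (Sum A a b) a (Pr1 A a b) g"
    and "Cmp A x (Sum A a b) b (Pr2 A a b) f = Cmp A x (Sum A a b) b (Pr2 A a b) g"
  shows "f = g"
  using assms sum_decomp by metis

lemma pairing_Cmp [simp]:
  assumes "y \<in> Ob A" "x \<in> Ob A" "a \<in> Ob A" "b \<in> Ob A" "f \<in> Hom A x a" "g \<in> Hom A x b" "h \<in> Hom A y x"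
  shows "Cmp A y x (Sum A a b) (pairing A x a b f g) h = pairing A y a b (Cmp A y x a f h) (Cmp A y x b g h)"
  using assms by (simp add: pairing_def)

lemma copairing_eqI:
  assumes "x \<in> Ob A" "a \<in> Ob A" "b \<in> Ob A" "f \<in> Hom A (Sum A a b) x" "g \<in> Hom A (Sum A a b) x"
    and "Cmp A a (Sum A a b) x f (In1 A a b) = Cmp A a (Sum A a b) x g (In1 A a b)"
    and "Cmp A b (Sum A a b) x f (In2 A a b) = Cmp A b (Sum A a b) x g (In2 A a b)"
  shows "f = g"
proof -
  have "h = Cmp A (Sum A a b) a x (Cmp A a (Sum A a b) x h (In1 A a b)) (Pr1 A a b) \<otimes>\<^bsub>Hgrp A (Sum A a b) x\<^esub>
      Cmp A (Sum A a b) b x (Cmp A b (Sum A a b) x h (In2 A a b)) (Pr2 A a b)" if "h \<in> Hom A (Sum A a b) x" for h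
    using assms(1-3) that Cmp_Idn_right[of "Sum A a b" x h] by (simp flip: In_Pr del: Cmp_Idn_right)
  from this[OF assms(4)] this[OF assms(5)] show ?thesis unfolding assms(6,7) by simp
qed

text \<open>D sends the chosen sum of X and Y to a biproduct of D X and D Y which is in general not
  the chosen one. Matrices of forms, which are arrows S -> D S, need this relational
  version.\<close>

definition is_biproduct :: "'o \<Rightarrow> 'o \<Rightarrow> 'o \<Rightarrow> 'm \<Rightarrow> 'm \<Rightarrow> 'm \<Rightarrow> 'm \<Rightarrow> bool" where
  "is_biproduct X Y S i1 i2 p1 p2 \<longleftrightarrow> X \<in> Ob A \<and> Y \<in> Ob A \<and> S \<in> Ob A \<and>
     i1 \<in> Hom A X S \<and> i2 \<in> Hom A Y S \<and> p1 \<in> Hom A S X \<and> p2 \<in> Hom A S Y \<and>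
     Cmp A X S X p1 i1 = Idn A X \<and> Cmp A Y S Y p2 i2 = Idn A Y \<and>
     Cmp A X S Y p2 i1 = (zero X Y) \<and> Cmp A Y S X p1 i2 = (zero Y X) \<and>
     Cmp A S X S i1 p1 \<otimes>\<^bsub>Hgrp A S S\<^esub> Cmp A S Y S i2 p2 = Idn A S"

lemma is_biproduct_Sum:
  "\<lbrakk>x \<in> Ob A; y \<in> Ob A\<rbrakk> \<Longrightarrow> is_biproduct x y (Sum A x y) (In1 A x y) (In2 A x y) (Pr1 A x y) (Pr2 A x y)"
  by (simp add: is_biproduct_def In_Pr)

lemma is_biproduct_swap: "is_biproduct X Y S i1 i2 p1 p2 \<Longrightarrow> is_biproduct Y X S i2 i1 p2 p1"
  unfolding is_biproduct_def by (simp add: add_comm[of S S "Cmp A S Y S i2 p2"])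

lemma is_biproduct_assoc:
  assumes "is_biproduct X Y S i1 i2 p1 p2" "Z \<in> Ob A"
  shows "f \<in> Hom A Z X \<Longrightarrow> Cmp A Z S X p1 (Cmp A Z X S i1 f) = f"
    "f \<in> Hom A Z X \<Longrightarrow> Cmp A Z S Y p2 (Cmp A Z X S i1 f) = zero Z Y"
    "g \<in> Hom A Z Y \<Longrightarrow> Cmp A Z S X p1 (Cmp A Z Y S i2 g) = zero Z X"
    "g \<in> Hom A Z Y \<Longrightarrow> Cmp A Z S Y p2 (Cmp A Z Y S i2 g) = g"
  using assms Cmp_cong_assoc[of X S X p1 i1 _ Z f] Cmp_cong_assoc[of X S Y p2 i1 _ Z f]
    Cmp_cong_assoc[of Y S X p1 i2 _ Z g] Cmp_cong_assoc[of Y S Y p2 i2 _ Z g]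
  by (auto simp: is_biproduct_def)

text \<open>In matrix form this is (a, b; c, 0) with b and c invertible. Every nondegeneracy proof
  below that is not trivial reduces to this shape: orthogonal sums, hyperbolic objects and the
  splitting of diag (u, u).\<close>

lemma triangular_invertible:
  assumes bi: "is_biproduct X Y S i1 i2 p1 p2" "is_biproduct U V W j1 j2 k1 k2"
    and a [simp]: "a \<in> Hom A X U" and b: "invertible A Y U b" and c: "invertible A X V c"
  shows "invertible A S W
    (Cmp A S U W j1 (Cmp A S X U a p1 \<otimes>\<^bsub>Hgrp A S U\<^esub> Cmp A S Y U b p2)
     \<otimes>\<^bsub>Hgrp A S W\<^esub> Cmp A S V W j2 (Cmp A S X V c p1))"
    (is "invertible A S W ?M")
proof -
  obtain b' c' where [simp]: "b \<in> Hom A Y U" "b' \<in> Hom A U Y"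
    and b1 [simp]: "Cmp A Y U Y b' b = Idn A Y" "Cmp A U Y U b b' = Idn A U"
    and [simp]: "c \<in> Hom A X V" "c' \<in> Hom A V X"
    and c1 [simp]: "Cmp A X V X c' c = Idn A X" "Cmp A V X V c c' = Idn A V"
    using b c by (auto simp: invertible_def is_inverse_def)
  have ob [simp]: "X \<in> Ob A" "Y \<in> Ob A" "S \<in> Ob A" "U \<in> Ob A" "V \<in> Ob A" "W \<in> Ob A"
    and [simp]: "i1 \<in> Hom A X S" "i2 \<in> Hom A Y S" "p1 \<in> Hom A S X" "p2 \<in> Hom A S Y"
      "j1 \<in> Hom A U W" "j2 \<in> Hom A V W" "k1 \<in> Hom A W U" "k2 \<in> Hom A W V"
    and ip: "Cmp A S X S i1 p1 \<otimes>\<^bsub>Hgrp A S S\<^esub> Cmp A S Y S i2 p2 = Idn A S"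
    using bi by (auto simp: is_biproduct_def)
  have jk: "Cmp A W V W j2 k2 \<otimes>\<^bsub>Hgrp A W W\<^esub> Cmp A W U W j1 k1 = Idn A W"
    using is_biproduct_swap[OF bi(2)] by (simp add: is_biproduct_def)
  note [simp] = is_biproduct_assoc[OF bi(1)] is_biproduct_assoc[OF bi(2)]
  have [simp]: "Cmp A Z U Y b' (Cmp A Z Y U b f) = f" if "Z \<in> Ob A" "f \<in> Hom A Z Y" for Z f
    using that Cmp_cong_assoc[OF b1(1), of Z f] by simp
  have [simp]: "Cmp A Z Y U b (Cmp A Z U Y b' f) = f" if "Z \<in> Ob A" "f \<in> Hom A Z U" for Z f
    using that Cmp_cong_assoc[OF b1(2), of Z f] by simp
  have [simp]: "Cmp A Z V X c' (Cmp A Z X V c f) = f" if "Z \<in> Ob A" "f \<in> Hom A Z X" for Z f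
    using that Cmp_cong_assoc[OF c1(1), of Z f] by simp
  have [simp]: "Cmp A Z X V c (Cmp A Z V X c' f) = f" if "Z \<in> Ob A" "f \<in> Hom A Z V" for Z f
    using that Cmp_cong_assoc[OF c1(2), of Z f] by simp
  \<comment> \<open>Solving the system for (r, s): the X component is \<open>?e\<close>, that is
    \<open>c' s\<close>, and the Y component is b' applied to \<open>?d\<close>, that is r - a c'
    s.\<close>
  let ?e = "Cmp A W V X c' k2"
  let ?d = "k1 \<otimes>\<^bsub>Hgrp A W U\<^esub> inv\<^bsub>Hgrp A W U\<^esub> (Cmp A W X U a ?e)"
  let ?M' = "Cmp A W X S i1 ?e \<otimes>\<^bsub>Hgrp A W S\<^esub> Cmp A W Y S i2 (Cmp A W U Y b' ?d)"
  have "Cmp A S W U ?d ?M = Cmp A S Y U b p2"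
    by (simp add: add_assoc)
  then have "Cmp A S W S ?M' ?M = Idn A S"
    by (simp del: Cmp_add_left Cmp_add_right Cmp_neg_left Cmp_neg_right
      add: Cmp_add_left[of S W S] Cmp_add_right[of S W X] ip)
       (simp add: ip)
  moreover have "Cmp A W S W ?M ?M' = Idn A W"
    by (simp add: add_assoc jk)
  moreover have "?M \<in> Hom A S W" "?M' \<in> Hom A W S" by simp_all
  ultimately show ?thesis unfolding invertible_def is_inverse_def by blast
qed

end

section \<open>Additivity of the duality\<close>

context duality
begin

lemma D_obj [simp]: "x \<in> Ob A \<Longrightarrow> fobj D x \<in> Ob A"
  using is_functorD(2)[OF D_functor] by (simp add: op_cat_def)

lemma D_in [simp]: "\<lbrakk>x \<in> Ob A; y \<in> Ob A; f \<in> Hom A x y\<rbrakk> \<Longrightarrow> fmor D y x f \<in> Hom A (fobj D y) (fobj D x)"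
  using is_functorD(3)[OF D_functor, of y x f] by (simp add: op_cat_def)

lemma D_Idn [simp]: "x \<in> Ob A \<Longrightarrow> fmor D x x (Idn A x) = Idn A (fobj D x)"
  using is_functorD(4)[OF D_functor, of x] by (simp add: op_cat_def)

lemma D_Cmp: "\<lbrakk>x \<in> Ob A; y \<in> Ob A; z \<in> Ob A; f \<in> Hom A x y; g \<in> Hom A y z\<rbrakk> \<Longrightarrow>
    fmor D z x (Cmp A x y z g f) = Cmp A (fobj D z) (fobj D y) (fobj D x) (fmor D y x f) (fmor D z y g)"
  using is_functorD(5)[OF D_functor, of z y x g f] by (simp add: op_cat_def)

lemma sig_in [simp]: "\<lbrakk>x \<in> Ob A; y \<in> Ob A; a \<in> Hom A x (fobj D y)\<rbrakk> \<Longrightarrow> \<sigma> x y a \<in> Hom A y (fobj D x)"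
  using \<sigma>_bij by (auto simp: bij_betw_def)

lemma sig_inj: "\<lbrakk>x \<in> Ob A; y \<in> Ob A; a \<in> Hom A x (fobj D y); b \<in> Hom A x (fobj D y); \<sigma> x y a = \<sigma> x y b\<rbrakk> \<Longrightarrow> a = b"
  using \<sigma>_inverse by metis

lemma sig_Cmp_left:
  assumes "x \<in> Ob A" "y \<in> Ob A" "y' \<in> Ob A" "g \<in> Hom A y' y" "a \<in> Hom A x (fobj D y)"
  shows "\<sigma> x y' (Cmp A x (fobj D y) (fobj D y') (fmor D y y' g) a) = Cmp A y' y (fobj D x) (\<sigma> x y a) g"
  using \<sigma>_natural[of x x y y' "Idn A x" g a] assms by simp

lemma sig_Cmp_right:
  assumes "x \<in> Ob A" "y \<in> Ob A" "x' \<in> Ob A" "f \<in> Hom A x' x" "a \<in> Hom A x (fobj D y)"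
  shows "\<sigma> x' y (Cmp A x' x (fobj D y) a f) = Cmp A y (fobj D x) (fobj D x') (fmor D x x' f) (\<sigma> x y a)"
  using \<sigma>_natural[of x x' y y f "Idn A y" a] assms by simp

lemma sig_conj:
  assumes "x \<in> Ob A" "y \<in> Ob A" "f \<in> Hom A x y" "g \<in> Hom A x y" "a \<in> Hom A y (fobj D y)"
  shows "\<sigma> x x (Cmp A x (fobj D y) (fobj D x) (fmor D y x g) (Cmp A x y (fobj D y) a f)) =
    Cmp A x (fobj D y) (fobj D x) (fmor D y x f) (Cmp A x y (fobj D y) (\<sigma> y y a) g)"
  using assms by (intro \<sigma>_natural)

text \<open>Neither \<open>D\<close> nor \<open>\<sigma>\<close> is assumed additive: as \<open>D\<close> is self-adjoint, it turns coproducts into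
  products, hence biproducts into biproducts.\<close>

lemma D_sum_eqI:
  assumes X: "X \<in> Ob A" and y: "y \<in> Ob A" "z \<in> Ob A"
    and h: "h \<in> Hom A X (fobj D (Sum A y z))" "k \<in> Hom A X (fobj D (Sum A y z))"
    and 1: "Cmp A X (fobj D (Sum A y z)) (fobj D y) (fmor D (Sum A y z) y (In1 A y z)) h =
      Cmp A X (fobj D (Sum A y z)) (fobj D y) (fmor D (Sum A y z) y (In1 A y z)) k"
    and 2: "Cmp A X (fobj D (Sum A y z)) (fobj D z) (fmor D (Sum A y z) z (In2 A y z)) h =
      Cmp A X (fobj D (Sum A y z)) (fobj D z) (fmor D (Sum A y z) z (In2 A y z)) k"
  shows "h = k"
proof (rule sig_inj[OF X _ h])
  show "\<sigma> X (Sum A y z) h = \<sigma> X (Sum A y z) k"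
  proof (rule copairing_eqI[of "fobj D X" y z])
    show "Cmp A y (Sum A y z) (fobj D X) (\<sigma> X (Sum A y z) h) (In1 A y z) =
        Cmp A y (Sum A y z) (fobj D X) (\<sigma> X (Sum A y z) k) (In1 A y z)"
      using 1 X y h sig_Cmp_left[of X "Sum A y z" y "In1 A y z"] by (metis In1_in Sum_in)
    show "Cmp A z (Sum A y z) (fobj D X) (\<sigma> X (Sum A y z) h) (In2 A y z) =
        Cmp A z (Sum A y z) (fobj D X) (\<sigma> X (Sum A y z) k) (In2 A y z)"
      using 2 X y h sig_Cmp_left[of X "Sum A y z" z "In2 A y z"] by (metis In2_in Sum_in)
  qed (use X y h in auto)
qed (use y in auto)

text \<open>Under \<sigma>, arrows X -> D 0 correspond to arrows 0 -> D X, of which there is only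
  one.\<close>

lemma to_D_Zob:
  assumes "X \<in> Ob A" "h \<in> Hom A X (fobj D (Zob A))"
  shows "h = (zero X (fobj D (Zob A)))"
proof (rule sig_inj[OF assms(1) Zob_in assms(2)])
  show "\<sigma> X (Zob A) h = \<sigma> X (Zob A) (zero X (fobj D (Zob A)))"
    using assms null_from[OF Zob_null, of "fobj D X"] by (metis D_obj Zob_in sig_in zero_in)
qed (use assms in auto)

lemma D_zero [simp]:
  assumes "x \<in> Ob A" "y \<in> Ob A"
  shows "fmor D y x (zero x y) = zero (fobj D y) (fobj D x)"
proof -
  have "(zero x y) = Cmp A x (Zob A) y (zero (Zob A) y) (zero x (Zob A))" using assms by simp
  moreover have "fmor D y (Zob A) (zero (Zob A) y) = (zero (fobj D y) (fobj D (Zob A)))"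
    using assms by (intro to_D_Zob) auto
  ultimately show ?thesis using assms
    D_Cmp[of x "Zob A" y "(zero x (Zob A))" "(zero (Zob A) y)"] by simp
qed

lemma D_add [simp]:
  assumes x: "x \<in> Ob A" "y \<in> Ob A" and f: "f \<in> Hom A x y" "g \<in> Hom A x y"
  shows "fmor D y x (f \<otimes>\<^bsub>Hgrp A x y\<^esub> g) = fmor D y x f \<otimes>\<^bsub>Hgrp A (fobj D y) (fobj D x)\<^esub> fmor D y x g"
proof -
  let ?s = "Sum A y y" and ?c = "Pr1 A y y \<otimes>\<^bsub>Hgrp A (Sum A y y) y\<^esub> Pr2 A y y"
  \<comment> \<open>\<open>?c\<close> is the codiagonal of y. Its image under D and the sum on the
    right agree after composing with D of either inclusion, where both become the identity.\<close>
  have c: "fmor D y ?s ?c = fmor D y ?s (Pr1 A y y) \<otimes>\<^bsub>Hgrp A (fobj D y) (fobj D ?s)\<^esub> fmor D y ?s (Pr2 A y y)"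
    by (rule D_sum_eqI[of "fobj D y" y y]) (use x in \<open>auto simp flip: D_Cmp\<close>)
  have "f \<otimes>\<^bsub>Hgrp A x y\<^esub> g = Cmp A x ?s y ?c (pairing A x y y f g)" using x f by simp
  then have "fmor D y x (f \<otimes>\<^bsub>Hgrp A x y\<^esub> g) =
      Cmp A (fobj D y) (fobj D ?s) (fobj D x) (fmor D ?s x (pairing A x y y f g)) (fmor D y ?s ?c)"
    using x f D_Cmp[of x ?s y "pairing A x y y f g" ?c] by simp
  also have "\<dots> = fmor D y x f \<otimes>\<^bsub>Hgrp A (fobj D y) (fobj D x)\<^esub> fmor D y x g"
    using x f by (simp add: c flip: D_Cmp)
  finally show ?thesis .
qed

lemma D_neg [simp]:
  assumes "x \<in> Ob A" "y \<in> Ob A" "f \<in> Hom A x y"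
  shows "fmor D y x (inv\<^bsub>Hgrp A x y\<^esub> f) = inv\<^bsub>Hgrp A (fobj D y) (fobj D x)\<^esub> (fmor D y x f)"
  using assms by (intro neg_unique) (auto simp flip: D_add)

text \<open>The Yoneda description of \<sigma> by the unit of the duality; through it \<sigma>
  inherits additivity from D.\<close>

lemma sig_eq:
  assumes "x \<in> Ob A" "y \<in> Ob A" "a \<in> Hom A x (fobj D y)"
  shows "\<sigma> x y a = Cmp A y (fobj D (fobj D y)) (fobj D x) (fmor D (fobj D y) x a) (\<sigma> (fobj D y) y (Idn A (fobj D y)))"
  using sig_Cmp_right[of "fobj D y" y x a "Idn A (fobj D y)"] assms by simp

lemma sig_add [simp]:
  assumes "x \<in> Ob A" "y \<in> Ob A" "a \<in> Hom A x (fobj D y)" "b \<in> Hom A x (fobj D y)"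
  shows "\<sigma> x y (a \<otimes>\<^bsub>Hgrp A x (fobj D y)\<^esub> b) = \<sigma> x y a \<otimes>\<^bsub>Hgrp A y (fobj D x)\<^esub> \<sigma> x y b"
  using assms by (simp add: sig_eq[of x y a] sig_eq[of x y b] sig_eq[of x y "a \<otimes>\<^bsub>Hgrp A x (fobj D y)\<^esub> b"])

lemma sig_zero [simp]:
  assumes "x \<in> Ob A" "y \<in> Ob A"
  shows "\<sigma> x y (zero x (fobj D y)) = zero y (fobj D x)"
  using assms sig_eq[of x y "(zero x (fobj D y))"] by simp

lemma sig_neg [simp]:
  assumes "x \<in> Ob A" "y \<in> Ob A" "a \<in> Hom A x (fobj D y)"
  shows "\<sigma> x y (inv\<^bsub>Hgrp A x (fobj D y)\<^esub> a) = inv\<^bsub>Hgrp A y (fobj D x)\<^esub> (\<sigma> x y a)"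
  using assms by (intro neg_unique) (auto simp flip: sig_add)

lemma is_biproduct_D:
  assumes "is_biproduct X Y S i1 i2 p1 p2"
  shows "is_biproduct (fobj D X) (fobj D Y) (fobj D S)
    (fmor D X S p1) (fmor D Y S p2) (fmor D S X i1) (fmor D S Y i2)"
  using assms unfolding is_biproduct_def by (simp flip: D_Cmp D_add)

end

text \<open>\<open>SD\<^sup>2\<^sub>\<epsilon>\<close> and \<open>\<bar>SD\<^sup>2\<^sub>\<epsilon>\<close> are both natural quotients \<open>\<tau>\<close> of \<open>TD\<^sup>2\<close> through which the norm
  factors; nothing else about them is needed.\<close>

locale hermitian = duality A D \<sigma>
  for A :: "('ao, 'am, 'z) addcat_scheme" and D :: "('ao, 'am, 'ao, 'am) func"
    and \<sigma> :: "'ao \<Rightarrow> 'ao \<Rightarrow> 'am \<Rightarrow> 'am" +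
  fixes T :: "('ao, 'am, 't) form_functor" and \<tau> :: "'ao \<Rightarrow> 'am \<Rightarrow> 't" and \<epsilon> :: int
  assumes \<epsilon>: "\<epsilon> \<in> {-1, 1}"
    and T_group: "x \<in> Ob A \<Longrightarrow> comm_group (Tgrp T x)"
    and \<tau>_in [simp]: "\<lbrakk>x \<in> Ob A; a \<in> Hom A x (fobj D x)\<rbrakk> \<Longrightarrow> \<tau> x a \<in> carrier (Tgrp T x)"
    and \<tau>_add [simp]: "\<lbrakk>x \<in> Ob A; a \<in> Hom A x (fobj D x); b \<in> Hom A x (fobj D x)\<rbrakk>
      \<Longrightarrow> \<tau> x (a \<otimes>\<^bsub>Hgrp A x (fobj D x)\<^esub> b) = \<tau> x a \<otimes>\<^bsub>Tgrp T x\<^esub> \<tau> x b"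
    and \<tau>_surj: "\<lbrakk>x \<in> Ob A; u \<in> carrier (Tgrp T x)\<rbrakk> \<Longrightarrow> \<exists>a\<in>Hom A x (fobj D x). u = \<tau> x a"
    and \<tau>_sig: "\<lbrakk>x \<in> Ob A; a \<in> Hom A x (fobj D x)\<rbrakk> \<Longrightarrow> \<tau> x (\<sigma> x x a) = \<tau> x a [^]\<^bsub>Tgrp T x\<^esub> \<epsilon>"
    and Tmap_\<tau> [simp]: "\<lbrakk>x \<in> Ob A; y \<in> Ob A; f \<in> Hom A x y; a \<in> Hom A y (fobj D y)\<rbrakk>
      \<Longrightarrow> Tmap T x y f (\<tau> y a) =
        \<tau> x (Cmp A x (fobj D y) (fobj D x) (fmor D y x f) (Cmp A x y (fobj D y) a f))"
    and Tform_\<tau>: "\<lbrakk>x \<in> Ob A; a \<in> Hom A x (fobj D x)\<rbrakk>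
      \<Longrightarrow> Tform T x (\<tau> x a) =
        a \<otimes>\<^bsub>Hgrp A x (fobj D x)\<^esub> (\<sigma> x x a [^]\<^bsub>Hgrp A x (fobj D x)\<^esub> \<epsilon>)"
begin

text \<open>Multiplication by \<epsilon>. The case distinction replaces an integer power in the
  group by an operation that simplification can move through sums and composites.\<close>

definition eneg :: "'ao \<Rightarrow> 'ao \<Rightarrow> 'am \<Rightarrow> 'am" where
  "eneg x y a = (if \<epsilon> = 1 then a else inv\<^bsub>Hgrp A x y\<^esub> a)"

lemma eneg_in [simp]: "\<lbrakk>x \<in> Ob A; y \<in> Ob A; a \<in> Hom A x y\<rbrakk> \<Longrightarrow> eneg x y a \<in> Hom A x y"
  by (simp add: eneg_def)

lemma pow_eps:
  assumes "x \<in> Ob A" "y \<in> Ob A" "a \<in> Hom A x y"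
  shows "a [^]\<^bsub>Hgrp A x y\<^esub> \<epsilon> = eneg x y a"
proof -
  interpret group "Hgrp A x y" using assms(1,2) by (rule Hgrp_group)
  show ?thesis using \<epsilon> assms Hgrp_carrier[of x y] by (auto simp: eneg_def int_pow_neg)
qed

lemma Cmp_eneg [simp]:
  assumes "x \<in> Ob A" "y \<in> Ob A" "z \<in> Ob A" "f \<in> Hom A x y" "g \<in> Hom A y z"
  shows "Cmp A x y z (eneg y z g) f = eneg x z (Cmp A x y z g f)"
    and "Cmp A x y z g (eneg x y f) = eneg x z (Cmp A x y z g f)"
  using assms by (simp_all add: eneg_def)

lemma eneg_eneg [simp]: "\<lbrakk>x \<in> Ob A; y \<in> Ob A; a \<in> Hom A x y\<rbrakk> \<Longrightarrow> eneg x y (eneg x y a) = a"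
  by (simp add: eneg_def)

lemma eneg_zero [simp]: "\<lbrakk>x \<in> Ob A; y \<in> Ob A\<rbrakk> \<Longrightarrow> eneg x y (zero x y) = zero x y"
  by (simp add: eneg_def)

lemma eneg_add [simp]: "\<lbrakk>x \<in> Ob A; y \<in> Ob A; a \<in> Hom A x y; b \<in> Hom A x y\<rbrakk>
    \<Longrightarrow> eneg x y (a \<otimes>\<^bsub>Hgrp A x y\<^esub> b) = eneg x y a \<otimes>\<^bsub>Hgrp A x y\<^esub> eneg x y b"
  using Hgrp_comm_group[of x y] Hgrp_carrier[of x y]
  by (auto simp: eneg_def comm_group.inv_mult)

lemma sig_eneg [simp]: "\<lbrakk>x \<in> Ob A; y \<in> Ob A; a \<in> Hom A x (fobj D y)\<rbrakk>
    \<Longrightarrow> \<sigma> x y (eneg x (fobj D y) a) = eneg y (fobj D x) (\<sigma> x y a)"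
  by (simp add: eneg_def)

lemma invertible_eneg: "\<lbrakk>x \<in> Ob A; y \<in> Ob A; invertible A x y a\<rbrakk> \<Longrightarrow> invertible A x y (eneg x y a)"
  unfolding invertible_def is_inverse_def by (elim exE conjE) (rule_tac x = "eneg y x g" in exI, simp)

lemma \<tau>_group_hom: "x \<in> Ob A \<Longrightarrow> group_hom (Hgrp A x (fobj D x)) (Tgrp T x) (\<tau> x)"
  unfolding group_hom_def group_hom_axioms_def hom_def
  by (auto simp: Hgrp_group Hgrp_carrier comm_group.axioms(2)[OF T_group])

lemma \<tau>_zero [simp]: "x \<in> Ob A \<Longrightarrow> \<tau> x (zero x (fobj D x)) = \<one>\<^bsub>Tgrp T x\<^esub>"
  using group_hom.hom_one[OF \<tau>_group_hom] .

lemma \<tau>_neg [simp]: "\<lbrakk>x \<in> Ob A; a \<in> Hom A x (fobj D x)\<rbrakk>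
    \<Longrightarrow> \<tau> x (inv\<^bsub>Hgrp A x (fobj D x)\<^esub> a) = inv\<^bsub>Tgrp T x\<^esub> (\<tau> x a)"
  using group_hom.hom_inv[OF \<tau>_group_hom] by (simp add: Hgrp_carrier)

lemma \<tau>_sig_eneg: "\<lbrakk>x \<in> Ob A; a \<in> Hom A x (fobj D x)\<rbrakk> \<Longrightarrow> \<tau> x (\<sigma> x x a) = \<tau> x (eneg x (fobj D x) a)"
  using \<tau>_sig[of x a] group_hom.hom_int_pow[OF \<tau>_group_hom[of x], of a \<epsilon>] pow_eps[of x "fobj D x" a]
  by (simp add: Hgrp_carrier)

lemma Tform_\<tau>' [simp]: "\<lbrakk>x \<in> Ob A; a \<in> Hom A x (fobj D x)\<rbrakk> \<Longrightarrow> Tform T x (\<tau> x a) =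
    a \<otimes>\<^bsub>Hgrp A x (fobj D x)\<^esub> eneg x (fobj D x) (\<sigma> x x a)"
  by (simp add: Tform_\<tau> pow_eps)

lemma T_add_in [simp]: "\<lbrakk>x \<in> Ob A; u \<in> carrier (Tgrp T x); v \<in> carrier (Tgrp T x)\<rbrakk>
    \<Longrightarrow> u \<otimes>\<^bsub>Tgrp T x\<^esub> v \<in> carrier (Tgrp T x)"
  using T_group[of x] by (simp add: comm_group_def comm_monoid_def monoid.m_closed)

lemma T_zero_in [simp]: "x \<in> Ob A \<Longrightarrow> \<one>\<^bsub>Tgrp T x\<^esub> \<in> carrier (Tgrp T x)"
  using T_group[of x] by (simp add: comm_group_def comm_monoid_def monoid.one_closed)

lemma T_neg_in [simp]: "\<lbrakk>x \<in> Ob A; u \<in> carrier (Tgrp T x)\<rbrakk> \<Longrightarrow> inv\<^bsub>Tgrp T x\<^esub> u \<in> carrier (Tgrp T x)"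
  using T_group[of x] by (simp add: comm_group_def group.inv_closed)

lemma T_add_zero [simp]:
  assumes "x \<in> Ob A" "u \<in> carrier (Tgrp T x)"
  shows "u \<otimes>\<^bsub>Tgrp T x\<^esub> \<one>\<^bsub>Tgrp T x\<^esub> = u" "\<one>\<^bsub>Tgrp T x\<^esub> \<otimes>\<^bsub>Tgrp T x\<^esub> u = u"
  using T_group[of x] assms by (simp_all add: comm_group_def comm_monoid_def monoid.r_one monoid.l_one)

text \<open>Here, as in most of the following facts about \<open>Tmap\<close> and
  \<open>Tform\<close>, elements of T are lifted along the surjection \<tau> to arrows x -> D x,
  where the formulas are explicit.\<close>

lemma Tmap_in [simp]:
  assumes "x \<in> Ob A" "y \<in> Ob A" "f \<in> Hom A x y" "u \<in> carrier (Tgrp T y)"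
  shows "Tmap T x y f u \<in> carrier (Tgrp T x)"
  using \<tau>_surj[OF assms(2,4)] assms by auto

lemma Tmap_add [simp]:
  assumes "x \<in> Ob A" "y \<in> Ob A" "f \<in> Hom A x y" "u \<in> carrier (Tgrp T y)" "v \<in> carrier (Tgrp T y)"
  shows "Tmap T x y f (u \<otimes>\<^bsub>Tgrp T y\<^esub> v) = Tmap T x y f u \<otimes>\<^bsub>Tgrp T x\<^esub> Tmap T x y f v"
proof -
  obtain a b where "a \<in> Hom A y (fobj D y)" "u = \<tau> y a" "b \<in> Hom A y (fobj D y)" "v = \<tau> y b"
    using \<tau>_surj assms by meson
  then show ?thesis using assms by (simp flip: \<tau>_add)
qed

lemma Tmap_Cmp:
  assumes "x \<in> Ob A" "y \<in> Ob A" "z \<in> Ob A" "f \<in> Hom A x y" "g \<in> Hom A y z" "u \<in> carrier (Tgrp T z)"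
  shows "Tmap T x z (Cmp A x y z g f) u = Tmap T x y f (Tmap T y z g u)"
  using \<tau>_surj[OF assms(3,6)] assms by (auto simp: D_Cmp)

lemma Tmap_Idn [simp]: "\<lbrakk>x \<in> Ob A; u \<in> carrier (Tgrp T x)\<rbrakk> \<Longrightarrow> Tmap T x x (Idn A x) u = u"
  using \<tau>_surj[of x u] by auto

lemma Tmap_zero [simp]: "\<lbrakk>x \<in> Ob A; y \<in> Ob A; u \<in> carrier (Tgrp T y)\<rbrakk>
    \<Longrightarrow> Tmap T x y (zero x y) u = \<one>\<^bsub>Tgrp T x\<^esub>"
  using \<tau>_surj[of y u] by auto

lemma Tmap_one [simp]: "\<lbrakk>x \<in> Ob A; y \<in> Ob A; f \<in> Hom A x y\<rbrakk>
    \<Longrightarrow> Tmap T x y f \<one>\<^bsub>Tgrp T y\<^esub> = \<one>\<^bsub>Tgrp T x\<^esub>"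
  using Tmap_\<tau>[of x y f "(zero y (fobj D y))"] by (simp del: Tmap_\<tau>)

lemma Tform_in [simp]: "\<lbrakk>x \<in> Ob A; u \<in> carrier (Tgrp T x)\<rbrakk> \<Longrightarrow> Tform T x u \<in> Hom A x (fobj D x)"
  using \<tau>_surj[of x u] by auto

lemma Tform_sig [simp]: "\<lbrakk>x \<in> Ob A; u \<in> carrier (Tgrp T x)\<rbrakk>
    \<Longrightarrow> \<sigma> x x (Tform T x u) = eneg x (fobj D x) (Tform T x u)"
  using \<tau>_surj[of x u] by (auto simp: \<sigma>_inverse add_comm)

lemma Tform_add [simp]:
  assumes "x \<in> Ob A" "u \<in> carrier (Tgrp T x)" "v \<in> carrier (Tgrp T x)"
  shows "Tform T x (u \<otimes>\<^bsub>Tgrp T x\<^esub> v) = Tform T x u \<otimes>\<^bsub>Hgrp A x (fobj D x)\<^esub> Tform T x v"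
proof -
  obtain a b where "a \<in> Hom A x (fobj D x)" "u = \<tau> x a" "b \<in> Hom A x (fobj D x)" "v = \<tau> x b"
    using \<tau>_surj assms by meson
  then show ?thesis using assms by (simp add: add_ac flip: \<tau>_add)
qed

lemma Tform_Tmap [simp]:
  assumes "x \<in> Ob A" "y \<in> Ob A" "f \<in> Hom A x y" "u \<in> carrier (Tgrp T y)"
  shows "Tform T x (Tmap T x y f u) =
    Cmp A x (fobj D y) (fobj D x) (fmor D y x f) (Cmp A x y (fobj D y) (Tform T y u) f)"
  using \<tau>_surj[OF assms(2,4)] assms by (auto simp: sig_conj)

text \<open>The cross term of a quadratic form is its bilinear form. If u = \<tau>(a), the mixed
  terms are \<tau>(D f a g) and \<tau>(D g a f); since \<tau>(c) = \<tau>(\<epsilon> \<sigma>(c)),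
  the second equals \<tau>(D f (\<epsilon> \<sigma>(a)) g), and together they contain a + \<epsilon>
  \<sigma>(a), the norm of u.\<close>

lemma Tmap_plus:
  assumes xy: "x \<in> Ob A" "y \<in> Ob A" and fg: "f \<in> Hom A x y" "g \<in> Hom A x y" and u: "u \<in> carrier (Tgrp T y)"
  shows "Tmap T x y (f \<otimes>\<^bsub>Hgrp A x y\<^esub> g) u = Tmap T x y f u \<otimes>\<^bsub>Tgrp T x\<^esub> (Tmap T x y g u \<otimes>\<^bsub>Tgrp T x\<^esub>
    \<tau> x (Cmp A x (fobj D y) (fobj D x) (fmor D y x f) (Cmp A x y (fobj D y) (Tform T y u) g)))"
proof -
  obtain a where a: "a \<in> Hom A y (fobj D y)" "u = \<tau> y a" using \<tau>_surj xy(2) u by blast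
  let ?c = "\<lambda>h k. Cmp A x (fobj D y) (fobj D x) (fmor D y x h) (Cmp A x y (fobj D y) a k)"
  have s: "\<sigma> x x (?c g f) = Cmp A x (fobj D y) (fobj D x) (fmor D y x f) (Cmp A x y (fobj D y) (\<sigma> y y a) g)"
    using xy fg a by (simp add: sig_conj)
  have e: "\<tau> x (?c g f) = \<tau> x (eneg x (fobj D x) (\<sigma> x x (?c g f)))"
    using \<tau>_sig_eneg[of x "eneg x (fobj D x) (?c g f)"] xy fg a by simp
  have "Tmap T x y (f \<otimes>\<^bsub>Hgrp A x y\<^esub> g) u =
      \<tau> x (?c f f) \<otimes>\<^bsub>Tgrp T x\<^esub> \<tau> x (?c f g) \<otimes>\<^bsub>Tgrp T x\<^esub> (\<tau> x (?c g f) \<otimes>\<^bsub>Tgrp T x\<^esub> \<tau> x (?c g g))"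
    using xy fg a by (simp add: add_ac flip: \<tau>_add)
  also have "\<dots> = \<tau> x (?c f f) \<otimes>\<^bsub>Tgrp T x\<^esub> (\<tau> x (?c g g) \<otimes>\<^bsub>Tgrp T x\<^esub> \<tau> x
      (Cmp A x (fobj D y) (fobj D x) (fmor D y x f) (Cmp A x y (fobj D y) (Tform T y u) g)))"
    unfolding e s using xy fg a by (simp add: add_ac flip: \<tau>_add)
  finally show ?thesis using xy fg a by simp
qed

end

section \<open>Arrows of the category of hermitian objects and of \<open>tilde\<close>\<close>

lemma equiv_tilde_rel: "equiv (tilde_pre M a b) (tilde_rel M a b)"
proof (rule equivI)
  let ?s = "tilde_step M a b \<union> (tilde_step M a b)\<inverse>"
  have "sym (?s\<^sup>*)" by (rule sym_rtrancl) (auto simp: sym_def)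
  then show "sym (tilde_rel M a b)" unfolding tilde_rel_def by (auto simp: sym_def)
  show "trans (tilde_rel M a b)" unfolding tilde_rel_def
    by (rule transI) (auto intro: rtrancl_trans)
qed (auto simp: refl_on_def tilde_rel_def)

lemma tilde_class_eq:
  assumes "(t, f) \<in> tilde_pre M a b" "(t', f') \<in> tilde_pre M a b"
    and "((t, f), (t', f')) \<in> tilde_step M a b"
  shows "tilde_class M a b t f = tilde_class M a b t' f'"
  unfolding tilde_class_def
  by (rule equiv_class_eq[OF equiv_tilde_rel]) (use assms in \<open>auto simp: tilde_rel_def\<close>)

lemma in_tilde_classD:
  assumes "(t', f') \<in> tilde_class M a b t f"
  shows "(t', f') \<in> tilde_pre M a b" "tilde_class M a b t f = tilde_class M a b t' f'"
proof -
  have r: "((t, f), (t', f')) \<in> tilde_rel M a b" using assms by (simp add: tilde_class_def)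
  then show "(t', f') \<in> tilde_pre M a b" by (simp add: tilde_rel_def)
  show "tilde_class M a b t f = tilde_class M a b t' f'"
    unfolding tilde_class_def by (rule equiv_class_eq[OF equiv_tilde_rel r])
qed

lemma in_tilde_class: "(t, f) \<in> tilde_pre M a b \<Longrightarrow> (t, f) \<in> tilde_class M a b t f"
  by (simp add: tilde_class_def tilde_rel_def)

lemma tilde_class_invariant:
  assumes "(t', f') \<in> tilde_class M a b t f"
    and step: "\<And>t f t' f'. ((t, f), (t', f')) \<in> tilde_step M a b \<Longrightarrow> Q t f = Q t' f'"
  shows "Q t f = Q t' f'"
proof -
  let ?s = "tilde_step M a b \<union> (tilde_step M a b)\<inverse>"
  have "((t, f), (t', f')) \<in> ?s\<^sup>*" using assms(1) by (auto simp: tilde_class_def tilde_rel_def)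
  then show ?thesis
  proof (induction rule: rtrancl_induct2)
    case (step t1 f1 t2 f2)
    then show ?case using assms(2)[of t1 f1 t2 f2] assms(2)[of t2 f2 t1 f1] by auto
  qed simp
qed

context hermitian
begin

abbreviation M :: "('ao \<times> 't, 'am) smcat" where "M \<equiv> herm A D T"

lemma M_ob: "a \<in> Ob M \<longleftrightarrow> fst a \<in> Ob A \<and> snd a \<in> carrier (Tgrp T (fst a)) \<and>
    invertible A (fst a) (fobj D (fst a)) (Tform T (fst a) (snd a))"
  by (auto simp: herm_def)

lemma M_obD [simp]:
  assumes "a \<in> Ob M"
  shows "fst a \<in> Ob A" "snd a \<in> carrier (Tgrp T (fst a))"
  using assms by (auto simp: M_ob)

lemma M_nondeg: "a \<in> Ob M \<Longrightarrow> invertible A (fst a) (fobj D (fst a)) (Tform T (fst a) (snd a))"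
  using M_ob by blast

lemma M_obI: "\<lbrakk>x \<in> Ob A; u \<in> carrier (Tgrp T x); is_inverse A x (fobj D x) (Tform T x u) g\<rbrakk> \<Longrightarrow> (x, u) \<in> Ob M"
  using M_ob[of "(x, u)"] by (auto simp: invertible_def simp del: M_obD)

lemma M_simps [simp]:
  "f \<in> Hom M a b \<longleftrightarrow> f \<in> Hom A (fst a) (fst b) \<and> Tmap T (fst a) (fst b) f (snd b) = snd a"
  "Idn M a = Idn A (fst a)"
  "Cmp M a b c = Cmp A (fst a) (fst b) (fst c)"
  "fst (Tens M a b) = Sum A (fst a) (fst b)"
  "snd (Tens M a b) = herm_incl A T (fst a) (fst b) (snd a) (snd b)"
  "Tmor M a b c d f g = pairing A (Sum A (fst a) (fst c)) (fst b) (fst d)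
        (Cmp A (Sum A (fst a) (fst c)) (fst a) (fst b) f (Pr1 A (fst a) (fst c)))
        (Cmp A (Sum A (fst a) (fst c)) (fst c) (fst d) g (Pr2 A (fst a) (fst c)))"
  "fst (Unt M) = Zob A" "snd (Unt M) = \<one>\<^bsub>Tgrp T (Zob A)\<^esub>"
  "Lun M a = Pr2 A (Zob A) (fst a)"
  "Run M a = Pr1 A (fst a) (Zob A)"
  "Sym M a b = pairing A (Sum A (fst a) (fst b)) (fst b) (fst a) (Pr2 A (fst a) (fst b)) (Pr1 A (fst a) (fst b))"
  by (auto simp: herm_def dsum_smcat_def case_prod_beta)

lemma M_Asc [simp]: "Asc M a b c = pairing A (Sum A (Sum A (fst a) (fst b)) (fst c)) (fst a) (Sum A (fst b) (fst c))
    (Cmp A (Sum A (Sum A (fst a) (fst b)) (fst c)) (Sum A (fst a) (fst b)) (fst a) (Pr1 A (fst a) (fst b))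
       (Pr1 A (Sum A (fst a) (fst b)) (fst c)))
    (pairing A (Sum A (Sum A (fst a) (fst b)) (fst c)) (fst b) (fst c)
       (Cmp A (Sum A (Sum A (fst a) (fst b)) (fst c)) (Sum A (fst a) (fst b)) (fst b) (Pr2 A (fst a) (fst b))
          (Pr1 A (Sum A (fst a) (fst b)) (fst c)))
       (Pr2 A (Sum A (fst a) (fst b)) (fst c)))"
  by (simp add: herm_def dsum_smcat_def Let_def)

lemma T_assoc: "\<lbrakk>x \<in> Ob A; u \<in> carrier (Tgrp T x); v \<in> carrier (Tgrp T x); w \<in> carrier (Tgrp T x)\<rbrakk>
    \<Longrightarrow> u \<otimes>\<^bsub>Tgrp T x\<^esub> v \<otimes>\<^bsub>Tgrp T x\<^esub> w = u \<otimes>\<^bsub>Tgrp T x\<^esub> (v \<otimes>\<^bsub>Tgrp T x\<^esub> w)"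
  using T_group[of x] by (simp add: comm_group_def comm_monoid_def monoid.m_assoc)

lemma T_comm: "\<lbrakk>x \<in> Ob A; u \<in> carrier (Tgrp T x); v \<in> carrier (Tgrp T x)\<rbrakk>
    \<Longrightarrow> u \<otimes>\<^bsub>Tgrp T x\<^esub> v = v \<otimes>\<^bsub>Tgrp T x\<^esub> u"
  using T_group[of x] by (simp add: comm_group_def comm_monoid.m_comm)

lemma T_lcomm: "\<lbrakk>x \<in> Ob A; u \<in> carrier (Tgrp T x); v \<in> carrier (Tgrp T x); w \<in> carrier (Tgrp T x)\<rbrakk>
    \<Longrightarrow> u \<otimes>\<^bsub>Tgrp T x\<^esub> (v \<otimes>\<^bsub>Tgrp T x\<^esub> w) = v \<otimes>\<^bsub>Tgrp T x\<^esub> (u \<otimes>\<^bsub>Tgrp T x\<^esub> w)"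
  using T_assoc T_comm by metis

lemmas T_ac = T_assoc T_comm T_lcomm

lemma T_neg [simp]:
  assumes "x \<in> Ob A" "u \<in> carrier (Tgrp T x)"
  shows "u \<otimes>\<^bsub>Tgrp T x\<^esub> inv\<^bsub>Tgrp T x\<^esub> u = \<one>\<^bsub>Tgrp T x\<^esub>" "inv\<^bsub>Tgrp T x\<^esub> u \<otimes>\<^bsub>Tgrp T x\<^esub> u = \<one>\<^bsub>Tgrp T x\<^esub>"
  using T_group[of x] assms by (simp_all add: comm_group_def group.r_inv group.l_inv)

lemma herm_incl_in [simp]: "\<lbrakk>x \<in> Ob A; y \<in> Ob A; u \<in> carrier (Tgrp T x); v \<in> carrier (Tgrp T y)\<rbrakk>
    \<Longrightarrow> herm_incl A T x y u v \<in> carrier (Tgrp T (Sum A x y))"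
  by (simp add: herm_incl_def)

lemma Tmap_herm_incl [simp]:
  "\<lbrakk>z \<in> Ob A; x \<in> Ob A; y \<in> Ob A; u \<in> carrier (Tgrp T x); v \<in> carrier (Tgrp T y); k \<in> Hom A z (Sum A x y)\<rbrakk>
    \<Longrightarrow> Tmap T z (Sum A x y) k (herm_incl A T x y u v) =
      Tmap T z x (Cmp A z (Sum A x y) x (Pr1 A x y) k) u \<otimes>\<^bsub>Tgrp T z\<^esub>
      Tmap T z y (Cmp A z (Sum A x y) y (Pr2 A x y) k) v"
  by (simp add: herm_incl_def Tmap_Cmp)

lemma Tens_ob [simp]:
  assumes "a \<in> Ob M" "b \<in> Ob M"
  shows "Tens M a b \<in> Ob M"
proof -
  obtain x u y v where ab: "a = (x, u)" "b = (y, v)" by fastforce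
  have [simp]: "x \<in> Ob A" "y \<in> Ob A" "u \<in> carrier (Tgrp T x)" "v \<in> carrier (Tgrp T y)"
    using assms M_obD unfolding ab by fastforce+
  let ?s = "Sum A x y"
  \<comment> \<open>Exchanging the two summands of the target makes diag (u, v) antidiagonal, the
    triangular shape with a = 0.\<close>
  have "invertible A ?s (fobj D ?s)
    (Cmp A ?s (fobj D y) (fobj D ?s) (fmor D y ?s (Pr2 A x y))
       (Cmp A ?s x (fobj D y) (zero x (fobj D y)) (Pr1 A x y) \<otimes>\<^bsub>Hgrp A ?s (fobj D y)\<^esub> Cmp A ?s y (fobj D y) (Tform T y v) (Pr2 A x y))
     \<otimes>\<^bsub>Hgrp A ?s (fobj D ?s)\<^esub> Cmp A ?s (fobj D x) (fobj D ?s) (fmor D x ?s (Pr1 A x y)) (Cmp A ?s x (fobj D x) (Tform T x u) (Pr1 A x y)))"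
    using M_nondeg[OF assms(1)] M_nondeg[OF assms(2)] is_biproduct_Sum[of x y]
    by (intro triangular_invertible[OF _ is_biproduct_D[OF is_biproduct_swap]]) (simp_all add: ab)
  then show ?thesis unfolding M_ob by (simp add: ab herm_incl_def add_comm)
qed

lemma from_Zob: "\<lbrakk>a \<in> Ob A; f \<in> Hom A (Zob A) a\<rbrakk> \<Longrightarrow> f = zero (Zob A) a"
  by (rule null_from[OF Zob_null])

lemma to_Zob: "\<lbrakk>a \<in> Ob A; f \<in> Hom A a (Zob A)\<rbrakk> \<Longrightarrow> f = zero a (Zob A)"
  by (rule null_to[OF Zob_null])

lemma Unt_ob [simp]: "Unt M \<in> Ob M"
proof -
  let ?z = "Zob A"
  have "Idn A (fobj D ?z) = zero (fobj D ?z) (fobj D ?z)" by (rule to_D_Zob) auto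
  moreover have "Idn A ?z = zero ?z ?z" by (rule to_Zob) auto
  moreover have "Tform T ?z (snd (Unt M)) = zero ?z (fobj D ?z)" by (rule from_Zob) auto
  ultimately have "is_inverse A ?z (fobj D ?z) (Tform T ?z (snd (Unt M))) (zero (fobj D ?z) ?z)"
    by (simp add: is_inverse_def)
  then show ?thesis using M_obI[of ?z "snd (Unt M)"] by (metis M_simps(7,8) T_zero_in Zob_in prod.collapse)
qed

lemma category_M: "category M"
  by unfold_locales (auto simp: Tmap_Cmp)

section \<open>Arrows of \<open>tilde M\<close> in components\<close>

definition adm :: "'ao \<times> 't \<Rightarrow> 'ao \<times> 't \<Rightarrow> 'am \<Rightarrow> 'ao \<times> 't \<Rightarrow> 'am \<Rightarrow> bool" where
  "adm a b f t g \<longleftrightarrow> a \<in> Ob M \<and> b \<in> Ob M \<and> t \<in> Ob M \<and> f \<in> Hom A (fst a) (fst b) \<and> g \<in> Hom A (fst a) (fst t) \<and>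
    Tmap T (fst a) (fst b) f (snd b) \<otimes>\<^bsub>Tgrp T (fst a)\<^esub> Tmap T (fst a) (fst t) g (snd t) = snd a"

definition cls :: "'ao \<times> 't \<Rightarrow> 'ao \<times> 't \<Rightarrow> 'am \<Rightarrow> 'ao \<times> 't \<Rightarrow> 'am \<Rightarrow> (('ao \<times> 't) \<times> 'am) set" where
  "cls a b f t g = tilde_class M a b t (pairing A (fst a) (fst b) (fst t) f g)"

lemma admD:
  assumes "adm a b f t g"
  shows "a \<in> Ob M" "b \<in> Ob M" "t \<in> Ob M" "f \<in> Hom A (fst a) (fst b)" "g \<in> Hom A (fst a) (fst t)"
    "Tmap T (fst a) (fst b) f (snd b) \<otimes>\<^bsub>Tgrp T (fst a)\<^esub> Tmap T (fst a) (fst t) g (snd t) = snd a"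
  using assms by (simp_all add: adm_def)

lemma adm_pre: "adm a b f t g \<Longrightarrow> (t, pairing A (fst a) (fst b) (fst t) f g) \<in> tilde_pre M a b"
  by (auto simp: adm_def tilde_pre_def)

lemma preE:
  assumes "(t, k) \<in> tilde_pre M a b" "a \<in> Ob M" "b \<in> Ob M"
  obtains f g where "adm a b f t g" "k = pairing A (fst a) (fst b) (fst t) f g"
    "f = Cmp A (fst a) (Sum A (fst b) (fst t)) (fst b) (Pr1 A (fst b) (fst t)) k"
    "g = Cmp A (fst a) (Sum A (fst b) (fst t)) (fst t) (Pr2 A (fst b) (fst t)) k"
proof -
  let ?f = "Cmp A (fst a) (Sum A (fst b) (fst t)) (fst b) (Pr1 A (fst b) (fst t)) k"
  let ?g = "Cmp A (fst a) (Sum A (fst b) (fst t)) (fst t) (Pr2 A (fst b) (fst t)) k"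
  have t: "t \<in> Ob M" and k: "k \<in> Hom A (fst a) (Sum A (fst b) (fst t))"
    and T: "Tmap T (fst a) (Sum A (fst b) (fst t)) k (herm_incl A T (fst b) (fst t) (snd b) (snd t)) = snd a"
    using assms(1) by (auto simp: tilde_pre_def)
  have "adm a b ?f t ?g" unfolding adm_def using assms(2,3) t k T by auto
  moreover have "k = pairing A (fst a) (fst b) (fst t) ?f ?g" using assms(2,3) t k by (simp add: sum_decomp)
  ultimately show thesis by (rule that[OF _ _ refl refl])
qed

lemma stepE:
  assumes "((t, k), (t', k')) \<in> tilde_step M a b" "a \<in> Ob M" "b \<in> Ob M"
  obtains f g h where "adm a b f t g" "k = pairing A (fst a) (fst b) (fst t) f g"
    "t' \<in> Ob M" "h \<in> Hom M t t'" "adm a b f t' (Cmp A (fst a) (fst t) (fst t') h g)"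
    "k' = pairing A (fst a) (fst b) (fst t') f (Cmp A (fst a) (fst t) (fst t') h g)"
proof -
  obtain h where h: "(t, k) \<in> tilde_pre M a b" "t' \<in> Ob M" "h \<in> Hom M t t'"
      "k' = Cmp M a (Tens M b t) (Tens M b t') (Tmor M b b t t' (Idn M b) h) k"
    using assms(1) unfolding tilde_step_def by blast
  obtain f g where f: "adm a b f t g" "k = pairing A (fst a) (fst b) (fst t) f g"
    using preE[OF h(1) assms(2,3)] by blast
  have "adm a b f t' (Cmp A (fst a) (fst t) (fst t') h g)"
    using admD[OF f(1)] h(2,3) Tmap_Cmp[of "fst a" "fst t" "fst t'" g h "snd t'"] by (simp add: adm_def)
  moreover have "k' = pairing A (fst a) (fst b) (fst t') f (Cmp A (fst a) (fst t) (fst t') h g)"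
    using admD[OF f(1)] h by (simp add: f(2))
  ultimately show thesis using that f h by blast
qed

lemma adm_step:
  assumes "adm a b f t g" "t' \<in> Ob M" "h \<in> Hom M t t'"
  shows "adm a b f t' (Cmp A (fst a) (fst t) (fst t') h g)"
  using admD[OF assms(1)] assms(2,3) Tmap_Cmp[of "fst a" "fst t" "fst t'" g h "snd t'"] by (simp add: adm_def)

lemma cls_step:
  assumes "adm a b f t g" "t' \<in> Ob M" "h \<in> Hom M t t'"
  shows "cls a b f t g = cls a b f t' (Cmp A (fst a) (fst t) (fst t') h g)"
  unfolding cls_def
proof (rule tilde_class_eq[OF adm_pre adm_pre])
  have "pairing A (fst a) (fst b) (fst t') f (Cmp A (fst a) (fst t) (fst t') h g) =
      Cmp M a (Tens M b t) (Tens M b t') (Tmor M b b t t' (Idn M b) h) (pairing A (fst a) (fst b) (fst t) f g)"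
    using admD[OF assms(1)] assms by simp
  then show "((t, pairing A (fst a) (fst b) (fst t) f g),
      t', pairing A (fst a) (fst b) (fst t') f (Cmp A (fst a) (fst t) (fst t') h g)) \<in> tilde_step M a b"
    unfolding tilde_step_def using adm_pre[OF assms(1)] assms(2,3) by blast
qed (use assms adm_step in auto)

lemma cls_in: "adm a b f t g \<Longrightarrow> cls a b f t g \<in> tilde_hom M a b"
  unfolding cls_def tilde_hom_def tilde_class_def by (rule quotientI) (rule adm_pre)

lemma tilde_homE:
  assumes "\<phi> \<in> tilde_hom M a b" "a \<in> Ob M" "b \<in> Ob M"
  obtains f t g where "adm a b f t g" "\<phi> = cls a b f t g"
proof -
  obtain t k where tk: "(t, k) \<in> tilde_pre M a b" "\<phi> = tilde_class M a b t k"
    using assms(1) unfolding tilde_hom_def tilde_class_def by (auto elim!: quotientE)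
  obtain f g where "adm a b f t g" "k = pairing A (fst a) (fst b) (fst t) f g"
    using preE[OF tk(1) assms(2,3)] by blast
  then show thesis using that[of f t g] tk(2) by (simp add: cls_def)
qed

lemma cls_member:
  assumes "adm a b f t g" "(t', k) \<in> cls a b f t g"
  obtains f' g' where "adm a b f' t' g'" "k = pairing A (fst a) (fst b) (fst t') f' g'"
    "cls a b f t g = cls a b f' t' g'"
proof -
  have *: "(t', k) \<in> tilde_pre M a b" "cls a b f t g = tilde_class M a b t' k"
    using in_tilde_classD[of t' k M a b t] assms(2) by (simp_all add: cls_def)
  obtain f' g' where "adm a b f' t' g'" "k = pairing A (fst a) (fst b) (fst t') f' g'"
    using preE[OF *(1) admD(1,2)[OF assms(1)]] by blast
  then show thesis using that[of f' g'] *(2) by (simp add: cls_def)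
qed

text \<open>A generating step leaves f alone and replaces g by h g; invariance under this
  replacement is all that has to be checked on a class.\<close>

lemma cls_invariant:
  assumes eq: "cls a b f t g = cls a b f' t' g'" and adm: "adm a b f t g" "adm a b f' t' g'"
    and step: "\<And>f t g t' h. \<lbrakk>adm a b f t g; t' \<in> Ob M; h \<in> Hom M t t';
        adm a b f t' (Cmp A (fst a) (fst t) (fst t') h g)\<rbrakk>
      \<Longrightarrow> Q f t g = Q f t' (Cmp A (fst a) (fst t) (fst t') h g)"
  shows "Q f t g = Q f' t' g'"
proof -
  let ?Q = "\<lambda>t k. Q (Cmp A (fst a) (Sum A (fst b) (fst t)) (fst b) (Pr1 A (fst b) (fst t)) k) t
     (Cmp A (fst a) (Sum A (fst b) (fst t)) (fst t) (Pr2 A (fst b) (fst t)) k)"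
  have m: "(t', pairing A (fst a) (fst b) (fst t') f' g') \<in>
      tilde_class M a b t (pairing A (fst a) (fst b) (fst t) f g)"
    using in_tilde_class[OF adm_pre[OF adm(2)]] eq unfolding cls_def by simp
  have "?Q t (pairing A (fst a) (fst b) (fst t) f g) = ?Q t' (pairing A (fst a) (fst b) (fst t') f' g')"
  proof (rule tilde_class_invariant[OF m, of ?Q], goal_cases)
    case (1 t k t' k')
    show ?case
    proof (rule stepE[OF 1 admD(1,2)[OF adm(1)]], goal_cases)
      case (1 f g h)
      then show ?case using step[of f t g t' h] by (simp add: admD)
    qed
  qed
  then show ?thesis using admD[OF adm(1)] admD[OF adm(2)] by simp
qed

lemma cls_fst_eq:
  assumes "cls a b f t g = cls a b f' t' g'" "adm a b f t g" "adm a b f' t' g'"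
  shows "f = f'"
  using cls_invariant[OF assms, of "\<lambda>f t g. f"] by simp

lemma adm_Cmp:
  assumes F: "adm a b f t g" and G: "adm b c f' u g'"
  shows "adm a c (Cmp A (fst a) (fst b) (fst c) f' f) (Tens M u t)
    (pairing A (fst a) (fst u) (fst t) (Cmp A (fst a) (fst b) (fst u) g' f) g)"
  unfolding adm_def using admD[OF F] admD[OF G] 
  by (simp add: Tmap_Cmp flip: T_assoc Tmap_add)

text \<open>\<open>tilde_cmp\<close> is a union over all pairs of representatives. It is a single
  class because changing a representative of either factor by a step changes the composite by a
  step.\<close>

lemma cls_Cmp:
  assumes F: "adm a b f t g" and G: "adm b c f' u g'"
  shows "tilde_cmp M a b c (cls b c f' u g') (cls a b f t g) =
    cls a c (Cmp A (fst a) (fst b) (fst c) f' f) (Tens M u t)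
      (pairing A (fst a) (fst u) (fst t) (Cmp A (fst a) (fst b) (fst u) g' f) g)"
    (is "_ = ?R")
proof -
  let ?Q = "\<lambda>f t g f' u g'. cls a c (Cmp A (fst a) (fst b) (fst c) f' f) (Tens M u t)
      (pairing A (fst a) (fst u) (fst t) (Cmp A (fst a) (fst b) (fst u) g' f) g)"
  let ?V = "\<lambda>t k u l. tilde_class M a c (Tens M u t)
       (Cmp M a (Tens M (Tens M c u) t) (Tens M c (Tens M u t)) (Asc M c u t)
         (Cmp M a (Tens M b t) (Tens M (Tens M c u) t) (Tmor M b (Tens M c u) t t l (Idn M t)) k))"
  have V: "?V t k u l = ?R" if tk: "(t, k) \<in> cls a b f t0 g" and ul: "(u, l) \<in> cls b c f' u0 g'"
    and F: "adm a b f t0 g" and G: "adm b c f' u0 g'"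
    and R: "?R = ?Q f t0 g f' u0 g'" for t k u l t0 u0
  proof -
    obtain f1 g1 where 1: "adm a b f1 t g1" "k = pairing A (fst a) (fst b) (fst t) f1 g1"
        "cls a b f t0 g = cls a b f1 t g1" using cls_member[OF F tk] by blast
    obtain f2 g2 where 2: "adm b c f2 u g2" "l = pairing A (fst b) (fst c) (fst u) f2 g2"
        "cls b c f' u0 g' = cls b c f2 u g2" using cls_member[OF G ul] by blast
    have "?V t k u l = ?Q f1 t g1 f2 u g2"
      using admD[OF 1(1)] admD[OF 2(1)] by (simp add: 1(2) 2(2) cls_def)
    also have "\<dots> = ?Q f1 t g1 f' u0 g'"
    proof (rule cls_invariant[OF 2(3) G 2(1), of "\<lambda>f' u g'. ?Q f1 t g1 f' u g'", symmetric], goal_cases)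
      case h: (1 f u g u' h)
      \<comment> \<open>A step h of the second arrow becomes the step h \<oplus> 1 of the
        composite.\<close>
      have tm: "Tmor M u u' t t h (Idn M t) \<in> Hom M (Tens M u t) (Tens M u' t)"
        using h admD[OF h(1)] admD[OF 1(1)] by (simp add: Tmap_Cmp) (simp add: herm_incl_def)
      then show ?case using cls_step[OF adm_Cmp[OF 1(1) h(1)] _ tm] h admD[OF h(1)] admD[OF 1(1)]
        by simp
    qed
    also have "\<dots> = ?Q f t0 g f' u0 g'"
    proof (rule cls_invariant[OF 1(3) F 1(1), of "\<lambda>f t g. ?Q f t g f' u0 g'", symmetric], goal_cases)
      case h: (1 f t g t' h)
      have tm: "Tmor M u0 u0 t t' (Idn M u0) h \<in> Hom M (Tens M u0 t) (Tens M u0 t')"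
        using h admD[OF h(1)] admD[OF G] by (simp add: Tmap_Cmp) (simp add: herm_incl_def)
      then show ?case using cls_step[OF adm_Cmp[OF h(1) G] _ tm] h admD[OF h(1)] admD[OF G]
        by simp
    qed
    finally show ?thesis using R by simp
  qed
  have "(t, pairing A (fst a) (fst b) (fst t) f g) \<in> cls a b f t g"
      "(u, pairing A (fst b) (fst c) (fst u) f' g') \<in> cls b c f' u g'"
    using F G by (simp_all add: cls_def in_tilde_class adm_pre)
  then show ?thesis unfolding tilde_cmp_def using V[OF _ _ F G refl] by fast
qed

lemma T_interchange:
  "\<lbrakk>x \<in> Ob A; p \<in> carrier (Tgrp T x); q \<in> carrier (Tgrp T x); r \<in> carrier (Tgrp T x); s \<in> carrier (Tgrp T x)\<rbrakk>
    \<Longrightarrow> (p \<otimes>\<^bsub>Tgrp T x\<^esub> q) \<otimes>\<^bsub>Tgrp T x\<^esub> (r \<otimes>\<^bsub>Tgrp T x\<^esub> s) =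
      (p \<otimes>\<^bsub>Tgrp T x\<^esub> r) \<otimes>\<^bsub>Tgrp T x\<^esub> (q \<otimes>\<^bsub>Tgrp T x\<^esub> s)"
  by (simp add: T_ac)

abbreviation (input) pmap :: "'ao \<Rightarrow> 'ao \<Rightarrow> 'ao \<Rightarrow> 'ao \<Rightarrow> 'am \<Rightarrow> 'am \<Rightarrow> 'am" where
  "pmap x y x' y' f g \<equiv> pairing A (Sum A x y) x' y'
     (Cmp A (Sum A x y) x x' f (Pr1 A x y)) (Cmp A (Sum A x y) y y' g (Pr2 A x y))"

lemma adm_Tmor:
  assumes F: "adm a b f t g" and G: "adm c d f' u g'"
  shows "adm (Tens M a c) (Tens M b d) (pmap (fst a) (fst c) (fst b) (fst d) f f')
    (Tens M t u) (pmap (fst a) (fst c) (fst t) (fst u) g g')"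
  unfolding adm_def using admD(1-5)[OF F] admD(1-5)[OF G]
  by (simp add: Tmap_Cmp T_interchange flip: Tmap_add) (simp add: herm_incl_def admD(6)[OF F] admD(6)[OF G])

lemma M_Asc_inverse:
  assumes "a \<in> Ob M" "b \<in> Ob M" "c \<in> Ob M"
  shows "inverse_of M (Tens M (Tens M a b) c) (Tens M a (Tens M b c)) (Asc M a b c) =
    pairing A (Sum A (fst a) (Sum A (fst b) (fst c))) (Sum A (fst a) (fst b)) (fst c)
      (pairing A (Sum A (fst a) (Sum A (fst b) (fst c))) (fst a) (fst b)
        (Pr1 A (fst a) (Sum A (fst b) (fst c)))
        (Cmp A (Sum A (fst a) (Sum A (fst b) (fst c))) (Sum A (fst b) (fst c)) (fst b)
          (Pr1 A (fst b) (fst c)) (Pr2 A (fst a) (Sum A (fst b) (fst c)))))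
      (Cmp A (Sum A (fst a) (Sum A (fst b) (fst c))) (Sum A (fst b) (fst c)) (fst c)
        (Pr2 A (fst b) (fst c)) (Pr2 A (fst a) (Sum A (fst b) (fst c))))"
  (is "_ = ?i")
proof (rule category.inverse_of_eq[OF category_M])
  have e: "pairing A (Sum A x y) x y (Pr1 A x y) (Pr2 A x y) = Idn A (Sum A x y)" if "x \<in> Ob A" "y \<in> Ob A" for x y
    using that sum_decomp[of "Sum A x y" x y "Idn A (Sum A x y)"] by simp
  have e': "pairing A z x y (Cmp A z (Sum A x y) x (Pr1 A x y) k) (Cmp A z (Sum A x y) y (Pr2 A x y) k) = k"
    if "z \<in> Ob A" "x \<in> Ob A" "y \<in> Ob A" "k \<in> Hom A z (Sum A x y)" for x y z k
    using that by (rule sum_decomp)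
  show "is_inverse M (Tens M (Tens M a b) c) (Tens M a (Tens M b c)) (Asc M a b c) ?i"
    unfolding is_inverse_def using assms
    by (simp add: e e' Tmap_Cmp) (simp add: herm_incl_def T_assoc flip: Tmap_Cmp)
qed (use assms in auto)

lemma mid_swap_eq:
  assumes "b \<in> Ob M" "t \<in> Ob M" "d \<in> Ob M" "u \<in> Ob M"
  shows "mid_swap M b t d u =
    (let x = Sum A (fst b) (fst t); y = Sum A (fst d) (fst u); s = Sum A x y in
      pairing A s (Sum A (fst b) (fst d)) (Sum A (fst t) (fst u))
        (pairing A s (fst b) (fst d) (Cmp A s x (fst b) (Pr1 A (fst b) (fst t)) (Pr1 A x y))
          (Cmp A s y (fst d) (Pr1 A (fst d) (fst u)) (Pr2 A x y)))
        (pairing A s (fst t) (fst u) (Cmp A s x (fst t) (Pr2 A (fst b) (fst t)) (Pr1 A x y))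
          (Cmp A s y (fst u) (Pr2 A (fst d) (fst u)) (Pr2 A x y))))"
  unfolding mid_swap_def Let_def by (simp only: M_Asc_inverse assms Tens_ob) (simp add: assms)

lemma cls_Tmor:
  assumes F: "adm a b f t g" and G: "adm c d f' u g'"
  shows "tilde_tmor M a b c d (cls a b f t g) (cls c d f' u g') =
    cls (Tens M a c) (Tens M b d) (pmap (fst a) (fst c) (fst b) (fst d) f f')
      (Tens M t u) (pmap (fst a) (fst c) (fst t) (fst u) g g')"
    (is "_ = ?R")
proof -
  let ?Q = "\<lambda>f t g f' u g'. cls (Tens M a c) (Tens M b d) (pmap (fst a) (fst c) (fst b) (fst d) f f')
      (Tens M t u) (pmap (fst a) (fst c) (fst t) (fst u) g g')"
  let ?V = "\<lambda>t k u l. tilde_class M (Tens M a c) (Tens M b d) (Tens M t u)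
       (Cmp M (Tens M a c) (Tens M (Tens M b t) (Tens M d u)) (Tens M (Tens M b d) (Tens M t u))
         (mid_swap M b t d u)
         (Tmor M a (Tens M b t) c (Tens M d u) k l))"
  have V: "?V t k u l = ?R" if tk: "(t, k) \<in> cls a b f t0 g" and ul: "(u, l) \<in> cls c d f' u0 g'"
    and F: "adm a b f t0 g" and G: "adm c d f' u0 g'"
    and R: "?R = ?Q f t0 g f' u0 g'" for t k u l t0 u0
  proof -
    obtain f1 g1 where 1: "adm a b f1 t g1" "k = pairing A (fst a) (fst b) (fst t) f1 g1"
        "cls a b f t0 g = cls a b f1 t g1" using cls_member[OF F tk] by blast
    obtain f2 g2 where 2: "adm c d f2 u g2" "l = pairing A (fst c) (fst d) (fst u) f2 g2"
        "cls c d f' u0 g' = cls c d f2 u g2" using cls_member[OF G ul] by blast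
    have "?V t k u l = ?Q f1 t g1 f2 u g2"
      using admD[OF 1(1)] admD[OF 2(1)] by (simp add: mid_swap_eq Let_def 1(2) 2(2) cls_def)
    also have "\<dots> = ?Q f1 t g1 f' u0 g'"
    proof (rule cls_invariant[OF 2(3) G 2(1), of "\<lambda>f' u g'. ?Q f1 t g1 f' u g'", symmetric], goal_cases)
      case h: (1 f u g u' h)
      have tm: "Tmor M t t u u' (Idn M t) h \<in> Hom M (Tens M t u) (Tens M t u')"
        using h admD[OF h(1)] admD[OF 1(1)] by (simp add: Tmap_Cmp) (simp add: herm_incl_def)
      then show ?case using cls_step[OF adm_Tmor[OF 1(1) h(1)] _ tm] h admD[OF h(1)] admD[OF 1(1)]
        by simp
    qed
    also have "\<dots> = ?Q f t0 g f' u0 g'"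
    proof (rule cls_invariant[OF 1(3) F 1(1), of "\<lambda>f t g. ?Q f t g f' u0 g'", symmetric], goal_cases)
      case h: (1 f t g t' h)
      have tm: "Tmor M t t' u0 u0 h (Idn M u0) \<in> Hom M (Tens M t u0) (Tens M t' u0)"
        using h admD[OF h(1)] admD[OF G] by (simp add: Tmap_Cmp) (simp add: herm_incl_def)
      then show ?case using cls_step[OF adm_Tmor[OF h(1) G] _ tm] h admD[OF h(1)] admD[OF G]
        by simp
    qed
    finally show ?thesis using R by simp
  qed
  have "(t, pairing A (fst a) (fst b) (fst t) f g) \<in> cls a b f t g"
      "(u, pairing A (fst c) (fst d) (fst u) f' g') \<in> cls c d f' u g'"
    using F G by (simp_all add: cls_def in_tilde_class adm_pre)
  then show ?thesis unfolding tilde_tmor_def using V[OF _ _ F G refl] by fast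
qed

section \<open>The category structure of \<open>tilde M\<close>\<close>

abbreviation Nt :: "('ao \<times> 't, (('ao \<times> 't) \<times> 'am) set) smcat" where "Nt \<equiv> tilde M"

lemma Nt_simps [simp]:
  "Ob Nt = Ob M" "Hom Nt = tilde_hom M" "Cmp Nt = tilde_cmp M" "Tens Nt = Tens M" "Tmor Nt = tilde_tmor M"
  "Unt Nt = Unt M" "Idn Nt a = tilde_unit M a a (Idn M a)"
  "Lun Nt a = tilde_unit M (Tens M (Unt M) a) a (Lun M a)"
  by (simp_all add: tilde_def)

lemma adm_zero: "\<lbrakk>a \<in> Ob M; b \<in> Ob M; t \<in> Ob M; f \<in> Hom A (fst a) (fst b); Tmap T (fst a) (fst b) f (snd b) = snd a\<rbrakk>
    \<Longrightarrow> adm a b f t (zero (fst a) (fst t))"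
  by (simp add: adm_def)

text \<open>The unit is initial in M, so 0 -> t is an isometry and hence a step. Zero remainders can
  therefore be moved to the unit, which is their normal form from here on.\<close>

lemma cls_zero:
  assumes "a \<in> Ob M" "b \<in> Ob M" "t \<in> Ob M" "f \<in> Hom A (fst a) (fst b)" "Tmap T (fst a) (fst b) f (snd b) = snd a"
  shows "cls a b f t (zero (fst a) (fst t)) = cls a b f (Unt M) (zero (fst a) (Zob A))"
proof -
  have "zero (Zob A) (fst t) \<in> Hom M (Unt M) t" using assms by simp
  from cls_step[OF adm_zero[OF assms(1,2) Unt_ob assms(4,5)] assms(3) this] show ?thesis using assms by simp
qed

lemma tilde_unit_eq:
  assumes "a \<in> Ob M" "b \<in> Ob M" "f \<in> Hom A (fst a) (fst b)" "Tmap T (fst a) (fst b) f (snd b) = snd a"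
  shows "tilde_unit M a b f = cls a b f (Unt M) (zero (fst a) (Zob A))"
proof -
  have z: "Pr2 A (fst b) (Zob A) = zero (Sum A (fst b) (Zob A)) (Zob A)" using assms by (intro to_Zob) auto
  have "Cmp A (Sum A (fst b) (Zob A)) (fst b) (Sum A (fst b) (Zob A)) (In1 A (fst b) (Zob A)) (Pr1 A (fst b) (Zob A)) =
      Idn A (Sum A (fst b) (Zob A))"
    by (rule pairing_eqI[of "Sum A (fst b) (Zob A)" "fst b" "Zob A"]) (use assms in \<open>auto simp: z\<close>)
  then have "inverse_of M (Tens M b (Unt M)) b (Run M b) = In1 A (fst b) (Zob A)"
    using assms by (intro category.inverse_of_eq[OF category_M]) (auto simp: is_inverse_def, simp add: herm_incl_def)
  moreover have "Cmp A (fst a) (fst b) (Sum A (fst b) (Zob A)) (In1 A (fst b) (Zob A)) f =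
      pairing A (fst a) (fst b) (Zob A) f (zero (fst a) (Zob A))"
    using assms by (simp add: pairing_def)
  ultimately show ?thesis unfolding tilde_unit_def cls_def using assms by simp
qed

lemma Nt_Idn [simp]: "a \<in> Ob M \<Longrightarrow> tilde_unit M a a (Idn A (fst a)) = cls a a (Idn A (fst a)) (Unt M) (zero (fst a) (Zob A))"
  by (rule tilde_unit_eq) auto

lemma adm_Idn: "a \<in> Ob M \<Longrightarrow> adm a a (Idn A (fst a)) (Unt M) (zero (fst a) (Zob A))"
  using adm_zero[of a a "Unt M"] by simp

lemma category_Nt: "category Nt"
proof (unfold_locales, goal_cases)
  case (1 a)
  then show ?case using cls_in[OF adm_Idn[of a]] by simp
next
  case (2 a b c \<phi> \<psi>)
  then obtain f t g f' t' g' where F: "adm a b f t g" "\<phi> = cls a b f t g"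
    and G: "adm b c f' t' g'" "\<psi> = cls b c f' t' g'"
    by (metis Nt_simps(1,2) tilde_homE)
  show ?case using cls_in[OF adm_Cmp[OF F(1) G(1)]] by (simp add: F(2) G(2) cls_Cmp[OF F(1) G(1)])
next
  case (3 a b \<phi>)
  then obtain f t g where F: "adm a b f t g" "\<phi> = cls a b f t g" by (auto elim: tilde_homE)
  \<comment> \<open>Composing with an identity enlarges the remainder object from t to t \<oplus> 0;
    the inclusion of t is a step that undoes this.\<close>
  have tm: "In1 A (fst t) (Zob A) \<in> Hom M t (Tens M t (Unt M))" using admD[OF F(1)] by simp
  show ?case using 3 admD[OF F(1)] cls_step[OF F(1) _ tm, symmetric]
    by (simp add: F(2) cls_Cmp[OF adm_Idn F(1)] pairing_def)
next
  case (4 a b \<phi>)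
  then obtain f t g where F: "adm a b f t g" "\<phi> = cls a b f t g" by (auto elim: tilde_homE)
  have tm: "In2 A (Zob A) (fst t) \<in> Hom M t (Tens M (Unt M) t)" using admD[OF F(1)] by simp
  show ?case using 4 admD[OF F(1)] cls_step[OF F(1) _ tm, symmetric]
    by (simp add: F(2) cls_Cmp[OF F(1) adm_Idn] pairing_def)
next
  case (5 a b c d \<phi> \<psi> \<chi>)
  then obtain f t g f' t' g' f'' t'' g'' where F: "adm a b f t g" "\<phi> = cls a b f t g"
    and G: "adm b c f' t' g'" "\<psi> = cls b c f' t' g'" and H: "adm c d f'' t'' g''" "\<chi> = cls c d f'' t'' g''"
    by (metis Nt_simps(1,2) tilde_homE)
  \<comment> \<open>Both bracketings have the same arrow of A; their remainder objects differ by the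
    associator, which is an isometry and hence a step.\<close>
  have tm: "Asc M t'' t' t \<in> Hom M (Tens M (Tens M t'' t') t) (Tens M t'' (Tens M t' t))"
    using admD[OF F(1)] admD[OF G(1)] admD[OF H(1)]
    by (simp add: Tmap_Cmp) (simp add: herm_incl_def T_assoc)
  show ?case
    using admD[OF F(1)] admD[OF G(1)] admD[OF H(1)] cls_step[OF adm_Cmp[OF F(1) adm_Cmp[OF G(1) H(1)]] _ tm]
    by (simp add: F(2) G(2) H(2) cls_Cmp[OF F(1) G(1)] cls_Cmp[OF G(1) H(1)]
      cls_Cmp[OF adm_Cmp[OF F(1) G(1)] H(1)] cls_Cmp[OF F(1) adm_Cmp[OF G(1) H(1)]])
qed

end

section \<open>Hyperbolic objects and the forgetful functor\<close>

context hermitian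
begin

lemma invertible_Idn: "x \<in> Ob A \<Longrightarrow> invertible A x x (Idn A x)"
  unfolding invertible_def is_inverse_def by (rule exI[of _ "Idn A x"]) simp

text \<open>The pullback of x along the first projection plus the evaluation pairing between X and D
  X. The usual hyperbolic object is the case x = 0; the extra summand makes the inclusion of X pull
  the form back to x, degenerate or not.\<close>

definition hyp :: "'ao \<Rightarrow> 't \<Rightarrow> 'ao \<times> 't" where
  "hyp X x = (let s = Sum A X (fobj D X) in
     (s, Tmap T s X (Pr1 A X (fobj D X)) x \<otimes>\<^bsub>Tgrp T s\<^esub>
       \<tau> s (Cmp A s (fobj D X) (fobj D s) (fmor D X s (Pr1 A X (fobj D X))) (Pr2 A X (fobj D X)))))"

lemma fst_hyp [simp]: "fst (hyp X x) = Sum A X (fobj D X)"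
  by (simp add: hyp_def Let_def)

lemma hyp_In1:
  assumes "X \<in> Ob A" "x \<in> carrier (Tgrp T X)"
  shows "Tmap T X (Sum A X (fobj D X)) (In1 A X (fobj D X)) (snd (hyp X x)) = x"
  using assms by (simp add: hyp_def Let_def flip: Tmap_Cmp)

text \<open>The matrix is (x, 1; \<epsilon> \<eta>, 0) with x standing for its bilinear form. The
  unit \<eta> of the duality appears because \<sigma> of the evaluation pairing is D(p2) \<eta> p1;
  so its invertibility is what makes the form nondegenerate.\<close>

lemma hyp_ob [simp]:
  assumes X: "X \<in> Ob A" "x \<in> carrier (Tgrp T X)"
  shows "hyp X x \<in> Ob M"
proof -
  let ?s = "Sum A X (fobj D X)" and ?D = "fobj D X"
  let ?l = "Cmp A ?s ?D (fobj D ?s) (fmor D X ?s (Pr1 A X ?D)) (Pr2 A X ?D)"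
  let ?\<eta> = "\<sigma> (fobj D X) X (Idn A (fobj D X))"
  have l: "\<sigma> ?s ?s ?l = Cmp A ?s (fobj D ?D) (fobj D ?s) (fmor D ?D ?s (Pr2 A X ?D))
      (Cmp A ?s X (fobj D ?D) ?\<eta> (Pr1 A X ?D))"
    using \<sigma>_natural[of ?D ?s X ?s "Pr2 A X ?D" "Pr1 A X ?D" "Idn A ?D"] X by simp
  have "invertible A ?s (fobj D ?s) (Cmp A ?s ?D (fobj D ?s) (fmor D X ?s (Pr1 A X ?D))
      (Cmp A ?s X ?D (Tform T X x) (Pr1 A X ?D) \<otimes>\<^bsub>Hgrp A ?s ?D\<^esub> Cmp A ?s ?D ?D (Idn A ?D) (Pr2 A X ?D))
     \<otimes>\<^bsub>Hgrp A ?s (fobj D ?s)\<^esub> Cmp A ?s (fobj D ?D) (fobj D ?s) (fmor D ?D ?s (Pr2 A X ?D))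
       (Cmp A ?s X (fobj D ?D) (eneg X (fobj D ?D) ?\<eta>) (Pr1 A X ?D)))"
    using X unit_invertible[of X] invertible_eneg[of X "fobj D ?D" ?\<eta>] invertible_Idn[of ?D]
    by (intro triangular_invertible[OF is_biproduct_Sum is_biproduct_D[OF is_biproduct_Sum]]) simp_all
  moreover have "Tform T ?s (snd (hyp X x)) = Cmp A ?s ?D (fobj D ?s) (fmor D X ?s (Pr1 A X ?D))
      (Cmp A ?s X ?D (Tform T X x) (Pr1 A X ?D) \<otimes>\<^bsub>Hgrp A ?s ?D\<^esub> Cmp A ?s ?D ?D (Idn A ?D) (Pr2 A X ?D))
     \<otimes>\<^bsub>Hgrp A ?s (fobj D ?s)\<^esub> Cmp A ?s (fobj D ?D) (fobj D ?s) (fmor D ?D ?s (Pr2 A X ?D))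
       (Cmp A ?s X (fobj D ?D) (eneg X (fobj D ?D) ?\<eta>) (Pr1 A X ?D))"
    using X by (simp add: hyp_def Let_def l add_assoc)
  moreover have "snd (hyp X x) \<in> carrier (Tgrp T ?s)" using X by (simp add: hyp_def Let_def)
  ultimately show ?thesis unfolding M_ob using X by simp
qed

section \<open>Shifts in A and in \<open>tilde M\<close>\<close>

abbreviation AS :: "('ao, 'am) smcat" where "AS \<equiv> dsum_smcat A"

lemma AS_simps [simp]:
  "Ob AS = Ob A" "Hom AS = Hom A" "Idn AS = Idn A" "Cmp AS = Cmp A" "Tens AS = Sum A" "Unt AS = Zob A"
  "Tmor AS a b c d f g = pairing A (Sum A a c) b d
        (Cmp A (Sum A a c) a b f (Pr1 A a c)) (Cmp A (Sum A a c) c d g (Pr2 A a c))"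
  "Run AS a = Pr1 A a (Zob A)" "Lun AS a = Pr2 A (Zob A) a"
  by (simp_all add: dsum_smcat_def)

lemma category_AS: "category AS"
  by unfold_locales auto

lemma the_elem_Zob [simp]:
  assumes "x \<in> Ob A"
  shows "the_elem (Hom A (Zob A) x) = zero (Zob A) x" "the_elem (Hom A x (Zob A)) = zero x (Zob A)"
proof -
  have "Hom A (Zob A) x = {(zero (Zob A) x)}" using from_Zob[OF assms] zero_in[OF Zob_in assms] by blast
  moreover have "Hom A x (Zob A) = {(zero x (Zob A))}" using to_Zob[OF assms] zero_in[OF assms Zob_in] by blast
  ultimately show "the_elem (Hom A (Zob A) x) = zero (Zob A) x" "the_elem (Hom A x (Zob A)) = zero x (Zob A)"
    by simp_all
qed

lemma pairing_Pr [simp]: "\<lbrakk>x \<in> Ob A; y \<in> Ob A\<rbrakk> \<Longrightarrow> pairing A (Sum A x y) x y (Pr1 A x y) (Pr2 A x y) = Idn A (Sum A x y)"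
  using sum_decomp[of "Sum A x y" x y "Idn A (Sum A x y)"] by simp

lemma pairing_zero [simp]: "\<lbrakk>x \<in> Ob A; a \<in> Ob A; b \<in> Ob A\<rbrakk>
    \<Longrightarrow> pairing A x a b (zero x a) (zero x b) = zero x (Sum A a b)"
  by (simp add: pairing_def)

lemma pairing_In2: "\<lbrakk>x \<in> Ob A; a \<in> Ob A; b \<in> Ob A; g \<in> Hom A x b\<rbrakk>
    \<Longrightarrow> pairing A x a b (zero x a) g = Cmp A x b (Sum A a b) (In2 A a b) g"
  by (simp add: pairing_def)

lemma pairing_In1: "\<lbrakk>x \<in> Ob A; a \<in> Ob A; b \<in> Ob A; g \<in> Hom A x a\<rbrakk>
    \<Longrightarrow> pairing A x a b g (zero x b) = Cmp A x a (Sum A a b) (In1 A a b) g"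
  by (simp add: pairing_def)

lemma shift_in_AS [simp]:
  assumes "x \<in> Ob A" "y \<in> Ob A"
  shows "shift_in AS x y = In2 A x y"
proof -
  have z: "Pr1 A (Zob A) y = (zero (Sum A (Zob A) y) (Zob A))" using assms by (intro to_Zob) auto
  have "Cmp A (Sum A (Zob A) y) y (Sum A (Zob A) y) (In2 A (Zob A) y) (Pr2 A (Zob A) y) = Idn A (Sum A (Zob A) y)"
    by (rule pairing_eqI[of "Sum A (Zob A) y" "Zob A" y]) (use assms in \<open>auto simp: z\<close>)
  then have "inverse_of A (Sum A (Zob A) y) y (Pr2 A (Zob A) y) = In2 A (Zob A) y"
    using assms by (intro inverse_of_eq) (auto simp: is_inverse_def)
  moreover have "inverse_of AS (Sum A (Zob A) y) y (Pr2 A (Zob A) y) = inverse_of A (Sum A (Zob A) y) y (Pr2 A (Zob A) y)"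
    by (simp add: inverse_of_def is_inverse_def)
  ultimately show ?thesis using assms by (simp add: shift_in_def pairing_In2)
qed

lemma shiftable_AS: "shiftable AS (Pr2 A)"
  by (rule shiftable.intro[OF category_AS]) (unfold_locales, auto simp: pairing_In2)

lemma cls_Unt:
  assumes F: "adm a b f t g"
  shows "cls a b f (Tens M (Unt M) t) (pairing A (fst a) (Zob A) (fst t) (zero (fst a) (Zob A)) g) = cls a b f t g"
    and "cls a b f (Tens M t (Unt M)) (pairing A (fst a) (fst t) (Zob A) g (zero (fst a) (Zob A))) = cls a b f t g"
proof -
  have 1: "In2 A (Zob A) (fst t) \<in> Hom M t (Tens M (Unt M) t)" "In1 A (fst t) (Zob A) \<in> Hom M t (Tens M t (Unt M))"
    using admD[OF F] by simp_all
  show "cls a b f (Tens M (Unt M) t) (pairing A (fst a) (Zob A) (fst t) (zero (fst a) (Zob A)) g) = cls a b f t g"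
    using cls_step[OF F _ 1(1), symmetric] admD[OF F] by (simp add: pairing_In2)
  show "cls a b f (Tens M t (Unt M)) (pairing A (fst a) (fst t) (Zob A) g (zero (fst a) (Zob A))) = cls a b f t g"
    using cls_step[OF F _ 1(2), symmetric] admD[OF F] by (simp add: pairing_In1)
qed

lemma adm_whisker:
  assumes x: "x \<in> Ob M" and F: "adm y z f t g"
  shows "adm (Tens M x y) (Tens M x z) (pmap (fst x) (fst y) (fst x) (fst z) (Idn A (fst x)) f)
      t (Cmp A (Sum A (fst x) (fst y)) (fst y) (fst t) g (Pr2 A (fst x) (fst y)))"
  unfolding adm_def using x admD(1-5)[OF F]
  by (simp add: Tmap_Cmp T_assoc flip: Tmap_add) (simp add: herm_incl_def admD(6)[OF F])

text \<open>Tensoring with an identity produces the remainder object 0 \<oplus> t. Normalising it to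
  t makes whiskering keep the remainder object.\<close>

lemma whisker_cls:
  assumes x: "x \<in> Ob M" and F: "adm y z f t g"
  shows "tilde_tmor M x x y z (cls x x (Idn A (fst x)) (Unt M) (zero (fst x) (Zob A))) (cls y z f t g) =
    cls (Tens M x y) (Tens M x z) (pmap (fst x) (fst y) (fst x) (fst z) (Idn A (fst x)) f)
      t (Cmp A (Sum A (fst x) (fst y)) (fst y) (fst t) g (Pr2 A (fst x) (fst y)))"
  using cls_Unt(1)[OF adm_whisker[OF x F]] x admD[OF F] by (simp add: cls_Tmor[OF adm_Idn F])

text \<open>The unit stays initial, since both components of an arrow out of it vanish; this
  evaluates the \<open>the_elem\<close> inside the shift map.\<close>

lemma Unt_hom: "x \<in> Ob M \<Longrightarrow> tilde_hom M (Unt M) x = {cls (Unt M) x (zero (Zob A) (fst x)) (Unt M) (zero (Zob A) (Zob A))}"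
proof -
  assume x: "x \<in> Ob M"
  have a: "adm (Unt M) x (zero (Zob A) (fst x)) (Unt M) (zero (Zob A) (Zob A))"
    using adm_zero[of "Unt M" x "Unt M" "(zero (Zob A) (fst x))"] x by simp
  have "\<phi> = cls (Unt M) x (zero (Zob A) (fst x)) (Unt M) (zero (Zob A) (Zob A))"
    if \<phi>: "\<phi> \<in> tilde_hom M (Unt M) x" for \<phi>
  proof -
    obtain f t g where F: "adm (Unt M) x f t g" "\<phi> = cls (Unt M) x f t g"
      by (rule tilde_homE[OF \<phi> Unt_ob x])
    have "f = zero (Zob A) (fst x)" "g = zero (Zob A) (fst t)"
      using admD[OF F(1)] from_Zob by auto
    then show ?thesis using F(2) cls_zero[of "Unt M" x t "(zero (Zob A) (fst x))"] admD[OF F(1)] by simp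
  qed
  then show ?thesis using cls_in[OF a] by blast
qed

lemma Nt_Lun_inverse:
  assumes y: "y \<in> Ob M"
  shows "inverse_of Nt (Tens M (Unt M) y) y (tilde_unit M (Tens M (Unt M) y) y (Pr2 A (Zob A) (fst y))) =
    cls y (Tens M (Unt M) y) (In2 A (Zob A) (fst y)) (Unt M) (zero (fst y) (Zob A))"
proof -
  let ?s = "Sum A (Zob A) (fst y)"
  have z: "Pr1 A (Zob A) (fst y) = zero ?s (Zob A)" using y by (intro to_Zob) auto
  have i: "Cmp A ?s (fst y) ?s (In2 A (Zob A) (fst y)) (Pr2 A (Zob A) (fst y)) = Idn A ?s"
    by (rule pairing_eqI[of ?s "Zob A" "fst y"]) (use y in \<open>auto simp: z\<close>)
  have T: "Tmap T ?s (fst y) (Pr2 A (Zob A) (fst y)) (snd y) = herm_incl A T (Zob A) (fst y) \<one>\<^bsub>Tgrp T (Zob A)\<^esub> (snd y)"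
    using y by (simp add: herm_incl_def)
  have u: "tilde_unit M (Tens M (Unt M) y) y (Pr2 A (Zob A) (fst y)) =
      cls (Tens M (Unt M) y) y (Pr2 A (Zob A) (fst y)) (Unt M) (zero ?s (Zob A))"
    using tilde_unit_eq[of "Tens M (Unt M) y" y "Pr2 A (Zob A) (fst y)"] y T by simp
  have 1: "adm (Tens M (Unt M) y) y (Pr2 A (Zob A) (fst y)) (Unt M) (zero ?s (Zob A))"
    using adm_zero[of "Tens M (Unt M) y" y "Unt M" "Pr2 A (Zob A) (fst y)"] y T by simp
  have 2: "adm y (Tens M (Unt M) y) (In2 A (Zob A) (fst y)) (Unt M) (zero (fst y) (Zob A))"
    using adm_zero[of y "Tens M (Unt M) y" "Unt M" "In2 A (Zob A) (fst y)"] y by simp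
  have "is_inverse Nt (Tens M (Unt M) y) y (tilde_unit M (Tens M (Unt M) y) y (Pr2 A (Zob A) (fst y)))
    (cls y (Tens M (Unt M) y) (In2 A (Zob A) (fst y)) (Unt M) (zero (fst y) (Zob A)))"
    unfolding is_inverse_def u
    using y cls_in[OF 1] cls_in[OF 2] cls_Cmp[OF 1 2] cls_Cmp[OF 2 1] Nt_Idn[of "Tens M (Unt M) y"] Nt_Idn[of y]
      cls_zero[of y y "Tens M (Unt M) (Unt M)" "Idn A (fst y)"]
      cls_zero[of "Tens M (Unt M) y" "Tens M (Unt M) y" "Tens M (Unt M) (Unt M)" "Idn A ?s"]
    by (simp add: i)
  then show ?thesis by (rule category.inverse_of_eq[OF category_Nt, rotated 2]) (use y in auto)
qed

lemma shift_in_Nt [simp]: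
  assumes "x \<in> Ob M" "y \<in> Ob M"
  shows "shift_in Nt x y = cls y (Tens M x y) (In2 A (fst x) (fst y)) (Unt M) (zero (fst y) (Zob A))"
proof -
  have 1: "adm (Unt M) x (zero (Zob A) (fst x)) (Unt M) (zero (Zob A) (Zob A))"
    using adm_zero[of "Unt M" x "Unt M" "(zero (Zob A) (fst x))"] assms by simp
  have 2: "adm y (Tens M (Unt M) y) (In2 A (Zob A) (fst y)) (Unt M) (zero (fst y) (Zob A))"
    using adm_zero[of y "Tens M (Unt M) y" "Unt M" "In2 A (Zob A) (fst y)"] assms by simp
  have e: "pairing A (fst y) (fst x) (fst y) (zero (fst y) (fst x)) (Idn A (fst y)) = In2 A (fst x) (fst y)"
    using assms by (simp add: pairing_In2)
  show ?thesis
    using assms cls_Cmp[OF 2 adm_Tmor[OF 1 adm_Idn[OF assms(2)]]]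
      cls_zero[of y "Tens M x y" "Tens M (Tens M (Unt M) (Unt M)) (Unt M)" "In2 A (fst x) (fst y)"]
    by (simp add: shift_in_def Unt_hom Nt_Lun_inverse cls_Tmor[OF 1 adm_Idn[OF assms(2)]] e)
qed

text \<open>The projection of x \<oplus> y onto y is rarely an isometry, but in
  \<open>tilde M\<close> it becomes an arrow with x itself as remainder object: the symmetry x
  \<oplus> y -> y \<oplus> x represents it.\<close>

definition pN :: "'ao \<times> 't \<Rightarrow> 'ao \<times> 't \<Rightarrow> (('ao \<times> 't) \<times> 'am) set" where
  "pN x y = cls (Tens M x y) y (Pr2 A (fst x) (fst y)) x (Pr1 A (fst x) (fst y))"

lemma adm_pN: "\<lbrakk>x \<in> Ob M; y \<in> Ob M\<rbrakk> \<Longrightarrow> adm (Tens M x y) y (Pr2 A (fst x) (fst y)) x (Pr1 A (fst x) (fst y))"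
  by (simp add: adm_def herm_incl_def T_comm)

lemma adm_shift_in: "\<lbrakk>x \<in> Ob M; y \<in> Ob M\<rbrakk> \<Longrightarrow> adm y (Tens M x y) (In2 A (fst x) (fst y)) (Unt M) (zero (fst y) (Zob A))"
  using adm_zero[of y "Tens M x y" "Unt M" "In2 A (fst x) (fst y)"] by simp

lemma cls_Sym:
  assumes F: "adm a b f (Tens M t u) k"
    and k: "k = pairing A (fst a) (fst t) (fst u) g h" "g \<in> Hom A (fst a) (fst t)" "h \<in> Hom A (fst a) (fst u)"
    and t: "t \<in> Ob M" "u \<in> Ob M"
  shows "cls a b f (Tens M t u) (pairing A (fst a) (fst t) (fst u) g h) =
    cls a b f (Tens M u t) (pairing A (fst a) (fst u) (fst t) h g)"
proof -
  have "Sym M t u \<in> Hom M (Tens M t u) (Tens M u t)"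
    using t by simp (simp add: herm_incl_def T_comm)
  from cls_step[OF F _ this] show ?thesis using t k admD[OF F] by simp
qed

lemma shiftable_Nt: "shiftable Nt pN"
proof (rule shiftable.intro[OF category_Nt], unfold_locales, goal_cases)
  case (1 x y)
  then show ?case by simp
next
  case (2 x y z \<phi>)
  then obtain f t g where F: "adm y z f t g" "\<phi> = cls y z f t g" by (auto elim: tilde_homE)
  show ?case using 2 cls_in[OF adm_whisker[OF _ F(1)]] by (simp add: F(2) whisker_cls[OF _ F(1)])
next
  case (3 x y)
  then show ?case
    using cls_zero[of "Tens M x y" "Tens M x y" "Unt M" "Idn A (Sum A (fst x) (fst y))"] Nt_Idn[of "Tens M x y"]
    by (simp add: whisker_cls[OF _ adm_Idn])
next
  case (4 x y z w \<phi> \<psi>)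
  then obtain f t g f' t' g' where F: "adm y z f t g" "\<phi> = cls y z f t g"
    and G: "adm z w f' t' g'" "\<psi> = cls z w f' t' g'" by (metis Nt_simps(1,2) tilde_homE)
  have x: "x \<in> Ob M" using 4 by simp
  show ?case using x admD[OF F(1)] admD[OF G(1)] cls_Cmp[OF adm_whisker[OF x F(1)] adm_whisker[OF x G(1)]]
    by (simp add: F(2) G(2) cls_Cmp[OF F(1) G(1)] whisker_cls[OF x F(1)] whisker_cls[OF x G(1)]
      whisker_cls[OF x adm_Cmp[OF F(1) G(1)]])
next
  case (5 x y)
  then show ?case using cls_in[OF adm_shift_in[of x y]] by simp
next
  case (6 x y z \<phi>)
  then obtain f t g where F: "adm y z f t g" "\<phi> = cls y z f t g" by (auto elim: tilde_homE)
  have x: "x \<in> Ob M" "y \<in> Ob M" "z \<in> Ob M" using 6 by simp_all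
  have e: "pairing A (fst y) (fst x) (fst z) (zero (fst y) (fst x)) f = Cmp A (fst y) (fst z) (Sum A (fst x) (fst z)) (In2 A (fst x) (fst z)) f"
    using x admD[OF F(1)] by (simp add: pairing_In2)
  have a: "adm y (Tens M x z) (Cmp A (fst y) (fst z) (Sum A (fst x) (fst z)) (In2 A (fst x) (fst z)) f) t g"
    unfolding adm_def using x admD[OF F(1)] by simp
  show ?case using x admD[OF F(1)] cls_Unt[OF a] cls_Cmp[OF adm_shift_in[OF x(1,2)] adm_whisker[OF x(1) F(1)]]
      cls_Cmp[OF F(1) adm_shift_in[OF x(1,3)]]
    by (simp add: F(2) whisker_cls[OF _ F(1)] e)
next
  case (7 x y)
  then show ?case using cls_in[OF adm_pN[of x y]] by (simp add: pN_def)
next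
  case (8 x y z \<phi>)
  then obtain f t g where F: "adm y z f t g" "\<phi> = cls y z f t g" by (auto elim: tilde_homE)
  have x: "x \<in> Ob M" "y \<in> Ob M" "z \<in> Ob M" using 8 by simp_all
  \<comment> \<open>The two composites carry the remainders x and t in opposite order, so the
    symmetry is a step between them.\<close>
  show ?case using x admD[OF F(1)] cls_Sym[OF adm_Cmp[OF adm_pN[OF x(1,2)] F(1)] refl]
      cls_Cmp[OF adm_whisker[OF x(1) F(1)] adm_pN[OF x(1,3)]] cls_Cmp[OF adm_pN[OF x(1,2)] F(1)]
    by (simp add: F(2) pN_def whisker_cls[OF _ F(1)])
next
  case (9 x y)
  then show ?case
    using cls_zero[of y y "Tens M x (Unt M)" "Idn A (fst y)"]
    by (simp add: pN_def cls_Cmp[OF adm_shift_in adm_pN])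
qed

section \<open>The extended forgetful functor\<close>

abbreviation \<Phi> :: "('ao \<times> 't, (('ao \<times> 't) \<times> 'am) set, 'ao, 'am) func" where "\<Phi> \<equiv> herm_forget_ext A D T"

lemma \<Phi>_obj [simp]: "a \<in> Ob M \<Longrightarrow> fobj \<Phi> a = fst a"
  by (simp add: herm_forget_ext_def tilde_ext_def herm_forget_def)

text \<open>\<open>tilde_ext\<close> takes \<open>the_elem\<close> of the set of values at all
  representatives. This set is a singleton because the component f is the same for each of
  them.\<close>

lemma \<Phi>_cls [simp]:
  assumes F: "adm a b f t g"
  shows "fmor \<Phi> a b (cls a b f t g) = f"
proof -
  let ?v = "\<lambda>(t, k). Cmp AS (fobj (herm_forget A D T) a)
      (Tens AS (fobj (herm_forget A D T) b) (fobj (herm_forget A D T) t)) (fobj (herm_forget A D T) b)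
          (Cmp AS (Tens AS (fobj (herm_forget A D T) b) (fobj (herm_forget A D T) t))
            (Tens AS (fobj (herm_forget A D T) b) (Unt AS)) (fobj (herm_forget A D T) b)
             (Run AS (fobj (herm_forget A D T) b))
             (Tmor AS (fobj (herm_forget A D T) b) (fobj (herm_forget A D T) b) (fobj (herm_forget A D T) t) (Unt AS)
                (Idn AS (fobj (herm_forget A D T) b))
                (the_elem (Hom AS (fobj (herm_forget A D T) t) (Unt AS)))))
          (fmor (herm_forget A D T) a (Tens M b t) k)"
  have v: "?v p = f" if p: "p \<in> cls a b f t g" for p
  proof -
    obtain t' k where p': "p = (t', k)" by fastforce
    then have m: "(t', k) \<in> cls a b f t g" using p by simp
    obtain f' g' where k: "adm a b f' t' g'" "k = pairing A (fst a) (fst b) (fst t') f' g'"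
        "cls a b f t g = cls a b f' t' g'" by (rule cls_member[OF F m])
    have "f' = f" using cls_fst_eq[OF k(3) F k(1)] by simp
    moreover have "k \<in> Hom M a (Tens M b t')" using adm_pre[OF k(1)] k(2) by (simp add: tilde_pre_def)
    ultimately show ?thesis using admD[OF k(1)] k(2) p' by (simp add: herm_forget_def)
  qed
  have "cls a b f t g \<noteq> {}" using in_tilde_class[OF adm_pre[OF F]] unfolding cls_def by blast
  then have "?v ` cls a b f t g = {f}" using v by (simp add: image_constant_conv cong: image_cong)
  then show ?thesis
    using admD[OF F] cls_in[OF F] unfolding herm_forget_ext_def tilde_ext_def by simp
qed

lemma \<Phi>_functor: "is_functor Nt AS \<Phi>"
proof -
  have \<Phi>: "mk_func Nt (fobj \<Phi>) (fmor \<Phi>) = \<Phi>"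
    unfolding herm_forget_ext_def tilde_ext_def by (rule mk_func_mk_func)
  have "is_functor Nt AS (mk_func Nt (fobj \<Phi>) (fmor \<Phi>))"
  proof (rule is_functor_mk_func[OF category_Nt], goal_cases)
    case (2 a b \<phi>)
    then obtain f t g where F: "adm a b f t g" "\<phi> = cls a b f t g" by (auto elim: tilde_homE)
    then show ?case using admD[OF F(1)] by simp
  next
    case (3 a)
    then show ?case using adm_Idn[of a] by simp
  next
    case (4 a b c \<phi> \<psi>)
    then obtain f t g f' t' g' where F: "adm a b f t g" "\<phi> = cls a b f t g"
      and G: "adm b c f' t' g'" "\<psi> = cls b c f' t' g'" by (metis Nt_simps(1,2) tilde_homE)
    show ?case using F G admD[OF F(1)] admD[OF G(1)] adm_Cmp[OF F(1) G(1)] by (simp add: cls_Cmp)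
  qed simp
  then show ?thesis unfolding \<Phi> .
qed

lemma shift_functor_\<Phi>:
  assumes "abelian_category B"
  shows "shift_functor Nt pN AS (Pr2 A) B \<Phi>"
proof -
  interpret N: shiftable Nt pN by (rule shiftable_Nt)
  interpret AS: shiftable AS "Pr2 A" by (rule shiftable_AS)
  \<comment> \<open>Every X is a retract, in A, of the underlying object of a hyperbolic one; this
    supplies both retraction axioms of \<open>shift_functor\<close>.\<close>
  have r: "\<exists>x\<in>Ob M. fst x = Sum A X (fobj D X)" if "X \<in> Ob A" for X
    using hyp_ob[OF that T_zero_in[OF that]] fst_hyp by blast
  show ?thesis
  proof (rule shift_functor.intro)
    show "shiftable_abelian Nt pN B" "shiftable_abelian AS (Pr2 A) B"
      using assms shiftable_Nt shiftable_AS by (auto intro: shiftable_abelian.intro)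
    show "shift_functor_axioms Nt pN AS (Pr2 A) \<Phi>"
    proof (unfold_locales, goal_cases)
      case 1
      show ?case by (rule \<Phi>_functor)
    next
      case (2 x y)
      then show ?case by simp
    next
      case (3 x y z \<phi>)
      then obtain f t g where F: "adm y z f t g" "\<phi> = cls y z f t g" by (auto elim: tilde_homE)
      have x: "x \<in> Ob M" using 3 by simp
      show ?case using x admD[OF F(1)] F(1) adm_whisker[OF x F(1)] by (simp add: F(2) whisker_cls[OF x F(1)])
    next
      case (4 x y)
      then show ?case using adm_shift_in[of x y] by simp
    next
      case (5 x y)
      then show ?case using adm_pN[of x y] by (simp add: pN_def)
    next
      case (6 X)
      then show ?case using r[of X] by simp (metis D_obj In1_in Pr1_In1 Pr1_in \<Phi>_obj)
    next
      case (7 X)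
      then obtain x where x: "x \<in> Ob M" "fst x = Sum A X (fobj D X)" using r[of X] by auto
      have X: "X \<in> Ob A" using 7 by simp
      show ?case
        by (rule bexI[of _ x], rule exI[of _ "\<lambda>Y. pmap X Y (fst x) Y (In1 A X (fobj D X)) (Idn A Y)"],
            rule exI[of _ "\<lambda>Y. pmap (fst x) Y X Y (Pr1 A X (fobj D X)) (Idn A Y)"])
          (use x X in \<open>simp_all add: AS.shift_retraction_def pairing_In2\<close>)
    qed
  qed
qed

end

section \<open>Polynomial functors do not see isotropic classes\<close>

context hermitian
begin

lemma snd_hyp_in [simp]: "\<lbrakk>X \<in> Ob A; x \<in> carrier (Tgrp T X)\<rbrakk>
    \<Longrightarrow> snd (hyp X x) \<in> carrier (Tgrp T (Sum A X (fobj D X)))"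
  using M_obD[OF hyp_ob[of X x]] by simp

lemma T_cancel:
  assumes "x \<in> Ob A" "u \<in> carrier (Tgrp T x)" "v \<in> carrier (Tgrp T x)" "w \<in> carrier (Tgrp T x)"
    and "u \<otimes>\<^bsub>Tgrp T x\<^esub> v = u \<otimes>\<^bsub>Tgrp T x\<^esub> w"
  shows "v = w"
proof -
  interpret comm_group "Tgrp T x" using assms(1) by (rule T_group)
  show ?thesis using assms(2-) by simp
qed

lemma invertible_neg: "\<lbrakk>x \<in> Ob A; y \<in> Ob A; invertible A x y a\<rbrakk> \<Longrightarrow> invertible A x y (inv\<^bsub>Hgrp A x y\<^esub> a)"
  unfolding invertible_def is_inverse_def
  by (elim exE conjE) (rule_tac x = "inv\<^bsub>Hgrp A y x\<^esub> g" in exI, simp)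

text \<open>The second component \<open>(t, g)\<close> of an arrow of \<open>tilde M\<close> is determined by the form it induces
  as soon as this form is nondegenerate, since then \<open>g\<close> is itself an arrow of hermitian objects.\<close>

lemma cls_unique_nondeg:
  assumes 1: "adm a b f t g" and 2: "adm a b f t' g'"
    and nd: "(fst a, Tmap T (fst a) (fst t) g (snd t)) \<in> Ob M"
  shows "cls a b f t g = cls a b f t' g'"
proof -
  let ?v = "Tmap T (fst a) (fst t) g (snd t)"
  have v: "Tmap T (fst a) (fst t') g' (snd t') = ?v"
    by (rule T_cancel[of "fst a" "Tmap T (fst a) (fst b) f (snd b)"]) (use admD[OF 1] admD[OF 2] in auto)
  have *: "adm a b f (fst a, ?v) (Idn A (fst a))" using nd admD[OF 1] by (simp add: adm_def)
  have 3: "g \<in> Hom M (fst a, ?v) t" "g' \<in> Hom M (fst a, ?v) t'" using admD[OF 1] admD[OF 2] v by auto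
  have "cls a b f (fst a, ?v) (Idn A (fst a)) = cls a b f t g"
    using cls_step[OF * _ 3(1)] admD[OF 1] by simp
  moreover have "cls a b f (fst a, ?v) (Idn A (fst a)) = cls a b f t' g'"
    using cls_step[OF * _ 3(2)] admD[OF 1] admD[OF 2] by simp
  ultimately show ?thesis by simp
qed

text \<open>The retraction is \<open>\<pi> = u\<^sup>-\<^sup>1 \<circ> D \<alpha> \<circ> x\<close>; the form \<open>x - \<pi>\<^sup>* u\<close> left over is pulled back from
  a hyperbolic extension along \<open>1 - \<alpha> \<circ> \<pi>\<close>, so no orthogonal complement of \<open>\<alpha>\<close> is needed.\<close>

lemma isometry_retraction:
  assumes a: "a \<in> Ob M" and c: "c \<in> Ob M" and \<alpha>: "\<alpha> \<in> Hom M a c"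
  shows "\<exists>\<rho>\<in>tilde_hom M c a.
    tilde_cmp M a c a \<rho> (cls a c \<alpha> (Unt M) (zero (fst a) (Zob A))) = tilde_unit M a a (Idn A (fst a))"
proof -
  obtain A0 u X x where [simp]: "a = (A0, u)" "c = (X, x)" by fastforce
  have [simp]: "A0 \<in> Ob A" "X \<in> Ob A" "u \<in> carrier (Tgrp T A0)" "x \<in> carrier (Tgrp T X)"
    using M_obD[OF a] M_obD[OF c] by simp_all
  have [simp]: "\<alpha> \<in> Hom A A0 X" and u: "Tmap T A0 X \<alpha> x = u" using \<alpha> by auto
  let ?u = "Tform T A0 u" and ?x = "Tform T X x"
  obtain v where v: "v \<in> Hom A (fobj D A0) A0" "Cmp A A0 (fobj D A0) A0 v ?u = Idn A A0"
    "Cmp A (fobj D A0) A0 (fobj D A0) ?u v = Idn A (fobj D A0)"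
    using M_nondeg[OF a] by (auto simp: invertible_def is_inverse_def)
  define \<pi> where "\<pi> = Cmp A X (fobj D A0) A0 v (Cmp A X (fobj D X) (fobj D A0) (fmor D X A0 \<alpha>) ?x)"
  have [simp]: "\<pi> \<in> Hom A X A0" using v by (simp add: \<pi>_def)
  have u': "Cmp A A0 (fobj D X) (fobj D A0) (fmor D X A0 \<alpha>) (Cmp A A0 X (fobj D X) ?x \<alpha>) = ?u"
    by (simp flip: u)
  have \<pi>\<alpha> [simp]: "Cmp A A0 X A0 \<pi> \<alpha> = Idn A A0" using v by (simp add: \<pi>_def u')
  have \<pi>\<alpha>' [simp]: "Cmp A Z X A0 \<pi> (Cmp A Z A0 X \<alpha> f) = f" if "Z \<in> Ob A" "f \<in> Hom A Z A0" for Z f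
    using that Cmp_cong_assoc[OF \<pi>\<alpha>, of Z f] by simp
  have u\<pi>: "Cmp A X A0 (fobj D A0) ?u \<pi> = Cmp A X (fobj D X) (fobj D A0) (fmor D X A0 \<alpha>) ?x"
    unfolding \<pi>_def using v Cmp_cong_assoc[OF v(3), of X "Cmp A X (fobj D X) (fobj D A0) (fmor D X A0 \<alpha>) ?x"] by simp
  \<comment> \<open>The adjoint of the preceding equation: \<sigma> is applied to both sides, and
    the forms u and x are \<epsilon>-symmetric.\<close>
  have "eneg A0 (fobj D X) (Cmp A A0 (fobj D A0) (fobj D X) (fmor D A0 X \<pi>) ?u) = eneg A0 (fobj D X) (Cmp A A0 X (fobj D X) ?x \<alpha>)"
    using arg_cong[OF u\<pi>, of "\<sigma> X A0"] sig_Cmp_right[of A0 A0 X \<pi> ?u] sig_Cmp_left[of X X A0 \<alpha> ?x] by simp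
  then have x\<alpha>: "Cmp A A0 X (fobj D X) ?x \<alpha> = Cmp A A0 (fobj D A0) (fobj D X) (fmor D A0 X \<pi>) ?u"
    using arg_cong[of _ _ "eneg A0 (fobj D X)"] by (metis (no_types, lifting) Cmp_in D_in D_obj Tform_in
      \<open>A0 \<in> Ob A\<close> \<open>X \<in> Ob A\<close> \<open>\<alpha> \<in> Hom A A0 X\<close> \<open>\<pi> \<in> Hom A X A0\<close> \<open>u \<in> carrier (Tgrp T A0)\<close> \<open>x \<in> carrier (Tgrp T X)\<close> eneg_eneg)
  define \<kappa> where "\<kappa> = Idn A X \<otimes>\<^bsub>Hgrp A X X\<^esub> inv\<^bsub>Hgrp A X X\<^esub> (Cmp A X A0 X \<alpha> \<pi>)"
  have [simp]: "\<kappa> \<in> Hom A X X" by (simp add: \<kappa>_def)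
  have \<kappa>\<alpha> [simp]: "Cmp A A0 X X \<kappa> \<alpha> = zero A0 X" by (simp add: \<kappa>_def)
  have \<pi>\<kappa> [simp]: "Cmp A X X A0 \<pi> \<kappa> = zero X A0" by (simp add: \<kappa>_def)
  have dec: "\<kappa> \<otimes>\<^bsub>Hgrp A X X\<^esub> Cmp A X A0 X \<alpha> \<pi> = Idn A X" by (simp add: \<kappa>_def add_assoc)
  \<comment> \<open>Since x \<alpha> = D \<pi> u, the cross term of \<kappa> and \<alpha> \<pi>
    contains D \<kappa> D \<pi> = D(\<pi> \<kappa>), which is 0.\<close>
  have cross: "Cmp A X (fobj D X) (fobj D X) (fmor D X X \<kappa>) (Cmp A X X (fobj D X) ?x (Cmp A X A0 X \<alpha> \<pi>)) = zero X (fobj D X)"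
  proof -
    have d: "Cmp A (fobj D A0) (fobj D X) (fobj D X) (fmor D X X \<kappa>) (fmor D A0 X \<pi>) = zero (fobj D A0) (fobj D X)"
      using D_Cmp[of X X A0 \<kappa> \<pi>] by simp
    have "Cmp A A0 (fobj D X) (fobj D X) (fmor D X X \<kappa>) (Cmp A A0 X (fobj D X) ?x \<alpha>) = zero A0 (fobj D X)"
      unfolding x\<alpha> using Cmp_cong_assoc[OF d, of A0 ?u] by simp
    from arg_cong[OF this, of "\<lambda>k. Cmp A X A0 (fobj D X) k \<pi>"] show ?thesis by simp
  qed
  \<comment> \<open>Without cross term, pulling x back along 1 = \<kappa> + \<alpha> \<pi> is
    additive, and \<alpha> pulls x back to u.\<close>
  have x: "Tmap T X X \<kappa> x \<otimes>\<^bsub>Tgrp T X\<^esub> Tmap T X A0 \<pi> u = x"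
    using Tmap_plus[of X X \<kappa> "Cmp A X A0 X \<alpha> \<pi>" x] by (simp add: dec cross Tmap_Cmp u)
  let ?w = "Tmap T X X \<kappa> x"
  have \<kappa>\<kappa>: "Cmp A X X X \<kappa> \<kappa> = \<kappa>" using arg_cong[OF \<pi>\<kappa>, of "Cmp A X A0 X \<alpha>"]
    by (subst \<kappa>_def) simp
  \<comment> \<open>The form w may be degenerate, hence the passage to \<open>hyp X w\<close>; as
    \<kappa> is idempotent, pulling w back along \<kappa> gives w again.\<close>
  let ?h = "Cmp A X X (Sum A X (fobj D X)) (In1 A X (fobj D X)) \<kappa>"
  have hw: "Tmap T X (Sum A X (fobj D X)) ?h (snd (hyp X ?w)) = ?w"
    using Tmap_Cmp[of X X "Sum A X (fobj D X)" \<kappa> "In1 A X (fobj D X)" "snd (hyp X ?w)"] Tmap_Cmp[of X X X \<kappa> \<kappa> x]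
      M_obD[OF hyp_ob[of X ?w]] by (simp add: hyp_In1 \<kappa>\<kappa>)
  have adm: "adm c a \<pi> (hyp X ?w) ?h"
    unfolding adm_def using a c x hw by (simp add: T_comm)
  have adm\<alpha>: "adm a c \<alpha> (Unt M) (zero (fst a) (Zob A))"
    using adm_zero[of a c "Unt M" \<alpha>] a c \<alpha> by simp
  have "tilde_cmp M a c a (cls c a \<pi> (hyp X ?w) ?h) (cls a c \<alpha> (Unt M) (zero (fst a) (Zob A))) =
      tilde_unit M a a (Idn A (fst a))"
    using cls_Cmp[OF adm\<alpha> adm] cls_zero[of a a "Tens M (hyp X ?w) (Unt M)" "Idn A A0"] a Nt_Idn[OF a] by simp
  then show ?thesis using cls_in[OF adm] by blast
qed

text \<open>On \<open>X \<oplus> X\<close> with the form \<open>diag (u, u)\<close>, the splitting into two nondegenerate forms is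
  \<open>diag (u, u) = (u, u; u, 0) + (0, -u; -u, u)\<close>.\<close>

lemma Tens_self_splits:
  assumes a: "a \<in> Ob M"
  shows "\<exists>q0 q1. (Sum A (fst a) (fst a), q0) \<in> Ob M \<and> (Sum A (fst a) (fst a), q1) \<in> Ob M \<and>
    q1 \<otimes>\<^bsub>Tgrp T (Sum A (fst a) (fst a))\<^esub> q0 = snd (Tens M a a)"
proof -
  obtain x u where [simp]: "a = (x, u)" by fastforce
  have [simp]: "x \<in> Ob A" "u \<in> carrier (Tgrp T x)" using M_obD[OF a] by simp_all
  let ?s = "Sum A x x" and ?u = "Tform T x u" and ?D = "fobj D x"
  have u: "invertible A x ?D ?u" using M_nondeg[OF a] by simp
  let ?l = "Cmp A ?s ?D (fobj D ?s) (fmor D x ?s (Pr1 A x x)) (Cmp A ?s x ?D ?u (Pr2 A x x))"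
  have l: "\<sigma> ?s ?s ?l = eneg ?s (fobj D ?s) (Cmp A ?s ?D (fobj D ?s) (fmor D x ?s (Pr2 A x x)) (Cmp A ?s x ?D ?u (Pr1 A x x)))"
    by (simp add: sig_conj)
  let ?q0 = "Tmap T ?s x (Pr1 A x x) u \<otimes>\<^bsub>Tgrp T ?s\<^esub> \<tau> ?s ?l"
  let ?q1 = "Tmap T ?s x (Pr2 A x x) u \<otimes>\<^bsub>Tgrp T ?s\<^esub> \<tau> ?s (inv\<^bsub>Hgrp A ?s (fobj D ?s)\<^esub> ?l)"
  have "invertible A ?s (fobj D ?s)
    (Cmp A ?s ?D (fobj D ?s) (fmor D x ?s (Pr1 A x x))
       (Cmp A ?s x ?D ?u (Pr1 A x x) \<otimes>\<^bsub>Hgrp A ?s ?D\<^esub> Cmp A ?s x ?D ?u (Pr2 A x x))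
     \<otimes>\<^bsub>Hgrp A ?s (fobj D ?s)\<^esub> Cmp A ?s ?D (fobj D ?s) (fmor D x ?s (Pr2 A x x)) (Cmp A ?s x ?D ?u (Pr1 A x x)))"
    using u by (intro triangular_invertible[OF is_biproduct_Sum is_biproduct_D[OF is_biproduct_Sum]]) simp_all
  then have 0: "(?s, ?q0) \<in> Ob M" unfolding M_ob by (simp add: l add_assoc)
  let ?n = "inv\<^bsub>Hgrp A x ?D\<^esub> ?u"
  \<comment> \<open>In \<open>?q1\<close> the zero entry is at the upper left, so the copies of x
    are exchanged in source and target to reach the triangular shape.\<close>
  have "invertible A ?s (fobj D ?s)
    (Cmp A ?s ?D (fobj D ?s) (fmor D x ?s (Pr2 A x x))
       (Cmp A ?s x ?D ?u (Pr2 A x x) \<otimes>\<^bsub>Hgrp A ?s ?D\<^esub> Cmp A ?s x ?D ?n (Pr1 A x x))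
     \<otimes>\<^bsub>Hgrp A ?s (fobj D ?s)\<^esub> Cmp A ?s ?D (fobj D ?s) (fmor D x ?s (Pr1 A x x)) (Cmp A ?s x ?D ?n (Pr2 A x x)))"
    using u invertible_neg[OF _ _ u] is_biproduct_swap[OF is_biproduct_Sum, of x x]
    by (intro triangular_invertible[OF _ is_biproduct_D]) simp_all
  moreover have "eneg ?s (fobj D ?s) (inv\<^bsub>Hgrp A ?s (fobj D ?s)\<^esub> k) = inv\<^bsub>Hgrp A ?s (fobj D ?s)\<^esub> (eneg ?s (fobj D ?s) k)"
    if "k \<in> Hom A ?s (fobj D ?s)" for k using that by (simp add: eneg_def)
  ultimately have 1: "(?s, ?q1) \<in> Ob M" unfolding M_ob by (simp add: l add_ac del: \<tau>_neg)
  have "?q1 \<otimes>\<^bsub>Tgrp T ?s\<^esub> ?q0 = snd (Tens M a a)"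
    using T_interchange[of ?s "Tmap T ?s x (Pr2 A x x) u" "\<tau> ?s (inv\<^bsub>Hgrp A ?s (fobj D ?s)\<^esub> ?l)" "Tmap T ?s x (Pr1 A x x) u" "\<tau> ?s ?l"]
    by (simp add: herm_incl_def) (simp add: T_comm)
  then show ?thesis using 0 1 by auto
qed

section \<open>The induction on the degree\<close>

context
  fixes B :: "('bo, 'bm, 'w) addcat_scheme"
  assumes B: "abelian_category B"
begin

interpretation B: abelian_category B by (rule B)
interpretation S: shift_functor Nt pN AS "Pr2 A" B \<Phi> by (rule shift_functor_\<Phi>[OF B])

lemma isotropic_trivial_step:
  assumes F: "F \<in> pol_below Nt B (Suc k)"
    and IH: "\<And>G a t m. \<lbrakk>G \<in> pol_below Nt B k; adm a a (Idn A (fst a)) t m\<rbrakk>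
      \<Longrightarrow> fmor G a a (cls a a (Idn A (fst a)) t m) = Idn B (fobj G a)"
    and b: "(x, q0) \<in> Ob M" "(x, q1) \<in> Ob M" and a: "(x, u) \<in> Ob M" and u: "q1 \<otimes>\<^bsub>Tgrp T x\<^esub> q0 = u"
    and \<mu>: "adm (x, u) (x, u) (Idn A x) t m"
  shows "fmor F (x, u) (x, u) (cls (x, u) (x, u) (Idn A x) t m) = Idn B (fobj F (x, u))"
proof -
  let ?a = "(x, u)" and ?b0 = "(x, q0)" and ?b1 = "(x, q1)"
  let ?d = "pairing A x x x (Idn A x) (Idn A x)"
  let ?c = "Tens M ?b1 ?b0"
  have [simp]: "x \<in> Ob A" "u \<in> carrier (Tgrp T x)" "q0 \<in> carrier (Tgrp T x)" "q1 \<in> carrier (Tgrp T x)"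
    using M_obD[OF a] M_obD[OF b(1)] M_obD[OF b(2)] by simp_all
  note [simp] = a b
  have t [simp]: "t \<in> Ob M" "m \<in> Hom A x (fst t)" and "u \<otimes>\<^bsub>Tgrp T x\<^esub> Tmap T x (fst t) m (snd t) = u"
    using admD[OF \<mu>] by simp_all
  \<comment> \<open>The first component is the identity, so it already accounts for all of u and the
    remainder has form 0. Hence (1, m) is an endomorphism of (x, q) for each nondegenerate
    q.\<close>
  then have m: "Tmap T x (fst t) m (snd t) = \<one>\<^bsub>Tgrp T x\<^esub>"
    using T_cancel[of x u "Tmap T x (fst t) m (snd t)" "\<one>\<^bsub>Tgrp T x\<^esub>"] by simp
  have Fun: "is_functor Nt B F" by (rule S.N.pol_below_functor[OF F])
  have Fo [simp]: "fobj F a \<in> Ob B" if "a \<in> Ob M" for a using is_functorD(2)[OF Fun] that by simp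
  have Fm [simp]: "fmor F a b \<phi> \<in> Hom B (fobj F a) (fobj F b)" if "a \<in> Ob M" "b \<in> Ob M" "\<phi> \<in> tilde_hom M a b" for a b \<phi>
    using is_functorD(3)[OF Fun] that by simp
  have Fc: "fmor F a c (tilde_cmp M a b c \<psi> \<phi>) = Cmp B (fobj F a) (fobj F b) (fobj F c) (fmor F b c \<psi>) (fmor F a b \<phi>)"
    if "a \<in> Ob M" "b \<in> Ob M" "c \<in> Ob M" "\<phi> \<in> tilde_hom M a b" "\<psi> \<in> tilde_hom M b c" for a b c \<phi> \<psi>
    using is_functorD(5)[OF Fun] that by simp
  let ?\<mu> = "cls ?a ?a (Idn A x) t m" and ?\<nu> = "cls ?b0 ?b0 (Idn A x) t m"
  let ?\<alpha> = "cls ?a ?c ?d (Unt M) (zero x (Zob A))"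
  have \<mu>0: "adm ?b0 ?b0 (Idn A x) t m" by (simp add: adm_def m)
  have \<alpha>: "adm ?a ?c ?d (Unt M) (zero x (Zob A))"
    using adm_zero[of ?a ?c "Unt M" ?d] u by simp
  let ?w = "cls ?c ?c (Idn A (Sum A x x)) t (Cmp A (Sum A x x) x (fst t) m (Pr2 A x x))"
  have w: "adm ?c ?c (Idn A (Sum A x x)) t (Cmp A (Sum A x x) x (fst t) m (Pr2 A x x))"
    and w_eq: "tilde_tmor M ?b1 ?b1 ?b0 ?b0 (tilde_unit M ?b1 ?b1 (Idn A x)) ?\<nu> = ?w"
    using adm_whisker[OF b(2) \<mu>0] whisker_cls[OF b(2) \<mu>0] Nt_Idn[OF b(2)] by simp_all
  have [simp]: "?w \<in> tilde_hom M ?c ?c" "?\<alpha> \<in> tilde_hom M ?a ?c" "?\<nu> \<in> tilde_hom M ?b0 ?b0" "?\<mu> \<in> tilde_hom M ?a ?a"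
    using cls_in[OF w] cls_in[OF \<alpha>] cls_in[OF \<mu>0] cls_in[OF \<mu>] by auto
  \<comment> \<open>Both composites have the underlying arrow \<open>?d\<close> and the remainder m,
    up to a unit summand on one side or the other.\<close>
  have w\<alpha>: "tilde_cmp M ?a ?c ?c ?w ?\<alpha> = tilde_cmp M ?a ?a ?c ?\<alpha> ?\<mu>"
  proof -
    have adm: "adm ?a ?c ?d t m" using u by (simp add: adm_def m)
    show ?thesis using cls_Cmp[OF \<alpha> w] cls_Cmp[OF \<mu> \<alpha>] cls_Unt[OF adm] by simp
  qed
  let ?p = "pN ?b1 ?b0" and ?i = "shift_in Nt ?b1 ?b0"
  have [simp]: "?p \<in> tilde_hom M ?c ?b0" "?i \<in> tilde_hom M ?b0 ?c" "S.N.ip ?b1 ?b0 \<in> tilde_hom M ?c ?c"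
    using S.N.p_in[of ?b1 ?b0] S.N.shift_in_in[of ?b1 ?b0] S.N.ip_in[of ?b1 ?b0] by (simp_all del: shift_in_Nt)
  have p\<alpha>_adm: "adm ?a ?b0 (Idn A x) (Tens M ?b1 (Unt M)) (pairing A x x (Zob A) (Idn A x) (zero x (Zob A)))"
    and p\<alpha>_eq: "tilde_cmp M ?a ?c ?b0 ?p ?\<alpha> = cls ?a ?b0 (Idn A x) (Tens M ?b1 (Unt M)) (pairing A x x (Zob A) (Idn A x) (zero x (Zob A)))"
    using adm_Cmp[OF \<alpha> adm_pN[of ?b1 ?b0]] cls_Cmp[OF \<alpha> adm_pN[of ?b1 ?b0]] by (simp_all add: pN_def)
  \<comment> \<open>The remainder of the projection of \<alpha> to (x, q0) has the form q1. This is
    nondegenerate, so \<open>?\<nu>\<close>, which adds a remainder of form 0, does not change the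
    class.\<close>
  have p\<alpha>: "tilde_cmp M ?a ?b0 ?b0 ?\<nu> (tilde_cmp M ?a ?c ?b0 ?p ?\<alpha>) = tilde_cmp M ?a ?c ?b0 ?p ?\<alpha>"
    using cls_unique_nondeg[OF p\<alpha>_adm] adm_Cmp[OF p\<alpha>_adm \<mu>0] cls_Cmp[OF p\<alpha>_adm \<mu>0] by (simp add: p\<alpha>_eq)
  obtain \<delta> q h where s: "S.N.split_cok B ?b1 F \<delta> q h" using S.N.split_cok_exists[OF Fun, of ?b1] by auto
  have \<delta>pol: "\<delta> \<in> pol_below Nt B k" by (rule S.N.pol_below_split_cok[OF F _ s]) simp
  then have \<delta>: "is_functor Nt B \<delta>" by (rule S.N.pol_below_functor)
  have q: "q \<in> nat_trans Nt B (shift_func Nt ?b1 F) \<delta>" and h: "h \<in> nat_trans Nt B \<delta> (shift_func Nt ?b1 F)"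
    and hq: "Cmp B (fobj F ?c) (fobj \<delta> ?b0) (fobj F ?c) (h ?b0) (q ?b0)
          \<otimes>\<^bsub>Hgrp B (fobj F ?c) (fobj F ?c)\<^esub> fmor F ?c ?c (S.N.ip ?b1 ?b0) = Idn B (fobj F ?c)"
    using s unfolding S.N.split_cok_def by auto
  have [simp]: "fobj \<delta> ?b0 \<in> Ob B" using is_functorD(2)[OF \<delta>] by simp
  have [simp]: "q ?b0 \<in> Hom B (fobj F ?c) (fobj \<delta> ?b0)" "h ?b0 \<in> Hom B (fobj \<delta> ?b0) (fobj F ?c)"
    using nat_transD(2)[OF q, of ?b0] nat_transD(2)[OF h, of ?b0] by simp_all
  \<comment> \<open>Naturality of q at \<open>?\<nu>\<close>, which \<delta> sends to the identity
    by the induction hypothesis.\<close>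
  have qw: "Cmp B (fobj F ?c) (fobj F ?c) (fobj \<delta> ?b0) (q ?b0) (fmor F ?c ?c ?w) = q ?b0"
    using nat_transD(3)[OF q, of ?b0 ?b0 ?\<nu>] IH[OF \<delta>pol, of ?b0 t m] \<mu>0
    by (simp add: w_eq)
  let ?k = "\<lambda>\<phi>. fmor F ?a ?c \<phi>"
  let ?z = "Cmp B (fobj F ?a) (fobj \<delta> ?b0) (fobj F ?c) (h ?b0) (Cmp B (fobj F ?a) (fobj F ?c) (fobj \<delta> ?b0) (q ?b0) (?k ?\<alpha>))"
  \<comment> \<open>F of an arrow into the sum is recovered from its part in the cokernel and its
    part along \<open>ip\<close>. For \<alpha> and for w \<alpha> the first parts agree by
    \<open>qw\<close>, the second ones by \<open>p\<alpha>\<close>.\<close>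
  have e: "?k \<phi> = Cmp B (fobj F ?a) (fobj \<delta> ?b0) (fobj F ?c) (h ?b0) (Cmp B (fobj F ?a) (fobj F ?c) (fobj \<delta> ?b0) (q ?b0) (?k \<phi>))
      \<otimes>\<^bsub>Hgrp B (fobj F ?a) (fobj F ?c)\<^esub> ?k (tilde_cmp M ?a ?c ?c (S.N.ip ?b1 ?b0) \<phi>)"
    if "\<phi> \<in> tilde_hom M ?a ?c" for \<phi>
  proof -
    have "?k \<phi> = Cmp B (fobj F ?a) (fobj F ?c) (fobj F ?c) (Idn B (fobj F ?c)) (?k \<phi>)" using that by simp
    then show ?thesis using that by (simp add: Fc flip: hq)
  qed
  have w\<alpha>_in: "tilde_cmp M ?a ?c ?c ?w ?\<alpha> \<in> tilde_hom M ?a ?c"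
    using category.Cmp_in[OF category_Nt, of ?a ?c ?c ?\<alpha> ?w] by simp
  have "tilde_cmp M ?a ?c ?c (S.N.ip ?b1 ?b0) (tilde_cmp M ?a ?c ?c ?w ?\<alpha>) =
      tilde_cmp M ?a ?c ?c (S.N.ip ?b1 ?b0) ?\<alpha>"
  proof -
    note as = S.N.Cmp_assoc[unfolded Nt_simps]
    have in': "tilde_cmp M ?a ?c ?b0 ?p ?\<alpha> \<in> tilde_hom M ?a ?b0"
      using S.N.Cmp_in[of ?a ?c ?b0 ?\<alpha> ?p] by simp
    have "tilde_cmp M ?a ?c ?b0 ?p (tilde_cmp M ?a ?c ?c ?w ?\<alpha>) = tilde_cmp M ?a ?c ?b0 ?p ?\<alpha>"
      using S.N.p_nat[of ?b1 ?b0 ?b0 ?\<nu>] w_eq p\<alpha> as[of ?a ?c ?c ?b0 ?\<alpha> ?w ?p] as[of ?a ?c ?b0 ?b0 ?\<alpha> ?p ?\<nu>]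
      by simp
    then show ?thesis
      using as[of ?a ?c ?b0 ?c ?\<alpha> ?p ?i] as[of ?a ?c ?b0 ?c "tilde_cmp M ?a ?c ?c ?w ?\<alpha>" ?p ?i] w\<alpha>_in
      by (simp add: S.N.ip_def del: shift_in_Nt)
  qed
  then have "?k (tilde_cmp M ?a ?c ?c ?w ?\<alpha>) = ?k ?\<alpha>"
    using e[OF w\<alpha>_in] e[of ?\<alpha>] B.Cmp_cong_assoc[OF qw, of "fobj F ?a" "?k ?\<alpha>"] by (simp add: Fc)
  then have \<alpha>\<mu>: "Cmp B (fobj F ?a) (fobj F ?a) (fobj F ?c) (?k ?\<alpha>) (fmor F ?a ?a ?\<mu>) = ?k ?\<alpha>"
    unfolding w\<alpha> by (simp add: Fc)
  obtain \<rho> where \<rho>: "\<rho> \<in> tilde_hom M ?c ?a" "tilde_cmp M ?a ?c ?a \<rho> ?\<alpha> = tilde_unit M ?a ?a (Idn A x)"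
    using isometry_retraction[of ?a ?c ?d] u by auto
  have r\<alpha>: "Cmp B (fobj F ?a) (fobj F ?c) (fobj F ?a) (fmor F ?c ?a \<rho>) (?k ?\<alpha>) = Idn B (fobj F ?a)"
    using \<rho> is_functorD(4)[OF Fun, of ?a] by (simp flip: Fc)
  show ?thesis
    using B.Cmp_cong_assoc[OF r\<alpha>, of "fobj F ?a" "fmor F ?a ?a ?\<mu>"] \<alpha>\<mu> r\<alpha> \<rho>(1) by simp
qed

lemma isotropic_trivial:
  assumes "F \<in> pol_below Nt B k" "adm a a (Idn A (fst a)) t m"
  shows "fmor F a a (cls a a (Idn A (fst a)) t m) = Idn B (fobj F a)"
  using assms
proof (induction k arbitrary: F a t m)
  case 0
  have F: "is_functor Nt B F" "is_null B (fobj F a)"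
    using 0(1) B.Fct_null_iff[OF category_Nt] admD(1)[OF 0(2)] by auto
  have "fmor F a a (cls a a (Idn A (fst a)) t m) \<in> Hom B (fobj F a) (fobj F a)"
    using is_functorD(3)[OF F(1)] cls_in[OF 0(2)] admD(1)[OF 0(2)] by simp
  then show ?case using B.null_from[OF F(2) B.null_in[OF F(2)]] B.Idn_in[OF B.null_in[OF F(2)]] by metis
next
  case (Suc k)
  have a [simp]: "a \<in> Ob M" using admD(1)[OF Suc.prems(2)] .
  have Fun: "is_functor Nt B F" by (rule S.N.pol_below_functor[OF Suc.prems(1)])
  let ?\<mu> = "cls a a (Idn A (fst a)) t m" and ?c = "Tens M a a"
  obtain q0 q1 where q: "(Sum A (fst a) (fst a), q0) \<in> Ob M" "(Sum A (fst a) (fst a), q1) \<in> Ob M"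
    "q1 \<otimes>\<^bsub>Tgrp T (Sum A (fst a) (fst a))\<^esub> q0 = snd ?c" using Tens_self_splits[OF a] by blast
  have c: "(Sum A (fst a) (fst a), snd ?c) = ?c" by (simp add: prod_eq_iff)
  have c': "(Sum A (fst a) (fst a), snd ?c) \<in> Ob M" unfolding c by simp
  let ?w = "cls ?c ?c (Idn A (Sum A (fst a) (fst a))) t (Cmp A (Sum A (fst a) (fst a)) (fst a) (fst t) m (Pr2 A (fst a) (fst a)))"
  have w: "adm ?c ?c (Idn A (Sum A (fst a) (fst a))) t (Cmp A (Sum A (fst a) (fst a)) (fst a) (fst t) m (Pr2 A (fst a) (fst a)))"
    and w_eq: "tilde_tmor M a a a a (tilde_unit M a a (Idn A (fst a))) ?\<mu> = ?w"
    using adm_whisker[OF a Suc.prems(2)] whisker_cls[OF a Suc.prems(2)] by simp_all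
  have Fw: "fmor F ?c ?c ?w = Idn B (fobj F ?c)"
    using isotropic_trivial_step[OF Suc.prems(1) Suc.IH q(1,2) c' q(3), unfolded c, OF _ _ w] by blast
  let ?p = "pN a a" and ?i = "shift_in Nt a a"
  have [simp]: "?p \<in> tilde_hom M ?c a" "?i \<in> tilde_hom M a ?c" "?\<mu> \<in> tilde_hom M a a" "?w \<in> tilde_hom M ?c ?c"
    using S.N.p_in[of a a] S.N.shift_in_in[of a a] cls_in[OF Suc.prems(2)] cls_in[OF w] by (simp_all del: shift_in_Nt)
  have "tilde_cmp M a ?c ?c ?w ?i = tilde_cmp M a a ?c ?i ?\<mu>"
    using S.N.shift_in_nat[of a a a ?\<mu>] w_eq by (simp del: shift_in_Nt)
  moreover have "tilde_cmp M a ?c a ?p (tilde_cmp M a a ?c ?i ?\<mu>) = ?\<mu>"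
    using S.N.Cmp_cong_assoc[OF S.N.p_shift_in, of a a a ?\<mu>] S.N.Cmp_Idn_left[of a a ?\<mu>] by (simp del: shift_in_Nt Nt_Idn S.N.Cmp_Idn_left)
  \<comment> \<open>\<mu> is 1 \<oplus> \<mu> on a \<oplus> a, cut down by the inclusion and the
    projection. The step lemma applies to the latter object, whose form splits.\<close>
  ultimately have \<mu>: "?\<mu> = tilde_cmp M a ?c a ?p (tilde_cmp M a ?c ?c ?w ?i)" by simp
  have Fc: "fmor F a c (tilde_cmp M a b c \<psi> \<phi>) = Cmp B (fobj F a) (fobj F b) (fobj F c) (fmor F b c \<psi>) (fmor F a b \<phi>)"
    if "a \<in> Ob M" "b \<in> Ob M" "c \<in> Ob M" "\<phi> \<in> tilde_hom M a b" "\<psi> \<in> tilde_hom M b c" for a b c \<phi> \<psi>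
    using is_functorD(5)[OF Fun] that by simp
  have in': "tilde_cmp M a ?c ?c ?w ?i \<in> tilde_hom M a ?c"
    using category.Cmp_in[OF category_Nt, of a ?c ?c ?i ?w] by (simp del: shift_in_Nt)
  have o: "fobj F a \<in> Ob B" "fobj F ?c \<in> Ob B" "fmor F a ?c ?i \<in> Hom B (fobj F a) (fobj F ?c)"
    using is_functorD(2,3)[OF Fun] by (simp_all del: shift_in_Nt)
  have "fmor F a a ?\<mu> = Cmp B (fobj F a) (fobj F ?c) (fobj F a) (fmor F ?c a ?p) (fmor F a ?c ?i)"
    by (subst \<mu>) (use o in' Fw in \<open>simp add: Fc del: shift_in_Nt\<close>)
  also have "\<dots> = fmor F a a (tilde_cmp M a ?c a ?p ?i)" by (simp add: Fc del: shift_in_Nt)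
  also have "\<dots> = Idn B (fobj F a)"
    using S.N.p_shift_in[of a a] is_functorD(4)[OF Fun, of a] by (simp del: shift_in_Nt Nt_Idn S.N.p_shift_in)
  finally show ?case .
qed

lemma pol_factors:
  assumes F: "F \<in> pol_below Nt B k" and ab: "a \<in> Ob M" "b \<in> Ob M"
    and \<phi>: "\<phi> \<in> tilde_hom M a b" and \<psi>: "\<psi> \<in> tilde_hom M a b" and eq: "fmor \<Phi> a b \<phi> = fmor \<Phi> a b \<psi>"
  shows "fmor F a b \<phi> = fmor F a b \<psi>"
proof -
  have Fun: "is_functor Nt B F" by (rule S.N.pol_below_functor[OF F])
  obtain f t g where 1: "adm a b f t g" "\<phi> = cls a b f t g" by (rule tilde_homE[OF \<phi> ab])
  obtain f' t' g' where \<psi>': "adm a b f' t' g'" "\<psi> = cls a b f' t' g'" by (rule tilde_homE[OF \<psi> ab])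
  then have 2: "adm a b f t' g'" "\<psi> = cls a b f t' g'" using eq 1 by auto
  let ?x = "fst a" and ?v = "Tmap T (fst a) (fst t) g (snd t)"
  have v: "Tmap T ?x (fst t') g' (snd t') = ?v"
    by (rule T_cancel[of ?x "Tmap T ?x (fst b) f (snd b)"]) (use admD[OF 1(1)] admD[OF 2(1)] in auto)
  \<comment> \<open>An object into which a's underlying object maps with induced form -v. Added to
    the remainder of either arrow, whose form is v, it yields a remainder of form 0.\<close>
  let ?c = "hyp ?x (inv\<^bsub>Tgrp T ?x\<^esub> ?v)" and ?i = "In1 A ?x (fobj D ?x)"
  let ?s = "Sum A ?x (fobj D ?x)"
  note [simp] = admD(1-5)[OF 1(1)] admD(1-5)[OF 2(1)]
  have m1: "adm a a (Idn A ?x) (Tens M ?c t') (pairing A ?x ?s (fst t') ?i g')"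
    and m2: "adm a a (Idn A ?x) (Tens M ?c t) (pairing A ?x ?s (fst t) ?i g)"
    unfolding adm_def by (simp_all add: hyp_In1 v)
  \<comment> \<open>The permutation taking the remainder object t \<oplus> (c \<oplus> t') of one
    composite to t' \<oplus> (c \<oplus> t) of the other; it is an isometry and hence a
    step.\<close>
  let ?h = "pairing A (Sum A (fst t) (Sum A ?s (fst t'))) (fst t') (Sum A ?s (fst t))
    (Cmp A (Sum A (fst t) (Sum A ?s (fst t'))) (Sum A ?s (fst t')) (fst t') (Pr2 A ?s (fst t')) (Pr2 A (fst t) (Sum A ?s (fst t'))))
    (pairing A (Sum A (fst t) (Sum A ?s (fst t'))) ?s (fst t)
      (Cmp A (Sum A (fst t) (Sum A ?s (fst t'))) (Sum A ?s (fst t')) ?s (Pr1 A ?s (fst t')) (Pr2 A (fst t) (Sum A ?s (fst t'))))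
      (Pr1 A (fst t) (Sum A ?s (fst t'))))"
  have h: "?h \<in> Hom M (Tens M t (Tens M ?c t')) (Tens M t' (Tens M ?c t))"
    by (simp add: Tmap_Cmp) (simp add: herm_incl_def T_ac)
  have "tilde_cmp M a a b \<phi> (cls a a (Idn A ?x) (Tens M ?c t') (pairing A ?x ?s (fst t') ?i g')) =
      tilde_cmp M a a b \<psi> (cls a a (Idn A ?x) (Tens M ?c t) (pairing A ?x ?s (fst t) ?i g))"
    using cls_step[OF adm_Cmp[OF m1 1(1)] _ h] by (simp add: 1(2) 2(2) cls_Cmp[OF m1 1(1)] cls_Cmp[OF m2 2(1)])
  then have "Cmp B (fobj F a) (fobj F a) (fobj F b) (fmor F a b \<phi>) (Idn B (fobj F a)) =
      Cmp B (fobj F a) (fobj F a) (fobj F b) (fmor F a b \<psi>) (Idn B (fobj F a))"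
    using is_functorD(5)[OF Fun, of a a b] cls_in[OF m1] cls_in[OF m2] \<phi> \<psi>
      isotropic_trivial[OF F m1] isotropic_trivial[OF F m2] by (metis Nt_simps(1,2,3) ab)
  then show ?thesis using \<phi> \<psi> is_functorD(2,3)[OF Fun] by simp
qed

end

lemma \<Phi>_full:
  assumes "a \<in> Ob M" "b \<in> Ob M" "f \<in> Hom A (fst a) (fst b)"
  shows "\<exists>\<phi>\<in>tilde_hom M a b. fmor \<Phi> a b \<phi> = f"
proof -
  \<comment> \<open>The defect of f from being an isometry; the hyperbolic extension absorbs it as a
    remainder.\<close>
  let ?w = "snd a \<otimes>\<^bsub>Tgrp T (fst a)\<^esub> inv\<^bsub>Tgrp T (fst a)\<^esub> (Tmap T (fst a) (fst b) f (snd b))"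
  have "adm a b f (hyp (fst a) ?w) (In1 A (fst a) (fobj D (fst a)))"
    unfolding adm_def using assms by (simp add: hyp_In1 T_lcomm)
  then show ?thesis using cls_in \<Phi>_cls by blast
qed

end

section \<open>The functors \<open>SD\<^sup>2\<^sub>\<epsilon>\<close> and \<open>\<bar>SD\<^sup>2\<^sub>\<epsilon>\<close>\<close>

locale eps_tensor_group = G: comm_group G for G :: "('m, 'z) monoid_scheme" (structure) +
  fixes s :: "'m \<Rightarrow> 'm" and \<epsilon> :: int
  assumes s_in [simp]: "x \<in> carrier G \<Longrightarrow> s x \<in> carrier G"
begin

abbreviation "Fr \<equiv> eps_tensor_free G"
abbreviation "R \<equiv> generate Fr (eps_tensor_rels \<epsilon> G s)"
abbreviation "E \<equiv> eps_tensor \<epsilon> G s"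

lemma Fr_comm: "comm_group Fr"
  by (simp add: eps_tensor_free_def abelian_free_Abelian_group)

lemma Fr_simps [simp]:
  "c \<in> carrier Fr \<longleftrightarrow> Poly_Mapping.keys c \<subseteq> UNIV \<times> carrier G"
  "\<one>\<^bsub>Fr\<^esub> = 0" "a \<otimes>\<^bsub>Fr\<^esub> b = a + b"
  "Poly_Mapping.keys c \<subseteq> UNIV \<times> carrier G \<Longrightarrow> inv\<^bsub>Fr\<^esub> c = - c"
  by (simp_all add: eps_tensor_free_def)

lemma keys_diff_le [simp]: "\<lbrakk>Poly_Mapping.keys a \<subseteq> S; Poly_Mapping.keys b \<subseteq> S\<rbrakk> \<Longrightarrow> Poly_Mapping.keys (a - b) \<subseteq> S"
  using keys_diff by fastforce

lemma rels_in: "eps_tensor_rels \<epsilon> G s \<subseteq> carrier Fr"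
  by (auto simp: eps_tensor_rels_def simp del: Fr_simps(1)) (simp_all only: Fr_simps(1), simp_all)

lemma R_subgroup: "subgroup R Fr"
  using Fr_comm rels_in by (simp add: comm_group.axioms(2) group.generate_is_subgroup)

lemma R_normal: "R \<lhd> Fr"
  using Fr_comm R_subgroup comm_group.subgroup_imp_normal by blast

lemma E_comm: "comm_group E"
  unfolding eps_tensor_def by (rule comm_group.abelian_FactGroup[OF Fr_comm R_subgroup])

lemma coset_eqI:
  assumes "b \<in> carrier Fr" "a - b \<in> R"
  shows "R #>\<^bsub>Fr\<^esub> a = R #>\<^bsub>Fr\<^esub> b"
proof (rule sym, rule group.repr_independence[OF comm_group.axioms(2)[OF Fr_comm] _ assms(1) R_subgroup])
  show "a \<in> R #>\<^bsub>Fr\<^esub> b" unfolding r_coset_def using assms(2) by (auto intro!: bexI[of _ "a - b"])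
qed

lemma coset_add:
  assumes "a \<in> carrier Fr" "b \<in> carrier Fr"
  shows "(R #>\<^bsub>Fr\<^esub> a) \<otimes>\<^bsub>E\<^esub> (R #>\<^bsub>Fr\<^esub> b) = R #>\<^bsub>Fr\<^esub> (a + b)"
  using normal.rcos_sum[OF R_normal assms] by (simp add: eps_tensor_def)

lemma E_elem: "X \<in> carrier E \<longleftrightarrow> (\<exists>c\<in>carrier Fr. X = R #>\<^bsub>Fr\<^esub> c)"
  by (auto simp: eps_tensor_def carrier_FactGroup simp del: Fr_simps(1))

lemma pure_in [simp]: "x \<in> carrier G \<Longrightarrow> pure_tensor \<epsilon> G s z x \<in> carrier E"
  unfolding E_elem pure_tensor_def by (rule bexI[of _ "frag_of (z, x)"]) auto

lemma pure_add_left: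
  assumes "x \<in> carrier G"
  shows "pure_tensor \<epsilon> G s (z + w) x = pure_tensor \<epsilon> G s z x \<otimes>\<^bsub>E\<^esub> pure_tensor \<epsilon> G s w x"
proof -
  have "frag_of (z + w, x) - (frag_of (z, x) + frag_of (w, x)) \<in> R"
    using assms by (intro generate.incl) (auto simp: eps_tensor_rels_def diff_diff_eq)
  then show ?thesis unfolding pure_tensor_def using assms keys_add[of "frag_of (z, x)" "frag_of (w, x)"]
    by (subst coset_add) (auto intro!: coset_eqI)
qed

lemma pure_add_right:
  assumes "x \<in> carrier G" "y \<in> carrier G"
  shows "pure_tensor \<epsilon> G s z (x \<otimes> y) = pure_tensor \<epsilon> G s z x \<otimes>\<^bsub>E\<^esub> pure_tensor \<epsilon> G s z y"
proof -
  have "frag_of (z, x \<otimes> y) - (frag_of (z, x) + frag_of (z, y)) \<in> R"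
    using assms by (intro generate.incl) (auto simp: eps_tensor_rels_def diff_diff_eq)
  then show ?thesis unfolding pure_tensor_def using assms keys_add[of "frag_of (z, x)" "frag_of (z, y)"]
    by (subst coset_add) (auto intro!: coset_eqI)
qed

lemma pure_eps:
  assumes "x \<in> carrier G"
  shows "pure_tensor \<epsilon> G s (\<epsilon> * z) x = pure_tensor \<epsilon> G s z (s x)"
proof -
  have "frag_of (\<epsilon> * z, x) - frag_of (z, s x) \<in> R"
    using assms by (intro generate.incl) (auto simp: eps_tensor_rels_def)
  then show ?thesis unfolding pure_tensor_def using assms by (intro coset_eqI) auto
qed

lemma E_induct [consumes 1, case_names one diff pure]:
  assumes X: "X \<in> carrier E" and "P \<one>\<^bsub>E\<^esub>"
    and "\<And>X Y. \<lbrakk>X \<in> carrier E; Y \<in> carrier E; P X; P Y\<rbrakk> \<Longrightarrow> P (X \<otimes>\<^bsub>E\<^esub> inv\<^bsub>E\<^esub> Y)"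
    and "\<And>z x. x \<in> carrier G \<Longrightarrow> P (pure_tensor \<epsilon> G s z x)"
  shows "P X"
proof -
  obtain c where c: "Poly_Mapping.keys c \<subseteq> UNIV \<times> carrier G" "X = R #>\<^bsub>Fr\<^esub> c"
    using X unfolding E_elem by auto
  interpret E: comm_group E by (rule E_comm)
  have "P (R #>\<^bsub>Fr\<^esub> c)" 
  proof (rule free_Abelian_group_induct[OF c(1), where P = "\<lambda>c. P (R #>\<^bsub>Fr\<^esub> c)"], goal_cases)
    case 1
    have "R #>\<^bsub>Fr\<^esub> 0 = \<one>\<^bsub>E\<^esub>"
      using group.coset_mult_one[OF comm_group.axioms(2)[OF Fr_comm], of R] subgroup.subset[OF R_subgroup]
      by (simp add: eps_tensor_def)
    then show ?case using assms(2) by simp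
  next
    case (2 x y)
    have in': "R #>\<^bsub>Fr\<^esub> x \<in> carrier E" "R #>\<^bsub>Fr\<^esub> y \<in> carrier E" "R #>\<^bsub>Fr\<^esub> (x - y) \<in> carrier E"
      unfolding E_elem using 2(1,2) by (auto intro!: bexI)
    have "(R #>\<^bsub>Fr\<^esub> (x - y)) \<otimes>\<^bsub>E\<^esub> (R #>\<^bsub>Fr\<^esub> y) = R #>\<^bsub>Fr\<^esub> x"
      using 2(1,2) by (subst coset_add) auto
    then have "R #>\<^bsub>Fr\<^esub> (x - y) = (R #>\<^bsub>Fr\<^esub> x) \<otimes>\<^bsub>E\<^esub> inv\<^bsub>E\<^esub> (R #>\<^bsub>Fr\<^esub> y)"
      using in' E.inv_solve_right by metis
    then show ?case using assms(3) in' 2 by simp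
  next
    case (3 a)
    then show ?case using assms(4)[of "snd a" "fst a"] by (auto simp: pure_tensor_def)
  qed
  then show ?thesis using c by simp
qed

lemma pure_pow:
  assumes x: "x \<in> carrier G"
  shows "pure_tensor \<epsilon> G s z x = pure_tensor \<epsilon> G s 1 x [^]\<^bsub>E\<^esub> z"
proof -
  interpret E: comm_group E by (rule E_comm)
  have 0: "pure_tensor \<epsilon> G s 0 x = \<one>\<^bsub>E\<^esub>"
    using pure_add_left[OF x, of 0 0] pure_in[OF x, of 0] E.r_cancel_one' by simp
  show ?thesis
  proof (induction z rule: int_induct[where k = 0])
    case base
    then show ?case using 0 by simp
  next
    case (step1 i)
    then show ?case using x by (simp add: pure_add_left E.int_pow_mult)
  next
    case (step2 i)
    have "pure_tensor \<epsilon> G s (i - 1) x \<otimes>\<^bsub>E\<^esub> pure_tensor \<epsilon> G s 1 x = pure_tensor \<epsilon> G s 1 x [^]\<^bsub>E\<^esub> (i - 1) \<otimes>\<^bsub>E\<^esub> pure_tensor \<epsilon> G s 1 x"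
      using step2 pure_add_left[OF x, of "i - 1" 1] E.int_pow_mult[of "pure_tensor \<epsilon> G s 1 x" "i - 1" 1] x by simp
    then show ?case using x by simp
  qed
qed

lemma pure_hom: "group_hom G E (pure_tensor \<epsilon> G s 1)"
  unfolding group_hom_def group_hom_axioms_def hom_def
  using E_comm G.is_group by (auto simp: comm_group.axioms(2) pure_add_right)

lemma pure_surj: "X \<in> carrier E \<Longrightarrow> \<exists>x\<in>carrier G. X = pure_tensor \<epsilon> G s 1 x"
proof (induction rule: E_induct)
  case one
  show ?case by (rule bexI[of _ \<one>]) (simp_all add: group_hom.hom_one[OF pure_hom])
next
  case (diff X Y)
  then obtain x y where "x \<in> carrier G" "X = pure_tensor \<epsilon> G s 1 x" "y \<in> carrier G" "Y = pure_tensor \<epsilon> G s 1 y"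
    by blast
  then show ?case
    by (intro bexI[of _ "x \<otimes> inv y"]) (simp_all add: pure_add_right group_hom.hom_inv[OF pure_hom])
next
  case (pure z x)
  then show ?case
    by (intro bexI[of _ "x [^] z"]) (simp_all add: pure_pow[of x z] group_hom.hom_int_pow[OF pure_hom])
qed

text \<open>Shows that the definite description in \<open>eps_tensor_lift\<close> denotes: the map
  on the free group kills the relations and factors through the quotient, and pure tensors determine
  the factorisation.\<close>

lemma lift:
  assumes H: "comm_group H"
    and \<phi>_in: "\<And>z x. x \<in> carrier G \<Longrightarrow> \<phi> z x \<in> carrier H"
    and \<phi>_left: "\<And>z w x. x \<in> carrier G \<Longrightarrow> \<phi> (z + w) x = \<phi> z x \<otimes>\<^bsub>H\<^esub> \<phi> w x"
    and \<phi>_right: "\<And>z x y. \<lbrakk>x \<in> carrier G; y \<in> carrier G\<rbrakk> \<Longrightarrow> \<phi> z (x \<otimes> y) = \<phi> z x \<otimes>\<^bsub>H\<^esub> \<phi> z y"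
    and \<phi>_eps: "\<And>z x. x \<in> carrier G \<Longrightarrow> \<phi> (\<epsilon> * z) x = \<phi> z (s x)"
    and x: "x \<in> carrier G"
  shows "eps_tensor_lift \<epsilon> G s H \<phi> (pure_tensor \<epsilon> G s z x) = \<phi> z x"
proof -
  interpret H: comm_group H by fact
  interpret E: comm_group E by (rule E_comm)
  interpret Fr: comm_group Fr by (rule Fr_comm)
  obtain k where k: "k \<in> hom (free_Abelian_group (UNIV \<times> carrier G)) H"
    and kf: "\<And>p. p \<in> UNIV \<times> carrier G \<Longrightarrow> k (frag_of p) = case_prod \<phi> p"
    by (rule H.free_Abelian_group_universal[of "case_prod \<phi>" "UNIV \<times> carrier G"]) (use \<phi>_in in auto)
  interpret k: group_hom Fr H k
    using k by (simp add: group_hom_def group_hom_axioms_def Fr.is_group H.is_group eps_tensor_free_def)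
  have kd: "k (a - b) = k a \<otimes>\<^bsub>H\<^esub> inv\<^bsub>H\<^esub> (k b)" if "a \<in> carrier Fr" "b \<in> carrier Fr" for a b
    using that k.hom_mult[of a "- b"] k.hom_inv[of b] by simp
  have "eps_tensor_rels \<epsilon> G s \<subseteq> kernel Fr H k"
  proof
    fix c assume c: "c \<in> eps_tensor_rels \<epsilon> G s"
    \<comment> \<open>The value of k on a biadditivity relation, written multiplicatively in
      H.\<close>
    have m: "a \<otimes>\<^bsub>H\<^esub> b \<otimes>\<^bsub>H\<^esub> inv\<^bsub>H\<^esub> a \<otimes>\<^bsub>H\<^esub> inv\<^bsub>H\<^esub> b = \<one>\<^bsub>H\<^esub>" if "a \<in> carrier H" "b \<in> carrier H" for a b
    proof -
      have "a \<otimes>\<^bsub>H\<^esub> b \<otimes>\<^bsub>H\<^esub> inv\<^bsub>H\<^esub> a = b" using that by (simp add: H.m_comm[of a b] H.m_assoc)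
      then show ?thesis using that by simp
    qed
    have "k c = \<one>\<^bsub>H\<^esub>"
      using c unfolding eps_tensor_rels_def
      by (auto simp: kd kf \<phi>_left \<phi>_right \<phi>_eps \<phi>_in m)
    then show "c \<in> kernel Fr H k" using c rels_in by (auto simp: kernel_def simp del: Fr_simps(1))
  qed
  then have R: "R \<subseteq> kernel Fr H k" by (rule Fr.generate_subgroup_incl[OF _ k.subgroup_kernel])
  have "k a = k b" if "a \<in> carrier Fr" "b \<in> carrier Fr" "R #>\<^bsub>Fr\<^esub> a = R #>\<^bsub>Fr\<^esub> b" for a b
  proof -
    have "a \<in> R #>\<^bsub>Fr\<^esub> b" using Fr.rcos_self[OF that(1) R_subgroup] that(3) by simp
    then obtain r where r: "r \<in> R" "a = r \<otimes>\<^bsub>Fr\<^esub> b" by (auto simp: r_coset_def)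
    then have "k r = \<one>\<^bsub>H\<^esub>" "r \<in> carrier Fr" using R by (auto simp: kernel_def)
    then show ?thesis using r(2) that(2) k.hom_mult[of r b] k.hom_closed[of b] by simp
  qed
  then obtain g where g: "g \<in> hom E H" and gk: "\<And>c. c \<in> carrier Fr \<Longrightarrow> g (R #>\<^bsub>Fr\<^esub> c) = k c"
    using FactGroup_universal[OF k.homh R_normal] unfolding eps_tensor_def by metis
  let ?P = "\<lambda>h. h \<in> hom E H \<and> h \<in> extensional (carrier E) \<and>
        (\<forall>z. \<forall>x\<in>carrier G. h (pure_tensor \<epsilon> G s z x) = \<phi> z x)"
  have "\<exists>!h. ?P h"
  proof (rule ex1I[of _ "restrict g (carrier E)"])
    have "g (pure_tensor \<epsilon> G s z x) = \<phi> z x" if "x \<in> carrier G" for z x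
      using gk[of "frag_of (z, x)"] kf[of "(z, x)"] that by (simp add: pure_tensor_def)
    then show "?P (restrict g (carrier E))"
      using g by (auto simp: hom_def)
  next
    fix h assume h: "?P h"
    interpret h: group_hom E H h using h by (simp add: group_hom_def group_hom_axioms_def E.is_group H.is_group)
    interpret g: group_hom E H g using g by (simp add: group_hom_def group_hom_axioms_def E.is_group H.is_group)
    show "h = restrict g (carrier E)"
    proof (rule extensionalityI[of _ "carrier E"])
      show "h X = restrict g (carrier E) X" if X: "X \<in> carrier E" for X
      proof -
        have "h X = g X" using X
        proof (induction rule: E_induct)
          case (pure z x)
          then show ?case using h gk[of "frag_of (z, x)"] kf[of "(z, x)"] by (simp add: pure_tensor_def)
        qed simp_all
        then show ?thesis using X by simp
      qed
    qed (use h in auto)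
  qed
  from theI'[OF this] show ?thesis unfolding eps_tensor_lift_def using x by blast
qed

end

context duality
begin

lemma eps_tensor_TD2: "x \<in> Ob A \<Longrightarrow> eps_tensor_group (TD2_grp A D x) (\<sigma> x x)"
  unfolding eps_tensor_group_def eps_tensor_group_axioms_def TD2_grp_def
  by (simp add: Hgrp_comm_group Hgrp_carrier)

lemma TD2_map_eq: "TD2_map A D x y f v = Cmp A x (fobj D y) (fobj D x) (fmor D y x f) (Cmp A x y (fobj D y) v f)"
  by (simp add: TD2_map_def)

lemma SD2_Tmap:
  assumes x: "x \<in> Ob A" "y \<in> Ob A" "f \<in> Hom A x y" and a: "a \<in> Hom A y (fobj D y)"
  shows "Tmap (SD2 A D \<sigma> \<epsilon>) x y f (pure_tensor \<epsilon> (TD2_grp A D y) (\<sigma> y y) z a) =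
    pure_tensor \<epsilon> (TD2_grp A D x) (\<sigma> x x) z (TD2_map A D x y f a)"
proof -
  interpret X: eps_tensor_group "TD2_grp A D x" "\<sigma> x x" \<epsilon> by (rule eps_tensor_TD2[OF x(1)])
  interpret Y: eps_tensor_group "TD2_grp A D y" "\<sigma> y y" \<epsilon> by (rule eps_tensor_TD2[OF x(2)])
  have c: "carrier (TD2_grp A D x) = Hom A x (fobj D x)" "carrier (TD2_grp A D y) = Hom A y (fobj D y)"
    using x by (simp_all add: TD2_grp_def Hgrp_carrier)
  have m: "TD2_map A D x y f v \<in> Hom A x (fobj D x)" if "v \<in> Hom A y (fobj D y)" for v
    using x that by (simp add: TD2_map_eq)
  show ?thesis unfolding SD2_def SD2_grp_def form_functor.simps
  proof (rule Y.lift[OF X.E_comm], goal_cases)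
    case (1 z v)
    then show ?case using m by (simp add: c)
  next
    case (2 z w v)
    then show ?case using m by (simp add: c X.pure_add_left)
  next
    case (3 z v w)
    have "TD2_map A D x y f (v \<otimes>\<^bsub>TD2_grp A D y\<^esub> w) = TD2_map A D x y f v \<otimes>\<^bsub>TD2_grp A D x\<^esub> TD2_map A D x y f w"
      using 3 x by (simp add: c TD2_map_eq) (simp add: TD2_grp_def)
    then show ?case using 3 m by (simp add: c X.pure_add_right)
  next
    case (4 z v)
    have "\<sigma> x x (TD2_map A D x y f v) = TD2_map A D x y f (\<sigma> y y v)"
      using 4 x by (simp add: c TD2_map_eq sig_conj)
    then show ?case using 4 m X.pure_eps[of "TD2_map A D x y f v" z] by (simp add: c)
  next
    case 5
    then show ?case using a by (simp add: c)
  qed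
qed

lemma norm_pure:
  assumes \<epsilon>: "\<epsilon> \<in> {-1, 1}" and x: "x \<in> Ob A" and a: "a \<in> Hom A x (fobj D x)"
  shows "SD2_norm A D \<sigma> \<epsilon> x (pure_tensor \<epsilon> (TD2_grp A D x) (\<sigma> x x) z a) =
    (a \<otimes>\<^bsub>Hgrp A x (fobj D x)\<^esub> (\<sigma> x x a [^]\<^bsub>Hgrp A x (fobj D x)\<^esub> \<epsilon>)) [^]\<^bsub>Hgrp A x (fobj D x)\<^esub> z"
proof -
  interpret X: eps_tensor_group "TD2_grp A D x" "\<sigma> x x" \<epsilon> by (rule eps_tensor_TD2[OF x])
  have c: "carrier (TD2_grp A D x) = Hom A x (fobj D x)"
    using x by (simp add: TD2_grp_def Hgrp_carrier)
  have sig: "\<sigma> x x (v \<otimes>\<^bsub>TD2_grp A D x\<^esub> w) = \<sigma> x x v \<otimes>\<^bsub>TD2_grp A D x\<^esub> \<sigma> x x w"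
    if "v \<in> Hom A x (fobj D x)" "w \<in> Hom A x (fobj D x)" for v w
    using that x by (simp add: TD2_grp_def)
  show ?thesis unfolding SD2_norm_def TD2_grp_def[symmetric]
  proof (rule X.lift[OF X.G.comm_group_axioms], goal_cases)
    case (1 z v)
    then show ?case by simp
  next
    case (2 z w v)
    then show ?case by (simp add: X.G.int_pow_mult)
  next
    case (3 z v w)
    then show ?case by (simp add: c sig) (simp add: X.G.int_pow_distrib X.G.m_ac flip: c)
  next
    \<comment> \<open>Compatibility with the tensor relation: the norm of \<sigma>(v) is \<sigma>(v)
      + \<epsilon> v, which is \<epsilon> times the norm of v because \<epsilon> is its own
      inverse.\<close>
    case (4 z v)
    then have v: "v \<in> Hom A x (fobj D x)" by (simp add: c)
    show ?case using \<epsilon>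
    proof (elim insertE emptyE)
      assume "\<epsilon> = 1"
      then show ?thesis using 4 v x \<sigma>_inverse[OF x x v] by (simp add: X.G.m_comm)
    next
      assume "\<epsilon> = -1"
      then show ?thesis using 4 v x \<sigma>_inverse[OF x x v]
        by (simp add: X.G.int_pow_neg X.G.int_pow_inv X.G.inv_mult_group flip: X.G.int_pow_inv)
    qed
  qed (use a in \<open>simp_all add: c\<close>)
qed

lemma hermitian_SD2:
  assumes \<epsilon>: "\<epsilon> \<in> {-1, 1}"
  shows "hermitian A D \<sigma> (SD2 A D \<sigma> \<epsilon>) (\<lambda>x. pure_tensor \<epsilon> (TD2_grp A D x) (\<sigma> x x) 1) \<epsilon>"
proof (rule hermitian.intro[OF duality_axioms hermitian_axioms.intro], goal_cases)
  case (2 x)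
  then show ?case using eps_tensor_group.E_comm[OF eps_tensor_TD2] by (simp add: SD2_def SD2_grp_def)
next
  case (3 x a)
  then show ?case using eps_tensor_group.pure_in[OF eps_tensor_TD2[OF 3(1)], of a]
    by (simp add: SD2_def SD2_grp_def TD2_grp_def Hgrp_carrier)
next
  case (4 x a b)
  then show ?case using eps_tensor_group.pure_add_right[OF eps_tensor_TD2[OF 4(1)], of a b]
    by (simp add: SD2_def SD2_grp_def TD2_grp_def Hgrp_carrier)
next
  case (5 x u)
  then show ?case using eps_tensor_group.pure_surj[OF eps_tensor_TD2[OF 5(1)], of u]
    by (simp add: SD2_def SD2_grp_def TD2_grp_def Hgrp_carrier)
next
  case (6 x a)
  \<comment> \<open>1 \<otimes> \<sigma>(a) = \<epsilon> \<otimes> a, and this is \<epsilon> times 1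
    \<otimes> a.\<close>
  then show ?case using eps_tensor_group.pure_eps[OF eps_tensor_TD2[OF 6(1)], of a \<epsilon> 1]
      eps_tensor_group.pure_pow[OF eps_tensor_TD2[OF 6(1)], of a \<epsilon> \<epsilon>]
    by (simp add: SD2_def SD2_grp_def TD2_grp_def Hgrp_carrier)
next
  case (7 x y f a)
  then show ?case using SD2_Tmap by (simp add: TD2_map_eq)
next
  case (8 x a)
  interpret group "Hgrp A x (fobj D x)" using 8 Hgrp_group by simp
  have "a \<in> carrier (Hgrp A x (fobj D x))" "\<sigma> x x a \<in> carrier (Hgrp A x (fobj D x))"
    using 8 by (simp_all add: Hgrp_carrier)
  then show ?case using norm_pure[OF \<epsilon> 8, of 1] by (simp add: SD2_def)
qed (use \<epsilon> in simp_all)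

lemma hermitian_SbarD2:
  assumes \<epsilon>: "\<epsilon> \<in> {-1, 1}"
  shows "hermitian A D \<sigma> (SbarD2 A D \<sigma> \<epsilon>)
    (\<lambda>x a. a \<otimes>\<^bsub>Hgrp A x (fobj D x)\<^esub> (\<sigma> x x a [^]\<^bsub>Hgrp A x (fobj D x)\<^esub> \<epsilon>)) \<epsilon>"
proof -
  interpret S: hermitian A D \<sigma> "SD2 A D \<sigma> \<epsilon>" "\<lambda>x. pure_tensor \<epsilon> (TD2_grp A D x) (\<sigma> x x) 1" \<epsilon>
    by (rule hermitian_SD2[OF \<epsilon>])
  let ?n = "\<lambda>x a. a \<otimes>\<^bsub>Hgrp A x (fobj D x)\<^esub> (\<sigma> x x a [^]\<^bsub>Hgrp A x (fobj D x)\<^esub> \<epsilon>)"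
  have n: "?n x a = a \<otimes>\<^bsub>Hgrp A x (fobj D x)\<^esub> S.eneg x (fobj D x) (\<sigma> x x a)"
    if "x \<in> Ob A" "a \<in> Hom A x (fobj D x)" for x a using that by (simp add: S.pow_eps)
  have c: "carrier (Tgrp (SbarD2 A D \<sigma> \<epsilon>) x) = ?n x ` Hom A x (fobj D x)" if x: "x \<in> Ob A" for x
  proof -
    have 1: "carrier (Tgrp (SD2 A D \<sigma> \<epsilon>) x) = pure_tensor \<epsilon> (TD2_grp A D x) (\<sigma> x x) 1 ` Hom A x (fobj D x)"
      using S.\<tau>_surj[OF x] S.\<tau>_in[OF x] by blast
    have 2: "SD2_norm A D \<sigma> \<epsilon> x (pure_tensor \<epsilon> (TD2_grp A D x) (\<sigma> x x) 1 a) = ?n x a"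
      if "a \<in> Hom A x (fobj D x)" for a using S.Tform_\<tau>[OF x that] by (simp add: SD2_def)
    have "carrier (Tgrp (SbarD2 A D \<sigma> \<epsilon>) x) = SD2_norm A D \<sigma> \<epsilon> x ` carrier (Tgrp (SD2 A D \<sigma> \<epsilon>) x)"
      by (simp add: SbarD2_def SD2_def)
    then show ?thesis unfolding 1 image_image using 2 by (simp cong: image_cong)
  qed
  have g: "Tgrp (SbarD2 A D \<sigma> \<epsilon>) x = (Hgrp A x (fobj D x))\<lparr>carrier := ?n x ` Hom A x (fobj D x)\<rparr>"
    if "x \<in> Ob A" for x using c[OF that] by (simp add: SbarD2_def TD2_grp_def)
  have add: "?n x (a \<otimes>\<^bsub>Hgrp A x (fobj D x)\<^esub> b) = ?n x a \<otimes>\<^bsub>Hgrp A x (fobj D x)\<^esub> ?n x b"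
    if "x \<in> Ob A" "a \<in> Hom A x (fobj D x)" "b \<in> Hom A x (fobj D x)" for x a b
    using n[of x "a \<otimes>\<^bsub>Hgrp A x (fobj D x)\<^esub> b"] n[of x a] n[of x b] that
    by simp (simp add: add_ac)
  have sub: "subgroup (?n x ` Hom A x (fobj D x)) (Hgrp A x (fobj D x))" if x: "x \<in> Ob A" for x
  proof -
    have "group_hom (Hgrp A x (fobj D x)) (Hgrp A x (fobj D x)) (?n x)"
      unfolding group_hom_def group_hom_axioms_def hom_def
      using x add by (auto simp: Hgrp_group Hgrp_carrier n)
    from group_hom.img_is_subgroup[OF this] show ?thesis using x by (simp add: Hgrp_carrier)
  qed
  show ?thesis
  proof (rule hermitian.intro[OF duality_axioms hermitian_axioms.intro], goal_cases)
    case (2 x)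
    then interpret comm_group "Hgrp A x (fobj D x)" using Hgrp_comm_group by simp
    show ?case unfolding g[OF 2] comm_group_def
      using subgroup.subgroup_is_group[OF sub[OF 2]] submonoid_is_comm_monoid[OF subgroup.subgroup_is_submonoid[OF sub[OF 2]]]
      by (simp add: is_group)
  next
    case (3 x a)
    then show ?case by (simp add: c)
  next
    case (4 x a b)
    then show ?case using add[OF 4] by (simp add: g)
  next
    case (5 x u)
    then show ?case by (auto simp: c)
  next
    case (6 x a)
    then interpret group "Hgrp A x (fobj D x)" using Hgrp_group by simp
    have "?n x (\<sigma> x x a) = ?n x a [^]\<^bsub>Hgrp A x (fobj D x)\<^esub> \<epsilon>"
      using 6 by (simp add: n S.pow_eps \<sigma>_inverse add_comm)
    then show ?case unfolding g[OF 6(1)] using int_pow_consistent[OF sub[OF 6(1)], of "?n x a" \<epsilon>] 6 by simp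
  next
    case (7 x y f a)
    then show ?case by (simp add: SbarD2_def TD2_map_eq n sig_conj S.pow_eps)
  next
    case (8 x a)
    then show ?case by (simp add: SbarD2_def)
  qed (use \<epsilon> in simp_all)
qed

end
section \<open>The equivalence\<close>

lemma isomorphic_full_subcat:
  "\<lbrakk>a \<in> S; b \<in> S; isomorphic C a b\<rbrakk> \<Longrightarrow> isomorphic (full_subcat C S) a b"
  by (simp add: isomorphic_def invertible_def is_inverse_def full_subcat_def)

lemma Pol_simps [simp]:
  "Ob (Pol N B n) = {F. is_functor N B F \<and> F \<in> pol_below N B (Suc n)}"
  "Hom (Pol N B n) = nat_trans N B"
  "Idn (Pol N B n) = Idn (Fct N B)"
  "Cmp (Pol N B n) = Cmp (Fct N B)"
  by (auto simp: Pol_def full_subcat_def)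

lemma category_Pol: "category B \<Longrightarrow> category (Pol N B n)"
  unfolding Pol_def by (rule category.category_full_subcat[OF category_Fct])

context hermitian
begin

context
  fixes B :: "('bo, 'bm, 'w) addcat_scheme"
  assumes B: "abelian_category B"
begin

interpretation B: abelian_category B by (rule B)
interpretation S: shift_functor Nt pN AS "Pr2 A" B \<Phi> by (rule shift_functor_\<Phi>[OF B])

definition hob :: "'ao \<Rightarrow> 'ao \<times> 't" where "hob X = hyp X \<one>\<^bsub>Tgrp T X\<^esub>"

lemma hob_ob [simp]: "X \<in> Ob A \<Longrightarrow> hob X \<in> Ob M"
  by (simp add: hob_def)

lemma fst_hob [simp]: "fst (hob X) = Sum A X (fobj D X)"
  by (simp add: hob_def)

text \<open>X is a retract of the object underlying \<open>hob X\<close>, so a natural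
  transformation on A is determined by its values there, and a given \<beta> extends to X by
  conjugating \<beta> (hob X) with inclusion and projection.\<close>

lemma precomp_bij:
  assumes F: "is_functor AS B F" and G: "is_functor AS B G"
  shows "bij_betw (\<lambda>\<alpha>. \<lambda>a\<in>Ob M. \<alpha> (fst a)) (nat_trans AS B F G)
    (nat_trans Nt B (comp_func Nt F \<Phi>) (comp_func Nt G \<Phi>))"
proof -
  have [simp]: "fobj F X \<in> Ob B" "fobj G X \<in> Ob B" if "X \<in> Ob A" for X
    using is_functorD(2)[OF F] is_functorD(2)[OF G] that by simp_all
  have [simp]: "fmor F X Y f \<in> Hom B (fobj F X) (fobj F Y)" "fmor G X Y f \<in> Hom B (fobj G X) (fobj G Y)"
    if "X \<in> Ob A" "Y \<in> Ob A" "f \<in> Hom A X Y" for X Y f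
    using is_functorD(3)[OF F] is_functorD(3)[OF G] that by simp_all
  have FI [simp]: "fmor F X X (Idn A X) = Idn B (fobj F X)" "fmor G X X (Idn A X) = Idn B (fobj G X)" if "X \<in> Ob A" for X
    using is_functorD(4)[OF F] is_functorD(4)[OF G] that by simp_all
  have Fc: "fmor F X Z (Cmp A X Y Z g f) = Cmp B (fobj F X) (fobj F Y) (fobj F Z) (fmor F Y Z g) (fmor F X Y f)"
    "fmor G X Z (Cmp A X Y Z g f) = Cmp B (fobj G X) (fobj G Y) (fobj G Z) (fmor G Y Z g) (fmor G X Y f)"
    if "X \<in> Ob A" "Y \<in> Ob A" "Z \<in> Ob A" "f \<in> Hom A X Y" "g \<in> Hom A Y Z" for X Y Z f g
    using is_functorD(5)[OF F] is_functorD(5)[OF G] that by simp_all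
  let ?H = "\<lambda>X. Sum A X (fobj D X)" and ?i = "\<lambda>X. In1 A X (fobj D X)" and ?r = "\<lambda>X. Pr1 A X (fobj D X)"
  have ext: "\<alpha> X = Cmp B (fobj F X) (fobj G (?H X)) (fobj G X) (fmor G (?H X) X (?r X))
      (Cmp B (fobj F X) (fobj F (?H X)) (fobj G (?H X)) (\<alpha> (?H X)) (fmor F X (?H X) (?i X)))"
    if \<alpha>: "\<alpha> \<in> nat_trans AS B F G" and X: "X \<in> Ob A" for \<alpha> X
  proof -
    have a: "\<alpha> Y \<in> Hom B (fobj F Y) (fobj G Y)" if "Y \<in> Ob A" for Y using nat_transD(2)[OF \<alpha>] that by simp
    have e: "Cmp B (fobj G X) (fobj G (?H X)) (fobj G X) (fmor G (?H X) X (?r X)) (fmor G X (?H X) (?i X)) = Idn B (fobj G X)"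
      using X by (simp flip: Fc)
    show ?thesis
      using nat_transD(3)[OF \<alpha>, of X "?H X" "?i X"] B.Cmp_cong_assoc[OF e, of "fobj F X" "\<alpha> X"] X a by simp
  qed
  show ?thesis
  proof (rule bij_betwI')
    fix \<alpha> \<beta> assume \<alpha>: "\<alpha> \<in> nat_trans AS B F G" and \<beta>: "\<beta> \<in> nat_trans AS B F G"
    show "(\<lambda>a\<in>Ob M. \<alpha> (fst a)) = (\<lambda>a\<in>Ob M. \<beta> (fst a)) \<longleftrightarrow> \<alpha> = \<beta>"
    proof
      assume eq: "(\<lambda>a\<in>Ob M. \<alpha> (fst a)) = (\<lambda>a\<in>Ob M. \<beta> (fst a))"
      have H: "\<alpha> (?H X) = \<beta> (?H X)" if "X \<in> Ob A" for X using fun_cong[OF eq, of "hob X"] that by simp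
      show "\<alpha> = \<beta>"
      proof (rule extensionalityI[of _ "Ob AS"])
        fix X assume "X \<in> Ob AS"
        then have X: "X \<in> Ob A" by simp
        show "\<alpha> X = \<beta> X" unfolding ext[OF \<alpha> X] ext[OF \<beta> X] H[OF X] ..
      qed (use nat_transD(1)[OF \<alpha>] nat_transD(1)[OF \<beta>] in auto)
    qed simp
  next
    fix \<alpha> assume "\<alpha> \<in> nat_trans AS B F G"
    from S.nat_trans_precomp[OF this]
    show "(\<lambda>a\<in>Ob M. \<alpha> (fst a)) \<in> nat_trans Nt B (comp_func Nt F \<Phi>) (comp_func Nt G \<Phi>)"
      by (simp cong: restrict_cong)
  next
    fix \<beta> assume \<beta>: "\<beta> \<in> nat_trans Nt B (comp_func Nt F \<Phi>) (comp_func Nt G \<Phi>)"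
    have b [simp]: "\<beta> a \<in> Hom B (fobj F (fst a)) (fobj G (fst a))" if "a \<in> Ob M" for a
      using nat_transD(2)[OF \<beta>] that by simp
    have b' [simp]: "\<beta> (hob X) \<in> Hom B (fobj F (?H X)) (fobj G (?H X))" if "X \<in> Ob A" for X
      using b[of "hob X"] that by simp
    \<comment> \<open>Fullness of \<Phi> makes \<beta> natural for all arrows of A between
      underlying objects. In particular, \<beta> a depends on the form of a only through its
      underlying object.\<close>
    have nat: "Cmp B (fobj F (fst a)) (fobj G (fst a)) (fobj G (fst b)) (fmor G (fst a) (fst b) f) (\<beta> a) =
        Cmp B (fobj F (fst a)) (fobj F (fst b)) (fobj G (fst b)) (\<beta> b) (fmor F (fst a) (fst b) f)"
      if ab: "a \<in> Ob M" "b \<in> Ob M" "f \<in> Hom A (fst a) (fst b)" for a b f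
    proof -
      obtain \<phi> where "\<phi> \<in> tilde_hom M a b" "fmor \<Phi> a b \<phi> = f" using \<Phi>_full[OF ab] by blast
      then show ?thesis using nat_transD(3)[OF \<beta>, of a b \<phi>] ab by simp
    qed
    define \<alpha> where "\<alpha> = (\<lambda>X\<in>Ob A. Cmp B (fobj F X) (fobj G (?H X)) (fobj G X) (fmor G (?H X) X (?r X))
      (Cmp B (fobj F X) (fobj F (?H X)) (fobj G (?H X)) (\<beta> (hob X)) (fmor F X (?H X) (?i X))))"
    have Gri: "Cmp B Z (fobj G (?H X)) (fobj G X) (fmor G (?H X) X (?r X)) (Cmp B Z (fobj G X) (fobj G (?H X)) (fmor G X (?H X) (?i X)) k) = k"
      if "X \<in> Ob A" "Z \<in> Ob B" "k \<in> Hom B Z (fobj G X)" for X Z k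
    proof -
      have e: "Cmp B (fobj G X) (fobj G (?H X)) (fobj G X) (fmor G (?H X) X (?r X)) (fmor G X (?H X) (?i X)) = Idn B (fobj G X)"
        using that by (simp flip: Fc)
      show ?thesis using B.Cmp_cong_assoc[OF e, of Z k] that by simp
    qed
    have "\<alpha> \<in> nat_trans AS B F G"
    proof (rule nat_transI, goal_cases)
      case (3 X Y f)
      then have [simp]: "X \<in> Ob A" "Y \<in> Ob A" "f \<in> Hom A X Y" by simp_all
      \<comment> \<open>f extended by zero to an arrow between the two hyperbolic objects, where the
        naturality of \<beta> can be used.\<close>
      let ?g = "Cmp A (?H X) Y (?H Y) (?i Y) (Cmp A (?H X) X Y f (?r X))"
      have n: "Cmp B (fobj F (?H X)) (fobj G (?H X)) (fobj G (?H Y)) (fmor G (?H X) (?H Y) ?g) (\<beta> (hob X)) =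
          Cmp B (fobj F (?H X)) (fobj F (?H Y)) (fobj G (?H Y)) (\<beta> (hob Y)) (fmor F (?H X) (?H Y) ?g)"
        using nat[of "hob X" "hob Y" ?g] by simp
      have r: "fmor F X (?H Y) (Cmp A X (?H X) (?H Y) ?g (?i X)) = fmor F X (?H Y) (Cmp A X Y (?H Y) (?i Y) f)"
        by simp
      have "Cmp B (fobj F X) (fobj G X) (fobj G Y) (fmor G X Y f) (\<alpha> X) =
        Cmp B (fobj F X) (fobj G (?H Y)) (fobj G Y) (fmor G (?H Y) Y (?r Y))
          (Cmp B (fobj F X) (fobj F (?H X)) (fobj G (?H Y)) (Cmp B (fobj F (?H X)) (fobj G (?H X)) (fobj G (?H Y)) (fmor G (?H X) (?H Y) ?g) (\<beta> (hob X)))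
            (fmor F X (?H X) (?i X)))"
        by (simp add: \<alpha>_def Fc Gri)
      also have "\<dots> = Cmp B (fobj F X) (fobj G (?H Y)) (fobj G Y) (fmor G (?H Y) Y (?r Y))
          (Cmp B (fobj F X) (fobj F (?H Y)) (fobj G (?H Y)) (\<beta> (hob Y)) (fmor F X (?H Y) (Cmp A X (?H X) (?H Y) ?g (?i X))))"
        unfolding n by (subst Fc(1)[of X "?H X" "?H Y"]) simp_all
      also have "\<dots> = Cmp B (fobj F X) (fobj F Y) (fobj G Y) (\<alpha> Y) (fmor F X Y f)"
        unfolding r by (simp add: \<alpha>_def Fc)
      finally show ?case by simp
    qed (auto simp: \<alpha>_def)
    moreover have "\<beta> = (\<lambda>a\<in>Ob M. \<alpha> (fst a))"
    proof (rule extensionalityI[of _ "Ob M"])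
      fix a assume a: "a \<in> Ob M"
      \<comment> \<open>Naturality along the inclusion a -> \<open>hob (fst a)\<close>; the
        projection then cancels the inclusion.\<close>
      show "\<beta> a = (\<lambda>a\<in>Ob M. \<alpha> (fst a)) a"
        using a nat[of a "hob (fst a)" "?i (fst a)", symmetric] by (simp add: \<alpha>_def Gri)
    qed (use nat_transD(1)[OF \<beta>] in auto)
    ultimately show "\<exists>\<alpha>\<in>nat_trans AS B F G. \<beta> = (\<lambda>a\<in>Ob M. \<alpha> (fst a))" by blast
  qed
qed

text \<open>Up to the choice of lifts along the full functor \<open>\<Phi>\<close>, \<open>F\<close> is defined on all arrows of \<open>A\<close>
  between objects that carry a nondegenerate form; the value of the extension at \<open>X\<close> is the image
  of the idempotent that projects the hyperbolic object \<open>X \<oplus> D X\<close> onto \<open>X\<close>.\<close>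

lemma pol_descends:
  assumes F: "F \<in> pol_below Nt B k"
  shows "\<exists>G. G \<in> pol_below AS B k \<and> is_functor AS B G \<and> isomorphic (Fct Nt B) (comp_func Nt G \<Phi>) F"
proof -
  have Fun: "is_functor Nt B F" by (rule S.N.pol_below_functor[OF F])
  define L where "L a b f = (SOME \<phi>. \<phi> \<in> tilde_hom M a b \<and> fmor \<Phi> a b \<phi> = f)" for a b f
  have L: "L a b f \<in> tilde_hom M a b" "fmor \<Phi> a b (L a b f) = f"
    if "a \<in> Ob M" "b \<in> Ob M" "f \<in> Hom A (fst a) (fst b)" for a b f
    using someI_ex[of "\<lambda>\<phi>. \<phi> \<in> tilde_hom M a b \<and> fmor \<Phi> a b \<phi> = f"] \<Phi>_full[OF that] unfolding L_def by blast+
  define Fh where "Fh a b f = fmor F a b (L a b f)" for a b f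
  have Fo [simp]: "fobj F a \<in> Ob B" if "a \<in> Ob M" for a using is_functorD(2)[OF Fun] that by simp
  have Fh_in [simp]: "Fh a b f \<in> Hom B (fobj F a) (fobj F b)" if "a \<in> Ob M" "b \<in> Ob M" "f \<in> Hom A (fst a) (fst b)" for a b f
    using is_functorD(3)[OF Fun] that L[OF that] by (simp add: Fh_def)
  have Fh: "fmor F a b \<phi> = Fh a b (fmor \<Phi> a b \<phi>)" if "a \<in> Ob M" "b \<in> Ob M" "\<phi> \<in> tilde_hom M a b" for a b \<phi>
    unfolding Fh_def using that L[of a b "fmor \<Phi> a b \<phi>"] is_functorD(3)[OF \<Phi>_functor, of a b \<phi>]
    by (intro pol_factors[OF B F]) auto
  have Fhc: "Fh a c (Cmp A (fst a) (fst b) (fst c) g f) = Cmp B (fobj F a) (fobj F b) (fobj F c) (Fh b c g) (Fh a b f)"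
    if "a \<in> Ob M" "b \<in> Ob M" "c \<in> Ob M" "f \<in> Hom A (fst a) (fst b)" "g \<in> Hom A (fst b) (fst c)" for a b c f g
    using that L[of a b f] L[of b c g] is_functorD(5)[OF Fun, of a b c "L a b f" "L b c g"]
      is_functorD(5)[OF \<Phi>_functor, of a b c "L a b f" "L b c g"]
      Fh[of a c "tilde_cmp M a b c (L b c g) (L a b f)"] category.Cmp_in[OF category_Nt, of a b c "L a b f" "L b c g"]
    by (simp flip: Fh_def)
  have FhI: "Fh a a (Idn A (fst a)) = Idn B (fobj F a)" if "a \<in> Ob M" for a
    using that Fh[of a a "tilde_unit M a a (Idn A (fst a))"] is_functorD(4)[OF Fun, of a] is_functorD(4)[OF \<Phi>_functor, of a]
      category.Idn_in[OF category_Nt, of a] by simp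
  let ?H = "\<lambda>X. Sum A X (fobj D X)" and ?i = "\<lambda>X. In1 A X (fobj D X)" and ?r = "\<lambda>X. Pr1 A X (fobj D X)"
  \<comment> \<open>Arrows of A extended by zero to hyperbolic objects. They compose, but the
    identity of X becomes the projection onto X, so the assignment is only a semifunctor.\<close>
  let ?e = "\<lambda>X Y f. Cmp A (?H X) Y (?H Y) (?i Y) (Cmp A (?H X) X Y f (?r X))"
  let ?K = "\<lambda>X. fobj F (hob X)" and ?Km = "\<lambda>X Y f. Fh (hob X) (hob Y) (?e X Y f)"
  have K_in [simp]: "?Km X Y f \<in> Hom B (?K X) (?K Y)" if "X \<in> Ob A" "Y \<in> Ob A" "f \<in> Hom A X Y" for X Y f
    using Fh_in[of "hob X" "hob Y"] that by simp
  have Fhc': "Cmp B (fobj F a) (fobj F b) (fobj F c) (Fh b c g) (Fh a b f) = Fh a c (Cmp A x y z g f)"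
    if "a \<in> Ob M" "b \<in> Ob M" "c \<in> Ob M" "fst a = x" "fst b = y" "fst c = z" "f \<in> Hom A x y" "g \<in> Hom A y z" for a b c f g x y z
    using Fhc[of a b c f g] that by simp
  have "\<exists>G q h. B.splits_semifunctor AS ?K ?Km G q h"
  proof (rule B.semifunctor_splits[OF category_AS], goal_cases)
    case (3 X Y Z f g)
    then show ?case by (subst Fhc'[of "hob X" "hob Y" "hob Z" "?H X" "?H Y" "?H Z"]) auto
  qed auto
  then obtain G q h where *: "B.splits_semifunctor AS ?K ?Km G q h"
    by blast
  have G: "is_functor AS B G"
    and q [simp]: "\<And>X. X \<in> Ob A \<Longrightarrow> q X \<in> Hom B (?K X) (fobj G X)"
    and h [simp]: "\<And>X. X \<in> Ob A \<Longrightarrow> h X \<in> Hom B (fobj G X) (?K X)"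
    and qh: "\<And>X. X \<in> Ob A \<Longrightarrow> Cmp B (fobj G X) (?K X) (fobj G X) (q X) (h X) = Idn B (fobj G X)"
    and hq: "\<And>X. X \<in> Ob A \<Longrightarrow> Cmp B (?K X) (fobj G X) (?K X) (h X) (q X) = ?Km X X (Idn A X)"
    and Gm: "\<And>X Y f. \<lbrakk>X \<in> Ob A; Y \<in> Ob A; f \<in> Hom A X Y\<rbrakk> \<Longrightarrow> fmor G X Y f =
      Cmp B (fobj G X) (?K X) (fobj G Y) (Cmp B (?K X) (?K Y) (fobj G Y) (q Y) (?Km X Y f)) (h X)"
    using * by (simp_all add: B.splits_semifunctor_def)
  have Go [simp]: "fobj G X \<in> Ob B" if "X \<in> Ob A" for X using is_functorD(2)[OF G] that by simp
  have G\<Phi>: "is_functor Nt B (comp_func Nt G \<Phi>)" by (rule S.is_functor_precomp[OF G])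
  \<comment> \<open>F a and G (fst a) split the same idempotent of F (hob (fst a)): the former
    through inclusion and projection of the underlying object of a, the latter by
    construction.\<close>
  define \<alpha> where "\<alpha> a = Cmp B (fobj G (fst a)) (?K (fst a)) (fobj F a) (Fh (hob (fst a)) a (?r (fst a))) (h (fst a))" for a
  define \<beta> where "\<beta> a = Cmp B (fobj F a) (?K (fst a)) (fobj G (fst a)) (q (fst a)) (Fh a (hob (fst a)) (?i (fst a)))" for a
  have ri [simp]: "Fh (hob (fst a)) a (?r (fst a)) \<in> Hom B (?K (fst a)) (fobj F a)"
    "Fh a (hob (fst a)) (?i (fst a)) \<in> Hom B (fobj F a) (?K (fst a))" if "a \<in> Ob M" for a
    using Fh_in[of "hob (fst a)" a "?r (fst a)"] Fh_in[of a "hob (fst a)" "?i (fst a)"] that by simp_all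
  have \<alpha> [simp]: "\<alpha> a \<in> Hom B (fobj G (fst a)) (fobj F a)" and \<beta> [simp]: "\<beta> a \<in> Hom B (fobj F a) (fobj G (fst a))"
    if "a \<in> Ob M" for a using that by (simp_all add: \<alpha>_def \<beta>_def)
  have \<beta>\<alpha>: "Cmp B (fobj G (fst a)) (fobj F a) (fobj G (fst a)) (\<beta> a) (\<alpha> a) = Idn B (fobj G (fst a))" if a: "a \<in> Ob M" for a
  proof -
    let ?x = "fst a"
    have e: "Cmp B (?K ?x) (fobj F a) (?K ?x) (Fh a (hob ?x) (?i ?x)) (Fh (hob ?x) a (?r ?x)) =
        Cmp B (?K ?x) (fobj G ?x) (?K ?x) (h ?x) (q ?x)"
      using a by (simp add: hq, subst Fhc'[of "hob ?x" a "hob ?x" "?H ?x" ?x "?H ?x"]) auto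
    have "Cmp B (fobj G ?x) (fobj F a) (fobj G ?x) (\<beta> a) (\<alpha> a) = Cmp B (fobj G ?x) (?K ?x) (fobj G ?x) (q ?x)
       (Cmp B (fobj G ?x) (?K ?x) (?K ?x) (Cmp B (?K ?x) (fobj G ?x) (?K ?x) (h ?x) (q ?x)) (h ?x))"
      unfolding e[symmetric] using a by (simp add: \<alpha>_def \<beta>_def)
    also have "\<dots> = Idn B (fobj G ?x)" using a by (simp add: qh)
    finally show ?thesis .
  qed
  have \<alpha>\<beta>: "Cmp B (fobj F a) (fobj G (fst a)) (fobj F a) (\<alpha> a) (\<beta> a) = Idn B (fobj F a)" if a: "a \<in> Ob M" for a
  proof -
    let ?x = "fst a"
    have "Cmp B (fobj F a) (fobj G ?x) (fobj F a) (\<alpha> a) (\<beta> a) =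
      Cmp B (fobj F a) (?K ?x) (fobj F a) (Fh (hob ?x) a (?r ?x)) (Cmp B (fobj F a) (?K ?x) (?K ?x)
        (?Km ?x ?x (Idn A ?x)) (Fh a (hob ?x) (?i ?x)))"
      unfolding hq[OF M_obD(1)[OF a], symmetric] using a by (simp add: \<alpha>_def \<beta>_def)
    also have "\<dots> = Fh a a (Idn A ?x)"
      using a Fhc'[of a "hob ?x" "hob ?x" ?x "?H ?x" "?H ?x" "?i ?x" "?e ?x ?x (Idn A ?x)"]
        Fhc'[of a "hob ?x" a ?x "?H ?x" ?x "?i ?x" "?r ?x"] by simp
    finally show ?thesis using FhI[OF a] by simp
  qed
  have nat: "Cmp B (fobj G (fst a)) (fobj F a) (fobj F b) (fmor F a b \<phi>) (\<alpha> a) =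
      Cmp B (fobj G (fst a)) (fobj G (fst b)) (fobj F b) (\<alpha> b) (fmor G (fst a) (fst b) (fmor \<Phi> a b \<phi>))"
    if ab: "a \<in> Ob M" "b \<in> Ob M" "\<phi> \<in> tilde_hom M a b" for a b \<phi>
  proof -
    let ?x = "fst a" and ?y = "fst b" and ?f = "fmor \<Phi> a b \<phi>"
    have f [simp]: "?f \<in> Hom A ?x ?y" using is_functorD(3)[OF \<Phi>_functor, of a b \<phi>] ab by simp
    have [simp]: "Fh a b ?f \<in> Hom B (fobj F a) (fobj F b)" using ab by simp
    have 1: "Cmp B (?K ?x) (fobj F a) (fobj F b) (Fh a b ?f) (Fh (hob ?x) a (?r ?x)) = Fh (hob ?x) b (Cmp A (?H ?x) ?x ?y ?f (?r ?x))"
      using ab by (subst Fhc'[of "hob ?x" a b "?H ?x" ?x ?y]) auto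
    have 2: "Cmp B (?K ?x) (?K ?y) (fobj F b) (Fh (hob ?y) b (?r ?y)) (Cmp B (?K ?x) (?K ?y) (?K ?y) (?Km ?y ?y (Idn A ?y)) (?Km ?x ?y ?f)) =
        Fh (hob ?x) b (Cmp A (?H ?x) ?x ?y ?f (?r ?x))"
      using ab Fhc'[of "hob ?x" "hob ?y" "hob ?y" "?H ?x" "?H ?y" "?H ?y" "?e ?x ?y ?f" "?e ?y ?y (Idn A ?y)"]
        Fhc'[of "hob ?x" "hob ?y" b "?H ?x" "?H ?y" ?y "?e ?x ?y ?f" "?r ?y"] by simp
    have "Cmp B (fobj G ?x) (fobj F a) (fobj F b) (fmor F a b \<phi>) (\<alpha> a) =
        Cmp B (fobj G ?x) (?K ?x) (fobj F b) (Cmp B (?K ?x) (fobj F a) (fobj F b) (Fh a b ?f) (Fh (hob ?x) a (?r ?x))) (h ?x)"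
      using ab by (simp add: \<alpha>_def Fh)
    also have "\<dots> = Cmp B (fobj G ?x) (?K ?x) (fobj F b)
        (Cmp B (?K ?x) (?K ?y) (fobj F b) (Fh (hob ?y) b (?r ?y)) (Cmp B (?K ?x) (?K ?y) (?K ?y) (Cmp B (?K ?y) (fobj G ?y) (?K ?y) (h ?y) (q ?y)) (?Km ?x ?y ?f))) (h ?x)"
      unfolding 1 2[symmetric] using ab by (simp only: hq M_obD)
    also have "\<dots> = Cmp B (fobj G ?x) (fobj G ?y) (fobj F b) (\<alpha> b) (fmor G ?x ?y ?f)"
      using ab K_in[of ?x ?y ?f] by (simp add: \<alpha>_def Gm del: K_in)
    finally show ?thesis .
  qed
  have iso: "isomorphic (Fct Nt B) (comp_func Nt G \<Phi>) F"
    by (rule isomorphic_Fct[where \<alpha> = \<alpha> and \<beta> = \<beta>]) (use G\<Phi> Fun \<beta>\<alpha> \<alpha>\<beta> nat B.category_axioms in auto)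
  \<comment> \<open>The isomorphism also gives the degree of G: its restriction is a retract of F,
    hence polynomial, and this is detected on \<open>Nt\<close>.\<close>
  then obtain s r where sr: "s \<in> nat_trans Nt B (comp_func Nt G \<Phi>) F" "r \<in> nat_trans Nt B F (comp_func Nt G \<Phi>)"
    and rs: "Cmp (Fct Nt B) (comp_func Nt G \<Phi>) F (comp_func Nt G \<Phi>) r s = Idn (Fct Nt B) (comp_func Nt G \<Phi>)"
    unfolding isomorphic_def invertible_def is_inverse_def Fct_simps(2) by blast
  have "Cmp B (fobj (comp_func Nt G \<Phi>) y) (fobj F y) (fobj (comp_func Nt G \<Phi>) y) (r y) (s y) =
      Idn B (fobj (comp_func Nt G \<Phi>) y)" if "y \<in> Ob Nt" for y
    using fun_cong[OF rs, of y] that by simp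
  then have "S.N.retract_of (comp_func Nt G \<Phi>) F"
    unfolding S.N.retract_of_def using sr by blast
  then have "comp_func Nt G \<Phi> \<in> pol_below Nt B k" by (rule S.N.pol_below_retract[OF F G\<Phi>])
  then have "G \<in> pol_below AS B k" by (rule S.pol_below_if_precomp[OF G])
  then show ?thesis using G iso by blast
qed

theorem pol_equivalence:
  "is_equivalence (Pol AS B n) (Pol Nt B n) (precomp_func (Pol AS B n) Nt \<Phi>)"
proof (rule equivalence_if_ff_es)
  show cA: "category (Pol AS B n)" and "category (Pol Nt B n)"
    by (rule category_Pol, rule B.category_axioms)+
  have o: "comp_func Nt F \<Phi> \<in> Ob (Pol Nt B n)" if "F \<in> Ob (Pol AS B n)" for F
    using that S.is_functor_precomp S.pol_below_precomp by (simp del: pol_below.simps)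
  show "is_functor (Pol AS B n) (Pol Nt B n) (precomp_func (Pol AS B n) Nt \<Phi>)"
    unfolding precomp_func_def
  proof (rule is_functor_mk_func[OF cA], goal_cases)
    case (1 F)
    then show ?case by (rule o)
  next
    case (2 F G \<alpha>)
    then show ?case using S.nat_trans_precomp by simp
  next
    case (3 F)
    then show ?case by (simp del: pol_below.simps cong: restrict_cong)
  next
    case (4 F G H \<alpha> \<beta>)
    then show ?case by (simp del: pol_below.simps cong: restrict_cong)
  qed
  fix F G assume F: "F \<in> Ob (Pol AS B n)" and G: "G \<in> Ob (Pol AS B n)"
  have m: "fmor (precomp_func (Pol AS B n) Nt \<Phi>) F G \<alpha> = (\<lambda>a\<in>Ob M. \<alpha> (fst a))" if "\<alpha> \<in> nat_trans AS B F G" for \<alpha>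
    using F G that by (simp add: precomp_func_def cong: restrict_cong del: pol_below.simps)
  have h: "Hom (Pol AS B n) F G = nat_trans AS B F G"
    "Hom (Pol Nt B n) (fobj (precomp_func (Pol AS B n) Nt \<Phi>) F) (fobj (precomp_func (Pol AS B n) Nt \<Phi>) G) =
      nat_trans Nt B (comp_func Nt F \<Phi>) (comp_func Nt G \<Phi>)"
    using F G by (simp_all add: precomp_func_def del: pol_below.simps)
  show "bij_betw (fmor (precomp_func (Pol AS B n) Nt \<Phi>) F G) (Hom (Pol AS B n) F G)
      (Hom (Pol Nt B n) (fobj (precomp_func (Pol AS B n) Nt \<Phi>) F) (fobj (precomp_func (Pol AS B n) Nt \<Phi>) G))"
    unfolding h by (subst bij_betw_cong[OF m]) (use precomp_bij[of F G] F G in auto)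
next
  fix F assume "F \<in> Ob (Pol Nt B n)"
  then have F: "F \<in> pol_below Nt B (Suc n)" by simp
  obtain G where G: "G \<in> pol_below AS B (Suc n)" "is_functor AS B G" "isomorphic (Fct Nt B) (comp_func Nt G \<Phi>) F"
    using pol_descends[OF F] by blast
  have "isomorphic (Pol Nt B n) (comp_func Nt G \<Phi>) F"
    unfolding Pol_def by (rule isomorphic_full_subcat[OF S.pol_below_precomp[OF G(1)] F G(3)])
  then show "\<exists>G\<in>Ob (Pol AS B n). isomorphic (Pol Nt B n) (fobj (precomp_func (Pol AS B n) Nt \<Phi>) G) F"
    using G by (intro bexI[of _ G]) (simp_all add: precomp_func_def del: pol_below.simps)
qed

end

end

theorem proposition6p17:
  fixes A :: "('ao, 'am) addcat"
    and D :: "('ao, 'am, 'ao, 'am) func"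
    and \<sigma> :: "'ao \<Rightarrow> 'ao \<Rightarrow> 'am \<Rightarrow> 'am"
    and \<epsilon> :: int
    and B :: "('bo, 'bm) addcat"
    and n :: nat
  assumes "duality A D \<sigma>"
    and "\<epsilon> \<in> {-1, 1}"
    and "abelian_category B"
  shows "is_equivalence
           (Pol (dsum_smcat A) B n)
           (Pol (tilde (herm A D (SD2 A D \<sigma> \<epsilon>))) B n)
           (precomp_func (Pol (dsum_smcat A) B n)
              (tilde (herm A D (SD2 A D \<sigma> \<epsilon>))) (herm_forget_ext A D (SD2 A D \<sigma> \<epsilon>)))
       \<and> is_equivalence
           (Pol (dsum_smcat A) B n)
           (Pol (tilde (herm A D (SbarD2 A D \<sigma> \<epsilon>))) B n)
           (precomp_func (Pol (dsum_smcat A) B n)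
              (tilde (herm A D (SbarD2 A D \<sigma> \<epsilon>))) (herm_forget_ext A D (SbarD2 A D \<sigma> \<epsilon>)))"
  using hermitian.pol_equivalence[OF duality.hermitian_SD2[OF assms(1,2)] assms(3)]
    hermitian.pol_equivalence[OF duality.hermitian_SbarD2[OF assms(1,2)] assms(3)] by blast

end
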